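(* Let $k\ge 1$, $0\le l\le k$, $\mathbf m\in\mathbb Z_{\ge 0}^k$, and let $0\leftarrow L_{l,k}\leftarrow F_0\leftarrow F_1\leftarrow\cdots$ be the BGG resolution of $L_{l,k}$. Then $$\sum_{p\ge 0}(-1)^p\,\mathrm{ch}_q\bigl(\mathbb C\otimes_{U(\mathfrak n)}(F_p\otimes V_{\mathbf m})\bigr)^0=\sum_{p\ge 0}q^{(k+2)p^2+(l+1)p}K_{2(k+2)p+l,\mathbf m}(q)-\sum_{p>0}q^{(k+2)p^2-(l+1)p}K_{2(k+2)p-l-2,\mathbf m}(q).$$
   Context: Let $e,h,f$ be the standard basis of $\mathfrak{sl}_2$ and $x_i=x\otimes t^i$. $\widehat{\mathfrak{sl}}_2=\mathfrak{sl}_2\otimes\mathbb C[t,t^{-1}]\oplus\mathbb CK\oplus\mathbb Cd$, $K$ central, $[d,x_i]=-ix_i$; $\mathfrak h=\mathrm{span}\{h_0,K,d\}$; $\mathfrak n=\mathfrak{sl}_2\otimes t^{-1}\mathbb C[t^{-1}]\oplus\mathbb Cf_0$. $L_{l,k}$ is the irreducible integrable highest weight module with highest weight $(l,k,0)$, where $(i,k,m)\in\mathfrak h^*$ takes values $i,k,m$ on $h_0,K,d$. $W$ is the Weyl group of $\widehat{\mathfrak{sl}}_2$ with simple reflections $s_0,s_1$ and length function $l(w)$; its shifted action $w*\lambda=w(\lambda+\rho)-\rho$, $\rho=(1,2,0)$, is given by $s_0*(i,k,m)=(-i+2k+2,k,m+k-i+1)$, $s_1*(i,k,m)=(-i-2,k,m)$.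 The BGG resolution has $F_p=\bigoplus_{l(w)=p}M(w*(l,k,0))$, with $M(\lambda)$ the Verma module of highest weight $\lambda$ (the highest weight vector having $h_0,K,d$-eigenvalues given by $\lambda$; each $F_p$ is a free $U(\mathfrak n)$-module). Fusion products: $\pi_a$ is the $(a+1)$-dimensional irreducible $\mathfrak{sl}_2$-module. Given $a_1,\ldots,a_n\ge 0$ fix pairwise distinct $z_1,\ldots,z_n\in\mathbb C$ and form the tensor product of evaluation modules $\pi_{a_i}(z_i)$ of $\mathfrak{sl}_2\otimes\mathbb C[t]$ ($x_r$ acts on the $i$-th factor as $z_i^r x$). Let $v_A$ be the tensor product of the lowest weight vectors and $F_s=\mathrm{span}\{x^{(1)}_{i_1}\cdots x^{(t)}_{i_t}v_A: x^{(j)}\in\mathfrak{sl}_2,\ i_1+\cdots+i_t\le s\}$. The fusion product $\pi_{a_1}*\cdots*\pi_{a_n}$ is the associated graded $\mathfrak{sl}_2\otimes\mathbb C[t]$-module $\bigoplus_sF_s/F_{s-1}$ of this filtration (independent of the $z_i$ up to graded isomorphism), with $F_s/F_{s-1}$ in $q$-degree $s$. $V_{\mathbf m}$ is the fusion product containing $m_i$ copies of $\pi_i$ for each $i$, regarded as an $\mathfrak{sl}_2\otimes\mathbb C[t^{-1}]$-module by letting $x_{-i}$ act as the original $x_i$. The superscript $0$ denotes the zero eigenspace of $h_0$; $\mathrm{ch}_q=\sum_sq^s\dim(\text{degree }s)$ for the $q$-grading given by the $d$-eigenvalue on $F_p$ plus the $q$-degree on $V_{\mathbf m}$. $K_{l,\mathbf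 m}(q)$ is the Kostka polynomial for $\mathfrak{sl}_2$, i.e. the $q$-multiplicity of $\pi_l$ in $V_{\mathbf m}$: $K_{l,\mathbf m}(q)=\sum_sq^s\dim\mathrm{Hom}_{\mathfrak{sl}_2}(\pi_l,V_{\mathbf m}[s])$, where $V_{\mathbf m}[s]$ is the $q$-degree $s$ component. *)

theory Defs
  imports
    Complex_Main
    "HOL-Library.Poly_Mapping"
    "HOL-Library.Product_Plus"
    "HOL-Computational_Algebra.Formal_Laurent_Series"
begin

section \<open>Complex vector spaces with a basis, and their subquotients\<close>

type_synonym 'i cvec = "'i \<Rightarrow>\<^sub>0 complex"

definition scal :: "complex \<Rightarrow> 'i cvec \<Rightarrow> 'i cvec" where
  "scal c = Poly_Mapping.map ((*) c)"

lemma lookup_scal [simp]: "Poly_Mapping.lookup (scal c v) i = c * Poly_Mapping.lookup v i"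
  unfolding scal_def by transfer (auto simp: when_def)

global_interpretation cvec: vector_space "scal :: complex \<Rightarrow> 'i cvec \<Rightarrow> 'i cvec"
  by standard (auto intro!: poly_mapping_eqI simp: lookup_add algebra_simps)

abbreviation basis_vec :: "'i \<Rightarrow> 'i cvec" where
  "basis_vec i \<equiv> Poly_Mapping.single i 1"

definition lin_ext :: "('i \<Rightarrow> 'j cvec) \<Rightarrow> 'i cvec \<Rightarrow> 'j cvec" where
  "lin_ext g v = (\<Sum>i\<in>Poly_Mapping.keys v. scal (Poly_Mapping.lookup v i) (g i))"

definition tens :: "'i cvec \<Rightarrow> 'j cvec \<Rightarrow> ('i \<times> 'j) cvec" (infixr \<open>\<otimes>\<close> 72) where
  "u \<otimes> v = lin_ext (\<lambda>i. lin_ext (\<lambda>j. basis_vec (i, j)) v) u"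

text \<open>
  The quotient of a subspace \<open>S\<close> by a subspace \<open>N\<close> of \<open>S\<close> is handled through representatives.
  The set \<open>B\<close> below is a set of representatives of a basis of this quotient. As for the library's
  \<open>dim\<close>, infinite dimension is reported as \<open>0\<close>.
\<close>

definition qdim :: "'i cvec set \<Rightarrow> 'i cvec set \<Rightarrow> nat" where
  "qdim S N = card (SOME B. cvec.independent B \<and> cvec.span B \<inter> N = {0} \<and> cvec.span (B \<union> N) = S)"


section \<open>The Lie algebras\<close>

datatype sl2 = E | H | F

fun sl2_bracket :: "sl2 \<Rightarrow> sl2 \<Rightarrow> sl2 cvec" where
  "sl2_bracket E F = basis_vec H"
| "sl2_bracket F E = - basis_vec H"
| "sl2_bracket H E = scal 2 (basis_vec E)"
| "sl2_bracket E H = - scal 2 (basis_vec E)"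
| "sl2_bracket H F = - scal 2 (basis_vec F)"
| "sl2_bracket F H = scal 2 (basis_vec F)"
| "sl2_bracket _ _ = 0"

text \<open>The trace form of the two-dimensional representation.\<close>

fun sl2_form :: "sl2 \<Rightarrow> sl2 \<Rightarrow> complex" where
  "sl2_form E F = 1"
| "sl2_form F E = 1"
| "sl2_form H H = 2"
| "sl2_form _ _ = 0"

text \<open>The basis \<open>x\<^sub>i = x \<otimes> t\<^sup>i\<close>, \<open>K\<close>, \<open>d\<close> of the affine Lie algebra; the type of its elements
  is \<open>aff cvec\<close>.\<close>

datatype aff = Loop sl2 int | Central | Deg

fun aff_bracket :: "aff \<Rightarrow> aff \<Rightarrow> aff cvec" where
  "aff_bracket (Loop x i) (Loop y j) =
     lin_ext (\<lambda>z. basis_vec (Loop z (i + j))) (sl2_bracket x y)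
     + (if i + j = 0 then scal (of_int i * sl2_form x y) (basis_vec Central) else 0)"
| "aff_bracket Deg (Loop x i) = - scal (of_int i) (basis_vec (Loop x i))"
| "aff_bracket (Loop x i) Deg = scal (of_int i) (basis_vec (Loop x i))"
| "aff_bracket _ _ = 0"

text \<open>\<open>n\<close> is spanned by \<open>n_minus\<close>; its opposite, spanned by \<open>n_plus\<close>, annihilates highest weight
  vectors.\<close>

definition n_minus :: "aff set" where
  "n_minus = {Loop x i |x i. i < 0} \<union> {Loop F 0}"

definition n_plus :: "aff set" where
  "n_plus = {Loop x i |x i. i > 0} \<union> {Loop E 0}"


section \<open>Enveloping algebras\<close>

text \<open>The free associative algebra on a basis of \<open>g\<close>, i.e. the tensor algebra of \<open>g\<close>, is the
  monoid algebra of the monoid of words. Its elements act on every \<open>g\<close>-module, and \<open>U(g)\<close> is its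
  quotient by \<open>env_ideal\<close>.\<close>

datatype 'a free_word = Word (letters: "'a list")

instantiation free_word :: (type) monoid_add
begin

definition zero_free_word :: "'a free_word" where
  "0 = Word []"

definition plus_free_word :: "'a free_word \<Rightarrow> 'a free_word \<Rightarrow> 'a free_word" where
  "u + v = Word (letters u @ letters v)"

instance
  by standard (auto simp: zero_free_word_def plus_free_word_def)

end

type_synonym free_alg = "aff free_word cvec"

definition gen :: "aff \<Rightarrow> free_alg" where
  "gen b = basis_vec (Word [b])"

definition env_ideal :: "free_alg set" where
  "env_ideal = cvec.span {u * (gen b * gen c - gen c * gen b - lin_ext gen (aff_bracket b c)) * v
                          |u v b c. True}"

definition augmentation :: "free_alg \<Rightarrow> complex" where
  "augmentation u = Poly_Mapping.lookup u 0"

text \<open>The tensor algebra of \<open>n\<close>, whose image in \<open>U(g)\<close> is \<open>U(n)\<close>.\<close>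

definition free_alg_n :: "free_alg set" where
  "free_alg_n = {u. \<forall>w\<in>Poly_Mapping.keys u. set (letters w) \<subseteq> n_minus}"


section \<open>Modules\<close>

text \<open>A module is the quotient \<open>upper / lower\<close>, the operators \<open>act b\<close> (given by linear operators on
  the ambient space) representing the basis elements of the Lie algebra. For a module over a proper
  subalgebra only the values of \<open>act\<close> at elements of that subalgebra are meaningful.\<close>

record 'i lmod =
  upper :: "'i cvec set"
  lower :: "'i cvec set"
  act :: "aff \<Rightarrow> 'i cvec \<Rightarrow> 'i cvec"

definition free_alg_act :: "'i lmod \<Rightarrow> free_alg \<Rightarrow> 'i cvec \<Rightarrow> 'i cvec" where
  "free_alg_act M u v =
     (\<Sum>w\<in>Poly_Mapping.keys u. scal (Poly_Mapping.lookup u w) (foldr (act M) (letters w) v))"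

definition direct_sum :: "'w set \<Rightarrow> ('w \<Rightarrow> 'i lmod) \<Rightarrow> ('w \<times> 'i) lmod" where
  "direct_sum I M =
     \<lparr>upper = cvec.span {basis_vec w \<otimes> v |w v. w \<in> I \<and> v \<in> upper (M w)},
      lower = cvec.span {basis_vec w \<otimes> v |w v. w \<in> I \<and> v \<in> lower (M w)},
      act = (\<lambda>b. lin_ext (\<lambda>(w, i). basis_vec w \<otimes> act (M w) b (basis_vec i)))\<rparr>"

text \<open>The tensor product of \<open>S/N\<close> and \<open>S'/N'\<close> is \<open>(S \<otimes> S') / (N \<otimes> S' + S \<otimes> N')\<close>.\<close>

definition tensor_mod :: "'i lmod \<Rightarrow> 'j lmod \<Rightarrow> ('i \<times> 'j) lmod" where
  "tensor_mod M V =
     \<lparr>upper = cvec.span {u \<otimes> v |u v. u \<in> upper M \<and> v \<in> upper V},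
      lower = cvec.span ({u \<otimes> v |u v. u \<in> lower M \<and> v \<in> upper V}
                         \<union> {u \<otimes> v |u v. u \<in> upper M \<and> v \<in> lower V}),
      act = (\<lambda>b. lin_ext (\<lambda>(i, j). act M b (basis_vec i) \<otimes> basis_vec j
                                   + basis_vec i \<otimes> act V b (basis_vec j)))\<rparr>"

text \<open>\<open>\<complex> \<otimes>\<^bsub>U(n)\<^esub> M\<close>: in \<open>\<complex> \<otimes> M = M\<close> the element \<open>1 \<cdot> u \<otimes> v\<close>, which is \<open>augmentation u\<close> times \<open>v\<close>,
  is identified with \<open>1 \<otimes> u v\<close> for all \<open>u\<close> in \<open>U(n)\<close>.\<close>

definition trivial_tensor_Un :: "'i lmod \<Rightarrow> 'i lmod" where
  "trivial_tensor_Un M =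
     M\<lparr>lower := cvec.span (lower M \<union>
         {scal (augmentation u) v - free_alg_act M u v |u v. u \<in> free_alg_n \<and> v \<in> upper M})\<rparr>"

text \<open>The generating function of the dimensions of the \<open>d\<close>-eigenspaces of the zero eigenspace of
  \<open>h\<^sub>0\<close>.\<close>

definition ch_q0 :: "'i lmod \<Rightarrow> int fls" where
  "ch_q0 M = Abs_fls (\<lambda>s. int (qdim
     {v \<in> upper M. act M (Loop H 0) v \<in> lower M \<and> act M Deg v - scal (of_int s) v \<in> lower M}
     (lower M)))"


section \<open>Weyl group, Verma modules, and the terms of the BGG resolution\<close>

text \<open>A weight is given by its values on \<open>h\<^sub>0\<close>, \<open>K\<close>, \<open>d\<close>.\<close>

type_synonym weight = "complex \<times> complex \<times> complex"

definition rho :: weight where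
  "rho = (1, 2, 0)"

text \<open>The linear action of the simple reflections; the shifted action of \<open>s\<^sub>0\<close> and \<open>s\<^sub>1\<close> is computed
  in the two lemmas below.\<close>

definition s0 :: "weight \<Rightarrow> weight" where
  "s0 = (\<lambda>(i, k, m). (2 * k - i, k, m + k - i))"

definition s1 :: "weight \<Rightarrow> weight" where
  "s1 = (\<lambda>(i, k, m). (- i, k, m))"

definition weyl_word :: "(weight \<Rightarrow> weight) list \<Rightarrow> weight \<Rightarrow> weight" where
  "weyl_word ss = foldr (\<circ>) ss id"

definition weyl_group :: "(weight \<Rightarrow> weight) set" where
  "weyl_group = {weyl_word ss |ss. set ss \<subseteq> {s0, s1}}"

definition weyl_length :: "(weight \<Rightarrow> weight) \<Rightarrow> nat" where
  "weyl_length w = (LEAST n. \<exists>ss. set ss \<subseteq> {s0, s1} \<and> length ss = n \<and> weyl_word ss = w)"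

definition shifted :: "(weight \<Rightarrow> weight) \<Rightarrow> weight \<Rightarrow> weight" where
  "shifted w mu = w (mu + rho) - rho"

lemma shifted_s0: "shifted s0 (i, k, m) = (- i + 2 * k + 2, k, m + k - i + 1)"
  by (simp add: shifted_def s0_def rho_def algebra_simps)

lemma shifted_s1: "shifted s1 (i, k, m) = (- i - 2, k, m)"
  by (simp add: shifted_def s1_def rho_def)

text \<open>\<open>M(\<lambda>)\<close> is the quotient of \<open>U(g)\<close> by the left ideal generated by \<open>n_plus\<close> and by the elements
  \<open>x - \<lambda>(x)\<close> with \<open>x\<close> in the Cartan subalgebra.\<close>

definition verma_gens :: "weight \<Rightarrow> free_alg set" where
  "verma_gens = (\<lambda>(i, k, m). gen ` n_plus \<union>
     {gen (Loop H 0) - scal i 1, gen Central - scal k 1, gen Deg - scal m 1})"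

definition verma :: "weight \<Rightarrow> aff free_word lmod" where
  "verma mu =
     \<lparr>upper = UNIV,
      lower = cvec.span (env_ideal \<union> {u * g |u g. g \<in> verma_gens mu}),
      act = (\<lambda>b v. gen b * v)\<rparr>"

text \<open>Only the modules of the resolution are needed below, not its differentials.\<close>

definition bgg_term :: "nat \<Rightarrow> nat \<Rightarrow> nat \<Rightarrow> ((weight \<Rightarrow> weight) \<times> aff free_word) lmod" where
  "bgg_term l k p = direct_sum {w \<in> weyl_group. weyl_length w = p}
     (\<lambda>w. verma (shifted w (of_nat l, of_nat k, 0)))"


section \<open>Fusion products\<close>

text \<open>The \<open>(a+1)\<close>-dimensional irreducible module \<open>\<pi>\<^sub>a\<close> has the basis \<open>v\<^sub>0, \<dots>, v\<^sub>a\<close>, where \<open>v\<^sub>0\<close> is the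
  lowest weight vector and \<open>v\<^sub>j = e\<^sup>j v\<^sub>0\<close>. Indices above \<open>a\<close> are not used.\<close>

fun irr_act :: "nat \<Rightarrow> sl2 \<Rightarrow> nat \<Rightarrow> nat cvec" where
  "irr_act a E j = (if j < a then basis_vec (j + 1) else 0)"
| "irr_act a H j = scal (2 * of_nat j - of_nat a) (basis_vec j)"
| "irr_act a F j = scal (of_nat j * (of_nat a - of_nat j + 1)) (basis_vec (j - 1))"

text \<open>In the tensor product of the \<open>\<pi>\<^bsub>as ! i\<^esub>(zs ! i)\<close> the basis vector with index \<open>js\<close> is the tensor
  product of the basis vectors with indices \<open>js ! i\<close>. The operator below is the action of \<open>x\<^sub>r\<close>,
  \<open>r \<ge> 0\<close>.\<close>

definition eval_act ::
  "nat list \<Rightarrow> complex list \<Rightarrow> sl2 \<Rightarrow> nat \<Rightarrow> nat list cvec \<Rightarrow> nat list cvec" where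
  "eval_act as zs x r = lin_ext (\<lambda>js. \<Sum>i<length as.
     scal ((zs ! i) ^ r) (lin_ext (\<lambda>j. basis_vec (js[i := j])) (irr_act (as ! i) x (js ! i))))"

definition lowest_vec :: "nat list \<Rightarrow> nat list cvec" where
  "lowest_vec as = basis_vec (replicate (length as) 0)"

text \<open>By multilinearity it suffices that the factors run over the basis of \<open>sl\<^sub>2\<close>.\<close>

definition fusion_filt :: "nat list \<Rightarrow> complex list \<Rightarrow> nat \<Rightarrow> nat list cvec set" where
  "fusion_filt as zs s = cvec.span
     {foldr (\<lambda>(x, i). eval_act as zs x i) xs (lowest_vec as) |xs. sum_list (map snd xs) \<le> s}"

definition fusion_filt_prev :: "nat list \<Rightarrow> complex list \<Rightarrow> nat \<Rightarrow> nat list cvec set" where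
  "fusion_filt_prev as zs s = (case s of 0 \<Rightarrow> {0} | Suc s' \<Rightarrow> fusion_filt as zs s')"

text \<open>The associated graded space, with \<open>basis_vec s \<otimes> v\<close> representing the class of \<open>v\<close> in degree
  \<open>s\<close>, as a module over \<open>sl\<^sub>2 \<otimes> \<complex>[t\<^sup>-\<^sup>1]\<close>: \<open>x\<^bsub>-r\<^esub>\<close> acts as the original \<open>x\<^sub>r\<close> and so maps degree \<open>s\<close>
  to degree \<open>s + r\<close>. Moreover \<open>d\<close> acts by the \<open>q\<close>-degree, so that on \<open>tensor_mod M (fusion as zs)\<close>
  it acts by the \<open>d\<close>-eigenvalue on \<open>M\<close> plus the \<open>q\<close>-degree. The remaining basis elements of the
  affine Lie algebra do not act on this module; their \<open>0\<close> is a dummy value.\<close>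

definition fusion :: "nat list \<Rightarrow> complex list \<Rightarrow> (nat \<times> nat list) lmod" where
  "fusion as zs =
     \<lparr>upper = cvec.span {basis_vec s \<otimes> v |s v. v \<in> fusion_filt as zs s},
      lower = cvec.span {basis_vec s \<otimes> v |s v. v \<in> fusion_filt_prev as zs s},
      act = (\<lambda>b. lin_ext (\<lambda>(s, js). case b of
          Loop x i \<Rightarrow> if i \<le> 0
            then basis_vec (s + nat (- i)) \<otimes> eval_act as zs x (nat (- i)) (basis_vec js) else 0
        | Deg \<Rightarrow> scal (of_nat s) (basis_vec (s, js))
        | Central \<Rightarrow> 0))\<rparr>"

text \<open>The list with \<open>m i\<close> entries \<open>i\<close> for each \<open>1 \<le> i \<le> k\<close>.\<close>

definition mult_list :: "nat \<Rightarrow> (nat \<Rightarrow> nat) \<Rightarrow> nat list" where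
  "mult_list k m = concat (map (\<lambda>i. replicate (m i) i) [1..<Suc k])"


section \<open>Kostka polynomials\<close>

text \<open>A linear map \<open>\<phi>\<close> from \<open>\<pi>\<^sub>l\<close> is stored as the sum of the \<open>v\<^sub>j \<otimes> \<phi>(v\<^sub>j)\<close>, \<open>0 \<le> j \<le> l\<close>.\<close>

definition map_apply :: "(nat \<times> 'i) cvec \<Rightarrow> nat cvec \<Rightarrow> 'i cvec" where
  "map_apply phi = lin_ext (\<lambda>j. Poly_Mapping.map_key (Pair j) phi)"

text \<open>The dimension of the space of \<open>sl\<^sub>2\<close>-homomorphisms from \<open>\<pi>\<^sub>l\<close> to \<open>S/N\<close>. Such a homomorphism is
  the class of a linear map from \<open>\<pi>\<^sub>l\<close> to \<open>S\<close> that is equivariant modulo \<open>N\<close>, and it vanishes iff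
  this map has values in \<open>N\<close>.\<close>

definition dim_hom :: "nat \<Rightarrow> (sl2 \<Rightarrow> 'i cvec \<Rightarrow> 'i cvec) \<Rightarrow> 'i cvec set \<Rightarrow> 'i cvec set \<Rightarrow> nat" where
  "dim_hom l action S N = qdim
     {phi \<in> cvec.span {basis_vec j \<otimes> v |j v. j \<le> l \<and> v \<in> S}.
        \<forall>x. \<forall>j\<le>l. map_apply phi (irr_act l x j) - action x (map_apply phi (basis_vec j)) \<in> N}
     (cvec.span {basis_vec j \<otimes> v |j v. j \<le> l \<and> v \<in> N})"

definition kostka :: "nat \<Rightarrow> nat list \<Rightarrow> complex list \<Rightarrow> int fls" where
  "kostka l as zs = fps_to_fls (Abs_fps (\<lambda>s. int (dim_hom l (\<lambda>x. eval_act as zs x 0)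
     (fusion_filt as zs s) (fusion_filt_prev as zs s))))"

end

theory Submission
  imports Defs
begin

text \<open>
  The Verma module \<open>M(\<lambda>)\<close> is free over \<open>U(n)\<close> on its highest weight vector \<open>v\<^sub>\<lambda>\<close>. Hence every class in
  \<open>\<complex> \<otimes>\<^bsub>U(n)\<^esub> (M(\<lambda>) \<otimes> V)\<close> has a unique representative \<open>v\<^sub>\<lambda> \<otimes> v\<close>, and \<open>h\<^sub>0\<close>, \<open>d\<close> act on it by their action
  on \<open>v\<close> plus \<open>\<lambda>(h\<^sub>0)\<close>, \<open>\<lambda>(d)\<close>. So the zero weight space of this module is the weight space of \<open>V\<close> of
  weight \<open>- \<lambda>(h\<^sub>0)\<close>, shifted in degree by \<open>\<lambda>(d)\<close> (lemma \<open>qdim_coinvariants\<close>, and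
  \<open>ch_q0_coinvariants\<close> for the fusion product).

  Write \<open>C\<^sub>j\<close> for the graded dimension of the weight space of weight \<open>j\<close> of the fusion product. The
  representation theory of \<open>sl\<^sub>2\<close> gives \<open>C\<^bsub>-j\<^esub> = C\<^sub>j\<close> and \<open>K\<^sub>l = C\<^sub>l - C\<^bsub>l+2\<^esub>\<close> (lemmas
  \<open>mult_series_symmetric\<close> and \<open>kostka_mult_series\<close>): a homomorphism from \<open>\<pi>\<^sub>l\<close> is a lowest weight
  vector of weight \<open>-l\<close>, and \<open>f\<close> maps the weight space of weight \<open>-l\<close> onto that of weight \<open>-l - 2\<close>.

  The Weyl group consists of the translations \<open>t\<^sup>n\<close> with \<open>t = s\<^sub>0 s\<^sub>1\<close>, of length \<open>2\<bar>n\<bar>\<close>, and of the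
  reflections \<open>t\<^sup>n s\<^sub>1\<close>, of length \<open>\<bar>2n - 1\<bar>\<close>. Their shifted action on \<open>(l, k, 0)\<close> gives the alternating
  sum of the characters as
  \<open>\<Sum>\<^sub>n q\<^bsup>(k+2)n\<^sup>2 + (l+1)n\<^esup> C\<^bsub>l + 2n(k+2)\<^esub> - \<Sum>\<^sub>n q\<^bsup>(k+2)n\<^sup>2 - (l+1)n\<^esup> C\<^bsub>2n(k+2) - l - 2\<^esub>\<close>, where \<open>n\<close> runs over all
  integers. The terms with \<open>n = p \<ge> 0\<close> of the first sum and \<open>n = -p\<close> of the second one combine to
  the first sum of the claim, the remaining ones to the second sum. All sums are finite, because the
  weights of the fusion product are bounded.

  The freeness of \<open>M(\<lambda>)\<close> is obtained without a basis of \<open>U(n)\<close>. The action of the complement of \<open>n\<close>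
  on \<open>M(\<lambda>)\<close> is determined by the commutation rules and by its action on \<open>v\<^sub>\<lambda>\<close>. Used as a
  recursion on words, these rules define operators on the tensor algebra \<open>T(n)\<close> of \<open>n\<close>. By the Jacobi
  identity they satisfy the relations of the affine algebra up to the ideal that defines \<open>U(n)\<close>,
  and they preserve this ideal. Thus \<open>U(n)\<close> itself becomes a highest weight module, and the
  resulting map \<open>normal_form\<close> from \<open>U(g)\<close> to \<open>U(n)\<close> identifies it with \<open>M(\<lambda>)\<close>.
\<close>


section \<open>Linear maps between spaces with a basis\<close>

definition clin :: "('i cvec \<Rightarrow> 'j cvec) \<Rightarrow> bool" where
  "clin f \<longleftrightarrow> (\<forall>u v. f (u + v) = f u + f v) \<and> (\<forall>c v. f (scal c v) = scal c (f v))"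

lemma clinI: "(\<And>u v. f (u + v) = f u + f v) \<Longrightarrow> (\<And>c v. f (scal c v) = scal c (f v)) \<Longrightarrow> clin f"
  by (simp add: clin_def)

lemma clin_add: "clin f \<Longrightarrow> f (u + v) = f u + f v"
  and clin_scal: "clin f \<Longrightarrow> f (scal c v) = scal c (f v)"
  by (simp_all add: clin_def)

lemma clin_iff_linear: "clin f \<longleftrightarrow> Vector_Spaces.linear scal scal f"
  by (auto simp: clin_def Vector_Spaces.linear_iff cvec.vector_space_axioms)

lemma clin_0: "clin f \<Longrightarrow> f 0 = 0"
  using clin_add[of f 0 0] by simp

lemma clin_uminus: "clin f \<Longrightarrow> f (- v) = - f v"
  using clin_add[of f v "- v"] clin_0[of f] by (simp add: eq_neg_iff_add_eq_0 add.commute)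

lemma clin_diff: "clin f \<Longrightarrow> f (u - v) = f u - f v"
  using clin_add[of f u "- v"] clin_uminus[of f v] by simp

lemma clin_sum: "clin f \<Longrightarrow> f (sum g A) = (\<Sum>a\<in>A. f (g a))"
  by (induction A rule: infinite_finite_induct) (auto simp: clin_0 clin_add)

lemma clin_comp: "clin f \<Longrightarrow> clin g \<Longrightarrow> clin (\<lambda>v. f (g v))"
  by (simp add: clin_def)

lemma clin_id: "clin (\<lambda>v. v)"
  and clin_zero: "clin (\<lambda>v. 0)"
  by (simp_all add: clin_def)

lemma clin_plus: "clin f \<Longrightarrow> clin g \<Longrightarrow> clin (\<lambda>v. f v + g v)"
  by (simp add: clin_def cvec.scale_right_distrib algebra_simps)

lemma clin_minus: "clin f \<Longrightarrow> clin g \<Longrightarrow> clin (\<lambda>v. f v - g v)"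
  by (simp add: clin_def cvec.scale_right_diff_distrib algebra_simps)

lemma clin_neg: "clin f \<Longrightarrow> clin (\<lambda>v. - f v)"
  by (simp add: clin_def)

lemma clin_scaled: "clin f \<Longrightarrow> clin (\<lambda>v. scal c (f v))"
  by (simp add: clin_def cvec.scale_right_distrib cvec.scale_left_commute)

lemma clin_setsum: "(\<And>a. a \<in> A \<Longrightarrow> clin (f a)) \<Longrightarrow> clin (\<lambda>v. \<Sum>a\<in>A. f a v)"
  by (simp add: clin_def cvec.scale_sum_right sum.distrib)

lemma clin_preimage: "clin f \<Longrightarrow> cvec.subspace Y \<Longrightarrow> cvec.subspace {v. f v \<in> Y}"
  by (auto simp: cvec.subspace_def clin_0 clin_add clin_scal)

lemma clin_image: "clin f \<Longrightarrow> cvec.subspace Y \<Longrightarrow> cvec.subspace (f ` Y)"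
  by (force simp: cvec.subspace_def clin_0 simp flip: clin_add clin_scal)

lemma clin_span_into:
  assumes "clin f" "cvec.subspace Y" "\<And>g. g \<in> G \<Longrightarrow> f g \<in> Y" "v \<in> cvec.span G"
  shows "f v \<in> Y"
proof -
  have "cvec.span G \<subseteq> {v. f v \<in> Y}"
    using assms(3) by (intro cvec.span_minimal clin_preimage assms(1,2)) auto
  with assms(4) show ?thesis by blast
qed

lemma clin_span_eq:
  assumes "clin f" "clin h" "\<And>g. g \<in> G \<Longrightarrow> f g = h g" "v \<in> cvec.span G"
  shows "f v = h v"
  using clin_span_into[OF clin_minus[OF assms(1,2)] cvec.subspace_single_0 _ assms(4)] assms(3)
  by auto

lemma lin_ext_superset:
  assumes "finite A" "Poly_Mapping.keys v \<subseteq> A"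
  shows "lin_ext g v = (\<Sum>i\<in>A. scal (Poly_Mapping.lookup v i) (g i))"
  unfolding lin_ext_def
  by (rule sum.mono_neutral_left[OF assms]) (auto simp: in_keys_iff)

lemma clin_lin_ext [intro!]: "clin (lin_ext g)"
proof (rule clinI)
  fix u v :: "'a cvec"
  define A where "A = Poly_Mapping.keys u \<union> Poly_Mapping.keys v \<union> Poly_Mapping.keys (u + v)"
  have "finite A" by (simp add: A_def)
  then have "lin_ext g w = (\<Sum>i\<in>A. scal (Poly_Mapping.lookup w i) (g i))" if "w \<in> {u, v, u + v}" for w
    using that by (intro lin_ext_superset) (auto simp: A_def)
  then show "lin_ext g (u + v) = lin_ext g u + lin_ext g v"
    by (simp add: lookup_add cvec.scale_left_distrib sum.distrib)
next
  fix c and v :: "'a cvec"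
  have "Poly_Mapping.keys (scal c v) \<subseteq> Poly_Mapping.keys v"
    by (auto simp: in_keys_iff)
  then have "lin_ext g (scal c v)
      = (\<Sum>i\<in>Poly_Mapping.keys v. scal (Poly_Mapping.lookup (scal c v) i) (g i))"
    by (intro lin_ext_superset) auto
  then show "lin_ext g (scal c v) = scal c (lin_ext g v)"
    unfolding lin_ext_def by (simp add: cvec.scale_sum_right)
qed

lemmas lin_ext_add = clin_add[OF clin_lin_ext]
  and lin_ext_scal = clin_scal[OF clin_lin_ext]
  and lin_ext_diff = clin_diff[OF clin_lin_ext]
  and lin_ext_uminus = clin_uminus[OF clin_lin_ext]
  and lin_ext_0 [simp] = clin_0[OF clin_lin_ext]

lemma lin_ext_basis [simp]: "lin_ext g (basis_vec i) = g i"
  by (simp add: lin_ext_def)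

lemma lin_ext_basis_id: "lin_ext basis_vec v = v"
  by (rule poly_mapping_eqI)
     (auto simp: lin_ext_def lookup_sum lookup_single when_def if_distrib in_keys_iff
       cong: if_cong)

lemma in_span_basis:
  assumes "Poly_Mapping.keys v \<subseteq> A"
  shows "v \<in> cvec.span (basis_vec ` A)"
proof -
  have "lin_ext basis_vec v \<in> cvec.span (basis_vec ` A)"
    unfolding lin_ext_def using assms by (intro cvec.span_sum cvec.span_scale cvec.span_base) auto
  then show ?thesis by (simp add: lin_ext_basis_id)
qed

text \<open>Only the basis vectors in the support matter. This allows identities that hold on a part of the
  basis, such as the admissible indices of a tensor product.\<close>

lemma clin_eq_keys:
  assumes "clin f" "clin h" "\<And>i. i \<in> Poly_Mapping.keys v \<Longrightarrow> f (basis_vec i) = h (basis_vec i)"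
  shows "f v = h v"
  using clin_span_eq[OF assms(1,2) _ in_span_basis[OF order_refl]] assms(3) by auto

lemma clin_eq: "clin f \<Longrightarrow> clin h \<Longrightarrow> (\<And>i. f (basis_vec i) = h (basis_vec i)) \<Longrightarrow> f v = h v"
  by (rule clin_eq_keys)

lemma clin_into_keys:
  assumes "clin f" "cvec.subspace Y" "\<And>i. i \<in> Poly_Mapping.keys v \<Longrightarrow> f (basis_vec i) \<in> Y"
  shows "f v \<in> Y"
  using clin_span_into[OF assms(1,2) _ in_span_basis[OF order_refl]] assms(3) by auto

lemma lin_ext_in: "cvec.subspace Y \<Longrightarrow> (\<And>i. i \<in> Poly_Mapping.keys v \<Longrightarrow> g i \<in> Y) \<Longrightarrow> lin_ext g v \<in> Y"
  by (rule clin_into_keys) auto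

lemma lin_ext_cong: "(\<And>i. i \<in> Poly_Mapping.keys v \<Longrightarrow> g i = h i) \<Longrightarrow> lin_ext g v = lin_ext h v"
  by (simp add: lin_ext_def)

lemma clin_lin_ext_comp: "clin f \<Longrightarrow> f (lin_ext g v) = lin_ext (\<lambda>i. f (g i)) v"
  by (rule clin_eq[where f = "\<lambda>v. f (lin_ext g v)"]) (auto intro: clin_comp)

lemma lin_ext_plus_fun: "lin_ext (\<lambda>i. g i + h i) v = lin_ext g v + lin_ext h v"
  by (simp add: lin_ext_def cvec.scale_right_distrib sum.distrib)

lemma lin_ext_minus_fun: "lin_ext (\<lambda>i. g i - h i) v = lin_ext g v - lin_ext h v"
  by (simp add: lin_ext_def cvec.scale_right_diff_distrib sum_subtractf)

lemma lin_ext_uminus_fun: "lin_ext (\<lambda>i. - g i) v = - lin_ext g v"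
  by (simp add: lin_ext_def sum_negf)

lemma lin_ext_scal_fun: "lin_ext (\<lambda>i. scal c (g i)) v = scal c (lin_ext g v)"
  by (simp add: lin_ext_def cvec.scale_sum_right mult.commute)

lemma lin_ext_zero_fun [simp]: "lin_ext (\<lambda>i. 0) v = 0"
  by (simp add: lin_ext_def)

lemma clin_lin_ext_fun: "(\<And>i. clin (g i)) \<Longrightarrow> clin (\<lambda>u. lin_ext (\<lambda>i. g i u) v)"
  unfolding lin_ext_def by (intro clin_setsum clin_scaled)


section \<open>Tensor products and their slices\<close>

lemma lookup_tens [simp]: "Poly_Mapping.lookup (u \<otimes> v) (i, j) = Poly_Mapping.lookup u i * Poly_Mapping.lookup v j"
proof -
  have inner: "Poly_Mapping.lookup (lin_ext (\<lambda>j. basis_vec (p, j)) v) (i, j)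
      = (if p = i then Poly_Mapping.lookup v j else 0)" for p
    by (auto simp: lin_ext_def lookup_sum lookup_single when_def in_keys_iff if_distrib cong: if_cong)
  have "Poly_Mapping.lookup (u \<otimes> v) (i, j) = (\<Sum>p\<in>Poly_Mapping.keys u.
      Poly_Mapping.lookup u p * Poly_Mapping.lookup (lin_ext (\<lambda>j. basis_vec (p, j)) v) (i, j))"
    unfolding tens_def by (simp add: lin_ext_def[of _ u] lookup_sum)
  also have "\<dots> = (\<Sum>p\<in>Poly_Mapping.keys u.
      if p = i then Poly_Mapping.lookup u i * Poly_Mapping.lookup v j else 0)"
    unfolding inner by (rule sum.cong) auto
  finally show ?thesis by (simp add: in_keys_iff)
qed

lemma tens_add_left: "(u + u') \<otimes> v = u \<otimes> v + u' \<otimes> v"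
  and tens_add_right: "u \<otimes> (v + v') = u \<otimes> v + u \<otimes> v'"
  and tens_scal_left: "scal c u \<otimes> v = scal c (u \<otimes> v)"
  and tens_scal_right: "u \<otimes> scal c v = scal c (u \<otimes> v)"
  and tens_diff_left: "(u - u') \<otimes> v = u \<otimes> v - u' \<otimes> v"
  and tens_diff_right: "u \<otimes> (v - v') = u \<otimes> v - u \<otimes> v'"
  by (rule poly_mapping_eqI; auto simp: lookup_add lookup_minus algebra_simps)+

lemma clin_tens_left: "clin (\<lambda>u. u \<otimes> v)" and clin_tens_right: "clin (\<lambda>v. u \<otimes> v)"
  by (auto intro!: clinI simp: tens_add_left tens_add_right tens_scal_left tens_scal_right)

lemma basis_tens_basis [simp]: "basis_vec i \<otimes> basis_vec j = basis_vec (i, j)"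
  by (rule poly_mapping_eqI) (auto simp: lookup_single when_def split: if_splits)

lemma tens_zero_left [simp]: "0 \<otimes> v = 0" and tens_zero_right [simp]: "u \<otimes> 0 = 0"
  by (simp_all add: clin_0[OF clin_tens_left] clin_0[OF clin_tens_right])

text \<open>The component of a vector of \<open>\<Oplus>\<^sub>i W\<close> at \<open>i\<close>; here the direct sum is realized as the space with
  basis vectors \<open>(i, j)\<close>.\<close>

definition slice :: "'i \<Rightarrow> ('i \<times> 'j) cvec \<Rightarrow> 'j cvec" where
  "slice i = Poly_Mapping.map_key (Pair i)"

lemma lookup_slice [simp]: "Poly_Mapping.lookup (slice i x) j = Poly_Mapping.lookup x (i, j)"
  by (simp add: slice_def map_key.rep_eq inj_on_def)

lemma clin_slice [intro!]: "clin (slice i)"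
  by (rule clinI) (auto intro!: poly_mapping_eqI simp: lookup_add)

lemma slice_basis_tens [simp]: "slice i (basis_vec i' \<otimes> v) = (if i = i' then v else 0)"
  by (auto intro!: poly_mapping_eqI simp: lookup_single when_def)

lemma sum_slices:
  assumes "finite A" "fst ` Poly_Mapping.keys x \<subseteq> A"
  shows "x = (\<Sum>i\<in>A. basis_vec i \<otimes> slice i x)"
proof (rule poly_mapping_eqI)
  fix p :: "'a \<times> 'b"
  obtain i j where p: "p = (i, j)" by force
  have "i \<notin> A \<Longrightarrow> (i, j) \<notin> Poly_Mapping.keys x" using assms by force
  then show "Poly_Mapping.lookup x p = Poly_Mapping.lookup (\<Sum>i\<in>A. basis_vec i \<otimes> slice i x) p"
    using assms(1) unfolding p
    by (auto simp: lookup_sum lookup_single when_def in_keys_iff if_distrib[of "\<lambda>x. x * _"] cong: if_cong)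
qed

text \<open>The internal direct sum of the subspaces \<open>S i\<close>. Testing membership slice by slice replaces the
  spans by which direct sums are given in the modules above.\<close>

definition dsum :: "'i set \<Rightarrow> ('i \<Rightarrow> 'j cvec set) \<Rightarrow> ('i \<times> 'j) cvec set" where
  "dsum I S = {x. \<forall>i. slice i x \<in> (if i \<in> I then S i else {0})}"

lemma dsumI: "(\<And>i. i \<in> I \<Longrightarrow> slice i x \<in> S i) \<Longrightarrow> (\<And>i. i \<notin> I \<Longrightarrow> slice i x = 0) \<Longrightarrow> x \<in> dsum I S"
  and dsum_in: "x \<in> dsum I S \<Longrightarrow> i \<in> I \<Longrightarrow> slice i x \<in> S i"
  and dsum_out: "x \<in> dsum I S \<Longrightarrow> i \<notin> I \<Longrightarrow> slice i x = 0"
  unfolding dsum_def by (auto split: if_splits)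

lemma dsum_mono: "(\<And>i. i \<in> I \<Longrightarrow> S i \<subseteq> T i) \<Longrightarrow> dsum I S \<subseteq> dsum I T"
  by (blast intro: dsumI dest: dsum_in dsum_out)

lemma subspace_dsum:
  assumes "\<And>i. i \<in> I \<Longrightarrow> cvec.subspace (S i)"
  shows "cvec.subspace (dsum I S)"
proof -
  have "cvec.subspace {x. slice i x \<in> (if i \<in> I then S i else {0})}" for i
    using assms by (intro clin_preimage) auto
  then show ?thesis
    unfolding dsum_def cvec.subspace_def by blast
qed

lemma span_dsum:
  assumes "\<And>i. i \<in> I \<Longrightarrow> cvec.subspace (S i)"
  shows "cvec.span {basis_vec i \<otimes> v |i v. i \<in> I \<and> v \<in> S i} = dsum I S" (is "cvec.span ?G = _")
proof
  show "cvec.span ?G \<subseteq> dsum I S"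
    using assms by (intro cvec.span_minimal subspace_dsum) (auto simp: dsum_def cvec.subspace_0)
next
  show "dsum I S \<subseteq> cvec.span ?G"
  proof
    fix x assume x: "x \<in> dsum I S"
    define A where "A = fst ` Poly_Mapping.keys x"
    have "i \<in> I" if "i \<in> A" for i
    proof -
      from that obtain j where "Poly_Mapping.lookup x (i, j) \<noteq> 0"
        by (force simp: A_def in_keys_iff)
      then have "slice i x \<noteq> 0" by (metis lookup_slice lookup_zero)
      with x show "i \<in> I" by (auto simp: dsum_def split: if_splits)
    qed
    then have "(\<Sum>i\<in>A. basis_vec i \<otimes> slice i x) \<in> cvec.span ?G"
      using x by (intro cvec.span_sum cvec.span_base) (force simp: dsum_def split: if_splits)
    moreover have "x = (\<Sum>i\<in>A. basis_vec i \<otimes> slice i x)"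
      by (rule sum_slices) (auto simp: A_def)
    ultimately show "x \<in> cvec.span ?G" by simp
  qed
qed


section \<open>Dimensions of quotients\<close>

definition quot_basis :: "'i cvec set \<Rightarrow> 'i cvec set \<Rightarrow> 'i cvec set \<Rightarrow> bool" where
  "quot_basis B S N \<longleftrightarrow> cvec.independent B \<and> cvec.span B \<inter> N = {0} \<and> cvec.span (B \<union> N) = S"

text \<open>In contrast to the number \<open>qdim S N\<close>, this asserts that the quotient is finite-dimensional. It
  therefore transfers along isomorphisms and adds up along filtrations.\<close>

definition has_qdim :: "'i cvec set \<Rightarrow> 'i cvec set \<Rightarrow> nat \<Rightarrow> bool" where
  "has_qdim S N n \<longleftrightarrow> (\<exists>B. finite B \<and> quot_basis B S N \<and> card B = n)"

lemma independent_Un: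
  assumes "cvec.independent B" "cvec.independent C" "finite B" "finite C" "cvec.span B \<inter> cvec.span C = {0}"
  shows "cvec.independent (B \<union> C)" "B \<inter> C = {}"
proof -
  have "B \<inter> C \<subseteq> {0}"
    using assms(5) cvec.span_base by blast
  moreover have "0 \<notin> B" using assms(1) cvec.dependent_zero by blast
  ultimately show disj: "B \<inter> C = {}" by blast
  show "cvec.independent (B \<union> C)"
  proof (rule cvec.independent_if_scalars_zero)
    fix f x assume 0: "(\<Sum>x\<in>B \<union> C. scal (f x) x) = 0" and x: "x \<in> B \<union> C"
    have eq: "(\<Sum>x\<in>B. scal (f x) x) = - (\<Sum>x\<in>C. scal (f x) x)"
      using 0 disj assms(3,4) by (simp add: sum.union_disjoint eq_neg_iff_add_eq_0)
    have "(\<Sum>x\<in>B. scal (f x) x) \<in> cvec.span B" "(\<Sum>x\<in>C. scal (f x) x) \<in> cvec.span C"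
      by (intro cvec.span_sum cvec.span_scale cvec.span_base; assumption)+
    moreover from this have "(\<Sum>x\<in>B. scal (f x) x) \<in> cvec.span C"
      using eq cvec.span_neg by simp
    ultimately have B0: "(\<Sum>x\<in>B. scal (f x) x) = 0" using assms(5) by blast
    moreover from this have "(\<Sum>x\<in>C. scal (f x) x) = 0" using eq by simp
    ultimately show "f x = 0"
      using x cvec.independentD[OF assms(1,3)] cvec.independentD[OF assms(2,4)] by blast
  qed (use assms in auto)
qed

lemma quot_basis_decomp:
  assumes "quot_basis B S N" "cvec.subspace N" "x \<in> S"
  obtains b n where "b \<in> cvec.span B" "n \<in> N" "x = b + n"
proof -
  have "x \<in> cvec.span (B \<union> N)" "cvec.span N = N" using assms by (auto simp: quot_basis_def)
  then show thesis using that by (auto simp: cvec.span_Un)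
qed

lemma quot_basis_exists:
  assumes "cvec.subspace N" "cvec.subspace S" "N \<subseteq> S"
  shows "\<exists>B. quot_basis B S N"
proof -
  obtain D where D: "D \<subseteq> N" "cvec.independent D" "N \<subseteq> cvec.span D"
    using cvec.maximal_independent_subset by blast
  obtain C where C: "D \<subseteq> C" "C \<subseteq> S" "cvec.independent C" "S \<subseteq> cvec.span C"
    using cvec.maximal_independent_subset_extend[of D S] D assms(3) by blast
  have spD: "cvec.span D = N" using D assms(1) by (metis cvec.span_subspace)
  have "x = 0" if "x \<in> cvec.span (C - D)" "x \<in> N" for x
  proof -
    have "cvec.independent D" "x \<in> cvec.span D" using D spD that by auto
    have "cvec.representation C x = cvec.representation D x"
      by (rule cvec.representation_extend[OF C(3)]) (use that spD C in auto)
    moreover have "cvec.representation C x = cvec.representation (C - D) x"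
      by (rule cvec.representation_extend[OF C(3)]) (use that in auto)
    moreover have "cvec.representation D x b \<noteq> 0 \<Longrightarrow> b \<in> D"
         "cvec.representation (C - D) x b \<noteq> 0 \<Longrightarrow> b \<in> C - D" for b
      by (blast dest: cvec.representation_ne_zero)+
    ultimately have "cvec.representation C x = (\<lambda>b. 0)" by (metis DiffE)
    moreover have "x \<in> cvec.span C" using that(1) cvec.span_mono[of "C - D" C] by blast
    ultimately show "x = 0"
      using cvec.sum_nonzero_representation_eq[OF C(3), of x] by simp
  qed
  moreover have "cvec.span (C - D \<union> N) = S"
  proof
    show "cvec.span (C - D \<union> N) \<subseteq> S" using C assms by (intro cvec.span_minimal) auto
    have "C \<subseteq> C - D \<union> N" using D by auto
    then show "S \<subseteq> cvec.span (C - D \<union> N)" using C(4) cvec.span_mono by blast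
  qed
  moreover have "cvec.independent (C - D)" using C(3) by (rule cvec.independent_mono) auto
  ultimately show ?thesis
    unfolding quot_basis_def using cvec.span_zero cvec.subspace_0[OF assms(1)]
    by (intro exI[of _ "C - D"]) auto
qed

text \<open>Modulo \<open>N\<close>, every element of \<open>C\<close> is congruent to an element of the span of \<open>B\<close>. The linear
  extension of this choice is injective on the span of \<open>C\<close>, since its kernel there lies in \<open>N\<close>.
  So the usual bound on independent subsets of a span applies.\<close>

lemma quot_basis_card_le:
  assumes B: "quot_basis B S N" "finite B" and C: "quot_basis C S N" and N: "cvec.subspace N"
  shows "finite C \<and> card C \<le> card B"
proof -
  have "\<exists>b \<in> cvec.span B. c - b \<in> N" if "c \<in> C" for c
  proof -
    have "c \<in> S" using C that by (auto simp: quot_basis_def intro: cvec.span_base)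
    then obtain b n where "b \<in> cvec.span B" "n \<in> N" "c = b + n"
      using quot_basis_decomp[OF B(1) N] by metis
    then show ?thesis by (intro bexI[of _ b]) auto
  qed
  then obtain g0 where g0: "\<And>c. c \<in> C \<Longrightarrow> g0 c \<in> cvec.span B \<and> c - g0 c \<in> N" by metis
  interpret pair: vector_space_pair "scal :: complex \<Rightarrow> 'a cvec \<Rightarrow> 'a cvec" "scal :: complex \<Rightarrow> 'a cvec \<Rightarrow> 'a cvec" ..
  have indC: "cvec.independent C" and spC: "cvec.span C \<inter> N = {0}" using C by (auto simp: quot_basis_def)
  obtain g where g: "clin g" "\<And>c. c \<in> C \<Longrightarrow> g c = g0 c"
    using pair.linear_independent_extend[OF indC, of g0] unfolding clin_iff_linear by blast
  have cong: "x - g x \<in> N" if "x \<in> cvec.span C" for x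
    by (rule clin_span_into[OF _ N _ that]) (use g g0 in \<open>auto intro: clin_minus clin_id\<close>)
  have inj: "inj_on g (cvec.span C)"
  proof (rule inj_onI)
    fix x y assume xy: "x \<in> cvec.span C" "y \<in> cvec.span C" "g x = g y"
    then have d: "x - y \<in> cvec.span C" by (simp add: cvec.span_diff)
    have "g (x - y) = 0" using xy g(1) by (simp add: clin_diff)
    with cong[OF d] d spC have "x - y \<in> {0}" by (metis IntI diff_zero)
    then show "x = y" by simp
  qed
  have "cvec.independent (g ` C)"
    using pair.linear_independent_injective_image[of g C] g(1) indC inj unfolding clin_iff_linear by blast
  moreover have "g ` C \<subseteq> cvec.span B" using g g0 by auto
  ultimately have fin: "finite (g ` C) \<and> card (g ` C) \<le> card B"
    by (intro cvec.independent_span_bound B(2))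
  moreover have "inj_on g C" using inj cvec.span_superset by (rule inj_on_subset)
  ultimately show ?thesis by (metis card_image finite_image_iff)
qed

lemma quot_basis_of_has_qdim:
  assumes "has_qdim S N n" "quot_basis C S N" "cvec.subspace N"
  shows "finite C \<and> card C = n"
proof -
  obtain B where B: "finite B" "quot_basis B S N" "card B = n" using assms(1) unfolding has_qdim_def by blast
  have "finite C \<and> card C \<le> card B" by (rule quot_basis_card_le[OF B(2,1) assms(2,3)])
  moreover from this have "card B \<le> card C"
    using quot_basis_card_le[OF assms(2) _ B(2) assms(3)] by blast
  ultimately show ?thesis using B(3) by simp
qed

lemma qdim_eqI:
  assumes "has_qdim S N n" "cvec.subspace N"
  shows "qdim S N = n"
proof -
  from assms(1) have "\<exists>B. quot_basis B S N" by (auto simp: has_qdim_def)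
  then have "quot_basis (SOME B. quot_basis B S N) S N" by (rule someI_ex)
  with quot_basis_of_has_qdim[OF assms(1) _ assms(2)] show ?thesis
    unfolding qdim_def quot_basis_def by blast
qed

lemma has_qdim_finite:
  assumes "cvec.subspace N" "cvec.subspace S" "N \<subseteq> S" "S \<subseteq> cvec.span G" "finite G"
  shows "has_qdim S N (qdim S N)"
proof -
  obtain B where B: "quot_basis B S N" using quot_basis_exists[OF assms(1-3)] by blast
  have "B \<subseteq> S" using B by (auto simp: quot_basis_def intro: cvec.span_base)
  then have "finite B"
    using cvec.independent_span_bound[OF assms(5), of B] B assms(4) by (auto simp: quot_basis_def)
  with B have "has_qdim S N (card B)" by (auto simp: has_qdim_def)
  then show ?thesis using qdim_eqI assms(1) by metis
qed

lemma has_qdim_trans: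
  assumes "has_qdim S N a" "has_qdim N P b" "cvec.subspace N" "cvec.subspace P"
  shows "has_qdim S P (a + b)"
proof -
  obtain B where B: "finite B" "quot_basis B S N" "card B = a" using assms(1) unfolding has_qdim_def by blast
  obtain C where C: "finite C" "quot_basis C N P" "card C = b" using assms(2) unfolding has_qdim_def by blast
  have CN: "cvec.span C \<subseteq> N" using C cvec.span_mono[of C "C \<union> P"] by (auto simp: quot_basis_def)
  have "cvec.span B \<inter> cvec.span C = {0}"
    using B CN by (auto simp: quot_basis_def intro: cvec.span_zero)
  then have ind: "cvec.independent (B \<union> C)" and disj: "B \<inter> C = {}"
    using independent_Un[of B C] B C by (auto simp: quot_basis_def)
  have PN: "P \<subseteq> N" using C by (auto simp: quot_basis_def intro: cvec.span_base)
  have "x = 0" if xs: "x \<in> cvec.span (B \<union> C)" "x \<in> P" for x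
  proof -
    obtain u v where uv: "u \<in> cvec.span B" "v \<in> cvec.span C" "x = u + v"
      using xs(1) unfolding cvec.span_Un by blast
    have "u = x - v" using uv by simp
    then have "u \<in> N" using xs PN uv CN cvec.subspace_diff[OF assms(3)] by blast
    then have "u = 0" using uv B by (auto simp: quot_basis_def)
    then show ?thesis using uv that C by (auto simp: quot_basis_def)
  qed
  moreover have "cvec.span (B \<union> C \<union> P) = S"
  proof -
    have "cvec.span (B \<union> (C \<union> P)) = cvec.span (B \<union> cvec.span (C \<union> P))"
      unfolding cvec.span_Un[of B] cvec.span_span ..
    also have "\<dots> = S" using B C by (simp add: quot_basis_def)
    finally show ?thesis by (simp add: Un_assoc)
  qed
  moreover have "0 \<in> cvec.span (B \<union> C)" "0 \<in> P" using cvec.subspace_0[OF assms(4)] by (auto intro: cvec.span_zero)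
  ultimately have "quot_basis (B \<union> C) S P"
    unfolding quot_basis_def using ind by auto
  then show ?thesis using B C disj
    unfolding has_qdim_def by (intro exI[of _ "B \<union> C"]) (simp add: card_Un_disjoint)
qed

definition quot_iso :: "('i cvec \<Rightarrow> 'j cvec) \<Rightarrow> 'i cvec set \<Rightarrow> 'i cvec set \<Rightarrow> 'j cvec set \<Rightarrow> 'j cvec set \<Rightarrow> bool" where
  "quot_iso L S N X Y \<longleftrightarrow> clin L \<and> cvec.subspace S \<and> cvec.subspace N \<and> N \<subseteq> S \<and> cvec.subspace X \<and> cvec.subspace Y \<and> Y \<subseteq> X
     \<and> (\<forall>x\<in>S. L x \<in> X \<and> (L x \<in> Y \<longleftrightarrow> x \<in> N)) \<and> (\<forall>y\<in>X. \<exists>x\<in>S. y - L x \<in> Y)"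

lemma quot_basis_iso:
  assumes iso: "quot_iso L S N X Y" and C: "quot_basis C S N"
  shows "quot_basis (L ` C) X Y" "inj_on L C"
proof -
  interpret pair: vector_space_pair "scal :: complex \<Rightarrow> 'a cvec \<Rightarrow> 'a cvec" "scal :: complex \<Rightarrow> 'b cvec \<Rightarrow> 'b cvec" ..
  have L: "clin L" and Y: "cvec.subspace Y" and X: "cvec.subspace X" "Y \<subseteq> X" and S: "cvec.subspace S"
    and N: "cvec.subspace N" and YN: "\<And>x. x \<in> S \<Longrightarrow> L x \<in> Y \<longleftrightarrow> x \<in> N"
    and LX: "\<And>x. x \<in> S \<Longrightarrow> L x \<in> X"
    and surj: "\<And>y. y \<in> X \<Longrightarrow> \<exists>x\<in>S. y - L x \<in> Y"
    using iso by (auto simp: quot_iso_def)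
  have indC: "cvec.independent C" and spC: "cvec.span C \<inter> N = {0}" and spS: "cvec.span (C \<union> N) = S"
    using C by (auto simp: quot_basis_def)
  have CS: "cvec.span C \<subseteq> S" using spS cvec.span_mono[of C "C \<union> N"] by auto
  have ker: "x = 0" if "x \<in> cvec.span C" "L x \<in> Y" for x
    using YN[of x] that CS spC by auto
  have inj: "inj_on L (cvec.span C)"
  proof (rule inj_onI)
    fix x y assume xy: "x \<in> cvec.span C" "y \<in> cvec.span C" "L x = L y"
    then have "L (x - y) = 0" using L by (simp add: clin_diff)
    then have "x - y = 0" using xy Y by (intro ker) (auto simp: cvec.span_diff cvec.subspace_0)
    then show "x = y" by simp
  qed
  then show "inj_on L C" using cvec.span_superset by (rule inj_on_subset)
  have ind: "cvec.independent (L ` C)"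
    using pair.linear_independent_injective_image[of L C] L indC inj unfolding clin_iff_linear by blast
  have spL: "cvec.span (L ` C) = L ` cvec.span C"
    using L by (simp add: clin_iff_linear pair.linear_span_image)
  have "cvec.span (L ` C) \<inter> Y = {0}"
  proof -
    have "L x = 0" if "x \<in> cvec.span C" "L x \<in> Y" for x using ker[OF that] L by (simp add: clin_0)
    moreover have "0 \<in> L ` cvec.span C" using clin_0[OF L] cvec.span_zero by (metis image_eqI)
    ultimately show ?thesis unfolding spL using Y cvec.subspace_0 by auto
  qed
  moreover have "cvec.span (L ` C \<union> Y) = X"
  proof
    show "cvec.span (L ` C \<union> Y) \<subseteq> X" using X LX CS cvec.span_superset[of C] by (intro cvec.span_minimal) auto
    show "X \<subseteq> cvec.span (L ` C \<union> Y)"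
    proof
      fix y assume "y \<in> X"
      then obtain x where x: "x \<in> S" "y - L x \<in> Y" using surj by blast
      obtain b n where bn: "b \<in> cvec.span C" "n \<in> N" "x = b + n" using quot_basis_decomp[OF C N x(1)] by blast
      have "n \<in> S" using bn(2) iso by (auto simp: quot_iso_def)
      then have "L n \<in> Y" using YN bn(2) by blast
      then have "y - L b \<in> Y" using x bn L Y cvec.subspace_add[OF Y x(2), of "L n"] by (simp add: clin_add)
      moreover have "y = L b + (y - L b)" by simp
      moreover have "cvec.span Y = Y" using Y by simp
      ultimately show "y \<in> cvec.span (L ` C \<union> Y)"
        unfolding cvec.span_Un spL using bn(1) by blast
    qed
  qed
  ultimately show "quot_basis (L ` C) X Y" using ind by (simp add: quot_basis_def)
qed

text \<open>For the converse direction a basis of \<open>S / N\<close> is taken first, possibly infinite. Its image is a basis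
  of \<open>X / Y\<close>, and this makes it finite.\<close>

lemma has_qdim_iso:
  assumes iso: "quot_iso L S N X Y"
  shows "has_qdim S N n \<longleftrightarrow> has_qdim X Y n"
proof
  assume "has_qdim S N n"
  then show "has_qdim X Y n"
    unfolding has_qdim_def using quot_basis_iso[OF iso] by (metis card_image finite_imageI)
next
  assume X: "has_qdim X Y n"
  have "cvec.subspace N" "cvec.subspace S" "N \<subseteq> S" and Y: "cvec.subspace Y" using iso by (auto simp: quot_iso_def)
  then obtain C where C: "quot_basis C S N" using quot_basis_exists by blast
  from quot_basis_of_has_qdim[OF X quot_basis_iso(1)[OF iso C] Y] quot_basis_iso(2)[OF iso C] C
  show "has_qdim S N n"
    unfolding has_qdim_def by (metis card_image finite_image_iff)
qed

lemma has_qdim_0: "cvec.subspace N \<Longrightarrow> has_qdim N N 0"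
  unfolding has_qdim_def quot_basis_def
  by (intro exI[of _ "{}"]) (auto simp: cvec.subspace_0 cvec.independent_empty)

text \<open>By induction on the index set, through the subspace \<open>P\<close> of the vectors whose component at the new
  index \<open>a\<close> vanishes in \<open>S a / N a\<close>.\<close>

lemma has_qdim_dsum:
  assumes "finite I" "\<And>i. i \<in> I \<Longrightarrow> cvec.subspace (S i) \<and> cvec.subspace (N i) \<and> N i \<subseteq> S i \<and> has_qdim (S i) (N i) (n i)"
  shows "has_qdim (dsum I S) (dsum I N) (\<Sum>i\<in>I. n i)"
  using assms
proof (induction I rule: finite_induct)
  case empty
  have "dsum {} S = dsum {} N" by (simp add: dsum_def)
  then show ?case using has_qdim_0[OF subspace_dsum[of "{}" N]] by simp
next
  case (insert a I)
  have sub: "cvec.subspace (S i)" "cvec.subspace (N i)" "N i \<subseteq> S i" "has_qdim (S i) (N i) (n i)" if "i \<in> insert a I" for i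
    using insert.prems that by auto
  have sub_a: "cvec.subspace (S a)" "cvec.subspace (N a)" "N a \<subseteq> S a" "has_qdim (S a) (N a) (n a)"
    using sub[of a] by simp_all
  have S: "cvec.subspace (dsum (insert a I) S)" and N: "cvec.subspace (dsum (insert a I) N)"
    and S': "cvec.subspace (dsum I S)" and N': "cvec.subspace (dsum I N)"
    using sub(1,2) by (intro subspace_dsum; simp)+
  define P where "P = dsum (insert a I) S \<inter> {x. slice a x \<in> N a}"
  have P: "cvec.subspace P" unfolding P_def
    using sub_a by (intro cvec.subspace_inter S clin_preimage) auto
  have "quot_iso (slice a) (dsum (insert a I) S) P (S a) (N a)"
    unfolding quot_iso_def
  proof (intro conjI ballI)
    fix y assume y: "y \<in> S a"
    then have "basis_vec a \<otimes> y \<in> dsum (insert a I) S"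
      using sub(1) insert.hyps by (intro dsumI) (auto simp: cvec.subspace_0)
    then show "\<exists>x\<in>dsum (insert a I) S. y - slice a x \<in> N a"
      using sub_a by (intro bexI[of _ "basis_vec a \<otimes> y"]) (auto simp: cvec.subspace_0)
  next
    fix x assume "x \<in> dsum (insert a I) S"
    then show "slice a x \<in> S a" "(slice a x \<in> N a) = (x \<in> P)" by (simp_all add: P_def dsum_in)
  qed (use sub_a S P in \<open>auto simp: P_def\<close>)
  from has_qdim_iso[OF this] have 1: "has_qdim (dsum (insert a I) S) P (n a)"
    using sub_a by simp
  have ext: "x \<in> dsum (insert a I) T" if "x \<in> dsum I T" "cvec.subspace (T a)" for x and T :: "'a \<Rightarrow> 'b cvec set"
    using that insert.hyps by (intro dsumI) (auto simp: dsum_in dsum_out cvec.subspace_0)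
  have "quot_iso (\<lambda>x. x) (dsum I S) (dsum I N) P (dsum (insert a I) N)"
    unfolding quot_iso_def
  proof (intro conjI ballI)
    fix x assume x: "x \<in> dsum I S"
    have a: "slice a x = 0" using x insert.hyps by (simp add: dsum_out)
    then show "x \<in> P" using ext[OF x] sub_a by (auto simp: P_def cvec.subspace_0)
    have "x \<in> dsum I N" if "x \<in> dsum (insert a I) N"
    proof (rule dsumI)
      fix i assume "i \<notin> I"
      with that a show "slice i x = 0" by (cases "i = a") (auto intro: dsum_out)
    qed (use that in \<open>auto intro: dsum_in\<close>)
    then show "(x \<in> dsum (insert a I) N) = (x \<in> dsum I N)"
      using ext[of x N] sub_a by blast
  next
    fix y assume y: "y \<in> P"
    define x where "x = y - basis_vec a \<otimes> slice a y"
    have sx: "slice i x = (if i = a then 0 else slice i y)" for i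
      by (simp add: x_def clin_diff[OF clin_slice])
    have "x \<in> dsum I S"
      using y insert.hyps by (intro dsumI) (auto simp: sx P_def intro: dsum_in dsum_out)
    moreover have "y - x \<in> dsum (insert a I) N"
      using y sub(2) by (intro dsumI) (auto simp: P_def x_def cvec.subspace_0)
    ultimately show "\<exists>x\<in>dsum I S. y - x \<in> dsum (insert a I) N" by blast
  next
    show "dsum I N \<subseteq> dsum I S" by (intro dsum_mono sub(3)) simp
    have "dsum (insert a I) N \<subseteq> dsum (insert a I) S" by (intro dsum_mono sub(3))
    then show "dsum (insert a I) N \<subseteq> P" unfolding P_def by (auto intro: dsum_in)
  qed (fact S' N' P N clin_id)+
  from has_qdim_iso[OF this] have "has_qdim P (dsum (insert a I) N) (\<Sum>i\<in>I. n i)"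
    using insert.IH insert.prems by simp
  from has_qdim_trans[OF 1 this P N] show ?case using insert.hyps by simp
qed


section \<open>The affine Lie algebra\<close>

lemma lin_ext_scaled_basis: "lin_ext g (scal c (basis_vec i)) = scal c (g i)"
  by (simp add: lin_ext_scal)

lemma sl2_bracket_antisym: "sl2_bracket y x = - sl2_bracket x y"
  by (cases x; cases y) simp_all

lemma sl2_form_sym: "sl2_form y x = sl2_form x y"
  by (cases x; cases y) simp_all

lemma aff_bracket_antisym: "aff_bracket c b = - aff_bracket b c"
proof (cases b; cases c)
  fix x i y j assume bc: "b = Loop x i" "c = Loop y j"
  show ?thesis
  proof (cases "i + j = 0")
    case True
    then have "j = - i" by linarith
    then show ?thesis
      by (simp add: bc sl2_bracket_antisym[of y x] sl2_form_sym[of y x] lin_ext_uminus)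
  next
    case False
    then show ?thesis by (simp add: bc sl2_bracket_antisym[of y x] lin_ext_uminus add.commute[of j i])
  qed
qed auto

lemma sl2_jacobi:
  "lin_ext (sl2_bracket x) (sl2_bracket y z) - lin_ext (sl2_bracket y) (sl2_bracket x z)
   = lin_ext (\<lambda>d. sl2_bracket d z) (sl2_bracket x y)"
  by (cases x; cases y; cases z) (simp_all add: lin_ext_scaled_basis lin_ext_uminus)

text \<open>The element \<open>v \<otimes> t\<^sup>n\<close> of the loop algebra.\<close>

definition loop_vec :: "sl2 cvec \<Rightarrow> int \<Rightarrow> aff cvec" where
  "loop_vec v n = lin_ext (\<lambda>z. basis_vec (Loop z n)) v"

lemma sl2_form_invariant:
  "lin_ext (\<lambda>d. scal (sl2_form x d) w) (sl2_bracket y z) = lin_ext (\<lambda>d. scal (sl2_form d z) w) (sl2_bracket x y)"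
  by (cases x; cases y; cases z) (simp_all add: lin_ext_scaled_basis lin_ext_uminus)

lemma bracket_loop_vec_right:
  "lin_ext (aff_bracket (Loop x i)) (loop_vec v n) = loop_vec (lin_ext (sl2_bracket x) v) (i + n)
    + (if i + n = 0 then scal (of_int i) (lin_ext (\<lambda>z. scal (sl2_form x z) (basis_vec Central)) v) else 0)"
  unfolding loop_vec_def clin_lin_ext_comp[OF clin_lin_ext]
  by (simp add: lin_ext_plus_fun lin_ext_scal_fun[symmetric])

lemma bracket_loop_vec_left:
  "lin_ext (\<lambda>d. aff_bracket d (Loop z k)) (loop_vec v n) = loop_vec (lin_ext (\<lambda>y. sl2_bracket y z) v) (n + k)
    + (if n + k = 0 then scal (of_int n) (lin_ext (\<lambda>y. scal (sl2_form y z) (basis_vec Central)) v) else 0)"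
  unfolding loop_vec_def clin_lin_ext_comp[OF clin_lin_ext]
  by (simp add: lin_ext_plus_fun lin_ext_scal_fun[symmetric])

lemma aff_bracket_loop: "aff_bracket (Loop x i) (Loop y j) = loop_vec (sl2_bracket x y) (i + j)
     + (if i + j = 0 then scal (of_int i * sl2_form x y) (basis_vec Central) else 0)"
  by (simp add: loop_vec_def)

lemma lin_ext_if_Central:
  "g Central = 0 \<Longrightarrow> lin_ext g (u + (if P then scal c (basis_vec Central) else 0)) = lin_ext g u"
  by (simp add: lin_ext_add lin_ext_scaled_basis)

text \<open>The loop part is the Jacobi identity of \<open>sl\<^sub>2\<close>. By the invariance of the form, the coefficients of
  the central element are \<open>i t + j t\<close> and \<open>(i + j) t\<close> with the same \<open>t\<close>.\<close>

lemma aff_jacobi_loop: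
  "lin_ext (aff_bracket (Loop x i)) (aff_bracket (Loop y j) (Loop z k))
     - lin_ext (aff_bracket (Loop y j)) (aff_bracket (Loop x i) (Loop z k))
   = lin_ext (\<lambda>d. aff_bracket d (Loop z k)) (aff_bracket (Loop x i) (Loop y j))"
proof -
  define w :: "aff cvec" where "w = basis_vec Central"
  define t where "t = lin_ext (\<lambda>d. scal (sl2_form d z) w) (sl2_bracket x y)"
  have x: "lin_ext (\<lambda>d. scal (sl2_form x d) w) (sl2_bracket y z) = t"
    unfolding t_def by (rule sl2_form_invariant)
  have y: "lin_ext (\<lambda>d. scal (sl2_form y d) w) (sl2_bracket x z) = - t"
    unfolding t_def sl2_form_invariant sl2_bracket_antisym[of y x] lin_ext_uminus ..
  have comm: "j + (i + k) = i + (j + k)" by simp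
  show ?thesis
    unfolding aff_bracket_loop
    by (simp add: lin_ext_if_Central bracket_loop_vec_left bracket_loop_vec_right comm add.assoc
          flip: w_def)
       (simp add: x y loop_vec_def lin_ext_diff[symmetric] sl2_jacobi[symmetric] cvec.scale_left_distrib
          flip: t_def)
qed

lemma aff_bracket_Central [simp]: "aff_bracket Central = (\<lambda>b. 0)" "aff_bracket b Central = 0"
  by (rule ext, simp) (cases b; simp)

lemma Deg_bracket_loop:
  "lin_ext (aff_bracket Deg) (aff_bracket (Loop x i) (Loop y j))
     = - scal (of_int (i + j)) (aff_bracket (Loop x i) (Loop y j))"
  "lin_ext (\<lambda>d. aff_bracket d Deg) (aff_bracket (Loop x i) (Loop y j))
     = scal (of_int (i + j)) (aff_bracket (Loop x i) (Loop y j))"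
proof -
  have "lin_ext (aff_bracket Deg) (loop_vec v n) = - scal (of_int n) (loop_vec v n)"
    "lin_ext (\<lambda>d. aff_bracket d Deg) (loop_vec v n) = scal (of_int n) (loop_vec v n)" for v n
    unfolding loop_vec_def clin_lin_ext_comp[OF clin_lin_ext]
    by (simp_all add: lin_ext_scal_fun lin_ext_uminus_fun)
  then show "lin_ext (aff_bracket Deg) (aff_bracket (Loop x i) (Loop y j))
     = - scal (of_int (i + j)) (aff_bracket (Loop x i) (Loop y j))"
  "lin_ext (\<lambda>d. aff_bracket d Deg) (aff_bracket (Loop x i) (Loop y j))
     = scal (of_int (i + j)) (aff_bracket (Loop x i) (Loop y j))"
    unfolding aff_bracket_loop
    by (simp_all add: lin_ext_if_Central cvec.scale_right_distrib flip: of_int_add)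
qed

lemma aff_jacobi:
  "lin_ext (aff_bracket a) (aff_bracket b c) - lin_ext (aff_bracket b) (aff_bracket a c)
   = lin_ext (\<lambda>d. aff_bracket d c) (aff_bracket a b)"
proof -
  note simps = aff_jacobi_loop Deg_bracket_loop lin_ext_uminus lin_ext_scaled_basis cvec.scale_left_distrib
  have "scal p (aff_bracket (Loop x i) (Loop y j)) + scal p (aff_bracket (Loop y j) (Loop x i)) = 0" for p x y i j
    unfolding aff_bracket_antisym[of "Loop x i" "Loop y j"] by (simp only: cvec.scale_minus_right) simp
  then show ?thesis
    by (cases a; cases b; cases c) (simp_all add: simps algebra_simps del: aff_bracket.simps(1))
qed

lemma subspace_keys: "cvec.subspace {u. Poly_Mapping.keys u \<subseteq> A}"
proof -
  have "Poly_Mapping.keys (scal c u) \<subseteq> Poly_Mapping.keys u" for c and u :: "'a cvec"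
    by (auto simp: in_keys_iff)
  then show ?thesis
    by (intro cvec.subspaceI) (simp, use Poly_Mapping.keys_add in fast, use order_trans in fast)
qed

lemma keys_loop_vec: "Poly_Mapping.keys (loop_vec v n) \<subseteq> (\<lambda>z. Loop z n) ` Poly_Mapping.keys v"
proof -
  have "loop_vec v n \<in> {u. Poly_Mapping.keys u \<subseteq> (\<lambda>z. Loop z n) ` Poly_Mapping.keys v}"
    unfolding loop_vec_def
    by (intro lin_ext_in subspace_keys) simp
  then show ?thesis by simp
qed

lemma keys_sl2_bracket:
  "Poly_Mapping.keys (sl2_bracket F F) = {}" "Poly_Mapping.keys (sl2_bracket H H) = {}"
  "Poly_Mapping.keys (sl2_bracket E E) = {}" "Poly_Mapping.keys (sl2_bracket E H) \<subseteq> {E}"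
  "Poly_Mapping.keys (sl2_bracket H E) \<subseteq> {E}"
  by (auto simp: in_keys_iff lookup_single when_def split: if_splits)

lemma keys_bracket_loop:
  "Poly_Mapping.keys (aff_bracket (Loop x i) (Loop y j))
     \<subseteq> (\<lambda>z. Loop z (i + j)) ` Poly_Mapping.keys (sl2_bracket x y) \<union> (if i + j = 0 \<and> i \<noteq> 0 then {Central} else {})"
proof -
  have "Poly_Mapping.keys (aff_bracket (Loop x i) (Loop y j)) \<subseteq> Poly_Mapping.keys (loop_vec (sl2_bracket x y) (i + j))
       \<union> Poly_Mapping.keys (if i + j = 0 then scal (of_int i * sl2_form x y) (basis_vec Central) else 0)"
    unfolding aff_bracket_loop by (rule Poly_Mapping.keys_add)
  moreover have "Poly_Mapping.keys (if i + j = 0 then scal (of_int i * sl2_form x y) (basis_vec Central) else 0)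
     \<subseteq> (if i + j = 0 \<and> i \<noteq> 0 then {Central} else {})"
    by (auto simp: in_keys_iff lookup_single when_def split: if_splits)
  ultimately show ?thesis using keys_loop_vec by blast
qed

lemma keys_bracket_Deg:
  "Poly_Mapping.keys (aff_bracket Deg b) \<subseteq> {b}" "Poly_Mapping.keys (aff_bracket b Deg) \<subseteq> {b}"
  by (cases b; auto simp: in_keys_iff lookup_single when_def split: if_splits)+

lemma n_minus_iff: "b \<in> n_minus \<longleftrightarrow> (\<exists>x i. b = Loop x i \<and> (i < 0 \<or> i = 0 \<and> x = F))"
  by (auto simp: n_minus_def)

lemma n_minus_bracket:
  assumes "b \<in> n_minus" "c \<in> n_minus"
  shows "Poly_Mapping.keys (aff_bracket b c) \<subseteq> n_minus"
proof -
  obtain x i where b: "b = Loop x i" "i < 0 \<or> i = 0 \<and> x = F" using assms(1) by (auto simp: n_minus_iff)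
  obtain y j where c: "c = Loop y j" "j < 0 \<or> j = 0 \<and> y = F" using assms(2) by (auto simp: n_minus_iff)
  show ?thesis
  proof (cases "i = 0 \<and> j = 0")
    case True
    then show ?thesis using b c keys_bracket_loop[of F 0 F 0] by (auto simp: keys_sl2_bracket)
  next
    case False
    then have "i + j < 0" using b c by auto
    then show ?thesis using keys_bracket_loop[of x i y j] by (auto simp: b c n_minus_iff)
  qed
qed

text \<open>The scalar by which a basis element of the complement of \<open>n\<close> acts on a highest weight vector.\<close>

definition hw_val :: "weight \<Rightarrow> aff \<Rightarrow> complex" where
  "hw_val = (\<lambda>(i, k, m) b. if b = Loop H 0 then i else if b = Central then k else if b = Deg then m else 0)"

text \<open>The complement of \<open>n_minus\<close> is a basis of the Borel subalgebra.\<close>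

lemma borel_iff: "b \<notin> n_minus \<longleftrightarrow> b \<in> n_plus \<or> b \<in> {Loop H 0, Central, Deg}"
proof (cases b)
  case (Loop x i)
  then show ?thesis by (cases x) (auto simp: n_minus_def n_plus_def)
qed (auto simp: n_minus_def n_plus_def)

lemma hw_val_n_plus: "b \<in> n_plus \<Longrightarrow> hw_val mu b = 0"
  by (auto simp: hw_val_def n_plus_def split: prod.splits)

lemma n_plus_borel: "b \<in> n_plus \<Longrightarrow> b \<notin> n_minus"
  by (auto simp: borel_iff)

text \<open>The derived algebra of the Borel subalgebra is contained in the span of \<open>n_plus\<close>, so the values
  on a highest weight vector define a character of the Borel subalgebra.\<close>

lemma borel_bracket:
  assumes "b \<notin> n_minus" "c \<notin> n_minus"
  shows "Poly_Mapping.keys (aff_bracket b c) \<subseteq> n_plus"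
proof -
  have Loop: "Loop x i \<notin> n_minus \<longleftrightarrow> i > 0 \<or> i = 0 \<and> x \<in> {E, H}" for x i
    by (cases x) (auto simp: n_minus_iff)
  have Deg: "Poly_Mapping.keys (aff_bracket Deg b) \<subseteq> n_plus" "Poly_Mapping.keys (aff_bracket b Deg) \<subseteq> n_plus"
    if "b \<notin> n_minus" for b
  proof -
    show "Poly_Mapping.keys (aff_bracket Deg b) \<subseteq> n_plus"
    proof (cases b)
      case (Loop x i)
      with that keys_bracket_Deg[of b] show ?thesis
        by (cases "i = 0") (auto simp: n_plus_def n_minus_iff)
    qed auto
    then show "Poly_Mapping.keys (aff_bracket b Deg) \<subseteq> n_plus"
      using aff_bracket_antisym[of b Deg] by simp
  qed
  show ?thesis
  proof (cases "\<exists>x i y j. b = Loop x i \<and> c = Loop y j")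
    case True
    then obtain x i y j where bc: "b = Loop x i" "c = Loop y j" by blast
    then have ij: "i > 0 \<or> i = 0 \<and> x \<in> {E, H}" "j > 0 \<or> j = 0 \<and> y \<in> {E, H}" using assms Loop by auto
    show ?thesis
    proof (cases "i = 0 \<and> j = 0")
      case True
      have "Poly_Mapping.keys (sl2_bracket x y) \<subseteq> {E}"
        using True ij keys_sl2_bracket by auto
      then have "Poly_Mapping.keys (aff_bracket b c) \<subseteq> {Loop E 0}"
        using True bc keys_bracket_loop[of x i y j] by (auto simp del: aff_bracket.simps)
      then show ?thesis by (auto simp: n_plus_def)
    next
      case False
      then have "i + j > 0" using ij by auto
      then show ?thesis using bc keys_bracket_loop[of x i y j] by (auto simp: n_plus_def)
    qed
  next
    case False
    then have "b = Deg \<or> c = Deg \<or> b = Central \<or> c = Central" by (cases b; cases c) auto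
    then show ?thesis using Deg assms by auto
  qed
qed


section \<open>The tensor algebra\<close>

abbreviation word_vec :: "aff list \<Rightarrow> free_alg" where
  "word_vec w \<equiv> basis_vec (Word w)"

lemma one_eq_mono: "(1 :: free_alg) = word_vec []"
  by (simp add: zero_free_word_def flip: single_one)

lemma mono_mult_mono: "word_vec u * word_vec v = word_vec (u @ v)"
  by (simp add: mult_single plus_free_word_def)

lemma gen_mult_mono: "gen b * word_vec w = word_vec (b # w)"
  by (simp add: gen_def mono_mult_mono)

lemma scal_mult_left: "scal c u * v = scal c (u * v)" for u v :: free_alg
  by (simp add: scal_def mult_map_scale_conv_mult mult.assoc)

lemma clin_mult_left: "clin (\<lambda>u. u * v)" for v :: free_alg
  by (rule clinI) (simp_all add: distrib_right scal_mult_left)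

lemma scal_mult_right: "u * scal c v = scal c (u * v)" for u v :: free_alg
proof (rule clin_eq[of "\<lambda>u. u * scal c v" "\<lambda>u. scal c (u * v)"])
  fix w :: "aff free_word"
  have "basis_vec w * scal c v = basis_vec w * Poly_Mapping.single 0 c * v"
    by (simp add: scal_def mult_map_scale_conv_mult mult.assoc)
  also have "basis_vec w * Poly_Mapping.single 0 c = Poly_Mapping.single 0 c * basis_vec w"
    by (simp add: mult_single)
  finally show "basis_vec w * scal c v = scal c (basis_vec w * v)"
    by (simp add: scal_def mult_map_scale_conv_mult mult.assoc)
qed (intro clin_mult_left clin_scaled)+

lemma clin_mult_right: "clin (\<lambda>v. u * v)" for u :: free_alg
  by (rule clinI) (simp_all add: distrib_left scal_mult_right)

lemma free_alg_span: "u \<in> cvec.span (range word_vec)"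
proof -
  have "Poly_Mapping.keys u \<subseteq> range Word"
    by (metis free_word.exhaust rangeI subsetI)
  from in_span_basis[OF this] show ?thesis by (simp add: image_image)
qed

lemma subspace_free_alg_n: "cvec.subspace free_alg_n"
proof -
  have "free_alg_n = {u. Poly_Mapping.keys u \<subseteq> {w. set (letters w) \<subseteq> n_minus}}"
    by (auto simp: free_alg_n_def)
  then show ?thesis using subspace_keys[of "{w. set (letters w) \<subseteq> n_minus}"] by (rule ssubst)
qed

lemma mono_in_free_alg_n: "word_vec w \<in> free_alg_n \<longleftrightarrow> set w \<subseteq> n_minus"
  by (auto simp: free_alg_n_def)

lemma one_in_free_alg_n: "1 \<in> free_alg_n"
  by (simp add: one_eq_mono mono_in_free_alg_n)

lemma free_alg_n_span: "u \<in> free_alg_n \<Longrightarrow> u \<in> cvec.span (word_vec ` {w. set w \<subseteq> n_minus})"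
proof -
  assume "u \<in> free_alg_n"
  then have "Poly_Mapping.keys u \<subseteq> Word ` {w. set w \<subseteq> n_minus}"
    unfolding free_alg_n_def by (metis (mono_tags, lifting) free_word.collapse image_eqI mem_Collect_eq subsetI)
  from in_span_basis[OF this] show ?thesis by (simp add: image_image)
qed

lemma gen_mult_free_alg_n:
  assumes "b \<in> n_minus" "u \<in> free_alg_n"
  shows "gen b * u \<in> free_alg_n"
  by (rule clin_span_into[OF clin_mult_right subspace_free_alg_n _ free_alg_n_span[OF assms(2)]])
     (use assms in \<open>auto simp: gen_mult_mono mono_in_free_alg_n\<close>)


section \<open>The Verma module on the tensor algebra of n\<close>

text \<open>The image of the word \<open>w\<close> in \<open>n\<close>, applied to the highest weight vector, under the basis element \<open>b\<close>.
  Elements of \<open>n\<close> act by left multiplication, and the others move to the right across the word by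
  \<open>b x w = x b w + [b, x] w\<close>, until they reach the highest weight vector.\<close>

primrec word_act :: "weight \<Rightarrow> aff list \<Rightarrow> aff \<Rightarrow> free_alg" where
  "word_act mu [] b = (if b \<in> n_minus then gen b else scal (hw_val mu b) 1)"
| "word_act mu (x # w) b = (if b \<in> n_minus then word_vec (b # x # w)
     else gen x * word_act mu w b + lin_ext (word_act mu w) (aff_bracket b x))"

definition opr :: "weight \<Rightarrow> aff \<Rightarrow> free_alg \<Rightarrow> free_alg" where
  "opr mu b = lin_ext (\<lambda>w. word_act mu (letters w) b)"

abbreviation oprl :: "weight \<Rightarrow> aff cvec \<Rightarrow> free_alg \<Rightarrow> free_alg" where
  "oprl mu y u \<equiv> lin_ext (\<lambda>b. opr mu b u) y"

lemma clin_opr [intro!]: "clin (opr mu b)"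
  by (simp add: opr_def clin_lin_ext)

lemma clin_oprl: "clin (oprl mu y)"
  by (intro clin_lin_ext_fun clin_opr)

lemma opr_mono: "opr mu b (word_vec w) = word_act mu w b"
  by (simp add: opr_def)

lemma opr_n_minus:
  assumes "b \<in> n_minus"
  shows "opr mu b u = gen b * u"
proof (rule clin_span_eq[OF clin_opr clin_mult_right _ free_alg_span])
  fix g assume "g \<in> range word_vec"
  then obtain w where "g = word_vec w" by blast
  then show "opr mu b g = gen b * g"
    using assms by (cases w) (simp_all add: opr_mono gen_mult_mono, simp add: gen_def)
qed

lemma opr_gen_mult:
  assumes "b \<notin> n_minus"
  shows "opr mu b (gen x * u) = gen x * opr mu b u + oprl mu (aff_bracket b x) u"
proof (rule clin_span_eq[of "\<lambda>u. opr mu b (gen x * u)" "\<lambda>u. gen x * opr mu b u + oprl mu (aff_bracket b x) u",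
    OF _ _ _ free_alg_span])
  show "clin (\<lambda>u. opr mu b (gen x * u))"
    by (intro clin_comp[OF clin_opr] clin_mult_right)
  show "clin (\<lambda>u. gen x * opr mu b u + oprl mu (aff_bracket b x) u)"
    by (intro clin_plus clin_oprl clin_comp[OF clin_mult_right] clin_opr)
  fix g assume "g \<in> range word_vec"
  then show "opr mu b (gen x * g) = gen x * opr mu b g + oprl mu (aff_bracket b x) g"
    using assms by (auto simp: gen_mult_mono opr_mono)
qed

lemma opr_one: "b \<notin> n_minus \<Longrightarrow> opr mu b 1 = scal (hw_val mu b) 1"
  by (simp add: one_eq_mono opr_mono)

lemma opr_free_alg_n:
  assumes "u \<in> free_alg_n"
  shows "opr mu b u \<in> free_alg_n"
proof -
  have "word_act mu w b \<in> free_alg_n" if "set w \<subseteq> n_minus" for w b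
    using that
  proof (induction w arbitrary: b)
    case Nil
    then show ?case using gen_mult_free_alg_n[OF _ one_in_free_alg_n, of b] one_in_free_alg_n
      by (auto intro: cvec.subspace_scale[OF subspace_free_alg_n])
  next
    case (Cons x w)
    then have "lin_ext (word_act mu w) (aff_bracket b x) \<in> free_alg_n"
      by (intro lin_ext_in subspace_free_alg_n) auto
    with Cons show ?case
      using mono_in_free_alg_n[of "b # x # w"]
      by (auto intro!: cvec.subspace_add[OF subspace_free_alg_n] gen_mult_free_alg_n)
  qed
  then show ?thesis
    by (intro clin_span_into[where f = "opr mu b", OF clin_opr subspace_free_alg_n _ free_alg_n_span[OF assms]])
       (auto simp: opr_mono)
qed

text \<open>The failure of the operators to represent the bracket of \<open>b\<close> and \<open>c\<close>.\<close>

definition oprel :: "weight \<Rightarrow> aff \<Rightarrow> aff \<Rightarrow> free_alg \<Rightarrow> free_alg" where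
  "oprel mu b c u = opr mu b (opr mu c u) - opr mu c (opr mu b u) - oprl mu (aff_bracket b c) u"

lemma oprel_antisym: "oprel mu c b u = - oprel mu b c u"
  by (simp add: oprel_def aff_bracket_antisym[of b c] lin_ext_uminus)

lemma clin_oprel: "clin (oprel mu b c)"
  unfolding oprel_def by (intro clin_minus clin_oprl clin_comp[OF clin_opr] clin_opr)

text \<open>This is the defining recursion.\<close>

lemma oprel_mixed: "b \<notin> n_minus \<Longrightarrow> c \<in> n_minus \<Longrightarrow> oprel mu b c u = 0"
  by (simp add: oprel_def opr_n_minus opr_gen_mult)

lemma opr_oprl:
  assumes "\<And>c. c \<in> Poly_Mapping.keys y \<Longrightarrow> oprel mu b c u = 0"
  shows "opr mu b (oprl mu y u) = oprl mu y (opr mu b u) + oprl mu (lin_ext (aff_bracket b) y) u"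
proof -
  have "opr mu b (oprl mu y u) = lin_ext (\<lambda>c. opr mu b (opr mu c u)) y"
    by (rule clin_lin_ext_comp[OF clin_opr])
  also have "\<dots> = lin_ext (\<lambda>c. opr mu c (opr mu b u) + oprl mu (aff_bracket b c) u) y"
    by (rule lin_ext_cong) (use assms in \<open>auto simp: oprel_def algebra_simps\<close>)
  finally show ?thesis
    by (simp add: lin_ext_plus_fun clin_lin_ext_comp[OF clin_lin_ext])
qed

lemma oprl_diff: "oprl mu (y - z) u = oprl mu y u - oprl mu z u"
  by (simp add: lin_ext_diff)

text \<open>Induction on the word. Moving \<open>b\<close> and \<open>c\<close> across the first letter \<open>x\<close> produces the terms
  \<open>[b, [c, x]] - [c, [b, x]]\<close>, which are \<open>[[b, c], x]\<close> by the Jacobi identity; on the shorter word the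
  relation is known for all pairs of which one element is outside of \<open>n\<close>.\<close>

lemma oprel_borel_mono:
  assumes "b \<notin> n_minus" "c \<notin> n_minus" "set w \<subseteq> n_minus"
  shows "oprel mu b c (word_vec w) = 0"
  using assms
proof (induction w arbitrary: b c)
  case Nil
  have "opr mu d 1 = 0" if "d \<in> Poly_Mapping.keys (aff_bracket b c)" for d
    using borel_bracket[of b c] Nil that by (auto simp: opr_one n_plus_borel hw_val_n_plus)
  then have "oprl mu (aff_bracket b c) 1 = 0"
    using lin_ext_cong[of _ "\<lambda>d. opr mu d 1" "\<lambda>d. 0"] by auto
  then show ?case
    using Nil by (simp add: oprel_def one_eq_mono[symmetric] opr_one clin_scal[OF clin_opr])
next
  case (Cons x w)
  define m where "m = word_vec w"
  have x: "x \<in> n_minus" and w: "set w \<subseteq> n_minus" using Cons by auto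
  have IH: "oprel mu b' d m = 0" if "b' \<notin> n_minus" for b' d
    using Cons.IH[OF that _ w] oprel_mixed that unfolding m_def by blast
  have step: "opr mu b (opr mu c (gen x * m)) = gen x * opr mu b (opr mu c m)
     + oprl mu (aff_bracket b x) (opr mu c m) + oprl mu (aff_bracket c x) (opr mu b m)
     + oprl mu (lin_ext (aff_bracket b) (aff_bracket c x)) m"
    if "b \<notin> n_minus" "c \<notin> n_minus" for b c
    using that
    by (simp add: opr_gen_mult clin_add[OF clin_opr] opr_oprl[OF IH] add.assoc)
  have "oprl mu (aff_bracket b c) (gen x * m)
     = lin_ext (\<lambda>d. gen x * opr mu d m + oprl mu (aff_bracket d x) m) (aff_bracket b c)"
    by (rule lin_ext_cong) (use borel_bracket[of b c] Cons.prems n_plus_borel in \<open>auto simp: opr_gen_mult\<close>)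
  also have "\<dots> = gen x * oprl mu (aff_bracket b c) m
     + oprl mu (lin_ext (\<lambda>d. aff_bracket d x) (aff_bracket b c)) m"
    by (simp add: lin_ext_plus_fun clin_lin_ext_comp[OF clin_lin_ext] clin_lin_ext_comp[OF clin_mult_right])
  finally have lin: "oprl mu (aff_bracket b c) (gen x * m) = gen x * oprl mu (aff_bracket b c) m
     + (oprl mu (lin_ext (aff_bracket b) (aff_bracket c x)) m
        - oprl mu (lin_ext (aff_bracket c) (aff_bracket b x)) m)"
    unfolding aff_jacobi[symmetric] oprl_diff .
  \<comment> \<open>after expansion the claim is an identity in the additive group\<close>
  have abel: "(A + p + q + r) - (B + q + p + s) - (C + (r - s)) = A - B - C" for A B C p q r s :: free_alg
    by (simp add: algebra_simps)
  have "oprel mu b c (gen x * m) = gen x * oprel mu b c m"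
    unfolding oprel_def lin step[OF Cons.prems(1,2)] step[OF Cons.prems(2,1)] right_diff_distrib
    by (rule abel)
  then show ?case using IH[of b c] Cons.prems by (simp add: m_def gen_mult_mono)
qed

lemma oprel_borel: "b \<notin> n_minus \<Longrightarrow> u \<in> free_alg_n \<Longrightarrow> oprel mu b c u = 0"
proof (cases "c \<in> n_minus")
  case False
  assume b: "b \<notin> n_minus" and u: "u \<in> free_alg_n"
  show ?thesis
    by (rule clin_span_eq[where f = "oprel mu b c", OF clin_oprel clin_zero _ free_alg_n_span[OF u]])
       (use False b in \<open>auto simp: oprel_borel_mono\<close>)
qed (simp add: oprel_mixed)

definition nrel :: "aff \<Rightarrow> aff \<Rightarrow> free_alg" where
  "nrel x y = gen x * gen y - gen y * gen x - lin_ext gen (aff_bracket x y)"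

definition nideal_gens :: "free_alg set" where
  "nideal_gens = {word_vec u * (nrel x y * v) |u x y v. set u \<subseteq> n_minus \<and> x \<in> n_minus \<and> y \<in> n_minus \<and> v \<in> free_alg_n}"

text \<open>The ideal of \<open>T(n)\<close> with quotient \<open>U(n)\<close>.\<close>

definition nideal :: "free_alg set" where
  "nideal = cvec.span nideal_gens"

lemma subspace_nideal: "cvec.subspace nideal"
  by (simp add: nideal_def)

lemma nrel_mult: "x \<in> n_minus \<Longrightarrow> y \<in> n_minus \<Longrightarrow> nrel x y * v = oprel mu x y v"
proof -
  assume xy: "x \<in> n_minus" "y \<in> n_minus"
  have "oprl mu (aff_bracket x y) v = lin_ext (\<lambda>d. gen d * v) (aff_bracket x y)"
    by (rule lin_ext_cong) (use n_minus_bracket[OF xy] in \<open>auto simp: opr_n_minus\<close>)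
  also have "\<dots> = lin_ext gen (aff_bracket x y) * v"
    by (rule clin_lin_ext_comp[OF clin_mult_left, symmetric])
  finally show ?thesis
    using xy by (simp add: nrel_def oprel_def opr_n_minus left_diff_distrib mult.assoc)
qed

text \<open>So on \<open>T(n)\<close> modulo this ideal the operators represent the whole affine algebra.\<close>

lemma oprel_in_nideal:
  assumes "u \<in> free_alg_n"
  shows "oprel mu b c u \<in> nideal"
proof -
  consider "b \<notin> n_minus" | "c \<notin> n_minus" | "b \<in> n_minus" "c \<in> n_minus" by blast
  then show ?thesis
  proof cases
    case 1 then show ?thesis using assms oprel_borel subspace_nideal cvec.subspace_0 by metis
  next
    case 2 then have "oprel mu b c u = 0" using oprel_antisym[of mu b c u] oprel_borel assms by simp
    then show ?thesis using subspace_nideal cvec.subspace_0 by metis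
  next
    case 3
    then have "word_vec [] * (nrel b c * u) \<in> nideal"
      unfolding nideal_def nideal_gens_def using assms by (intro cvec.span_base) fastforce
    then show ?thesis using 3 by (simp add: nrel_mult[of _ _ _ mu] flip: one_eq_mono)
  qed
qed

lemma gen_mult_nideal:
  assumes "b \<in> n_minus" "u \<in> nideal"
  shows "gen b * u \<in> nideal"
proof (rule clin_span_into[OF clin_mult_right subspace_nideal _ assms(2)[unfolded nideal_def]])
  fix g assume "g \<in> nideal_gens"
  then obtain u x y v where g: "g = word_vec u * (nrel x y * v)" "set u \<subseteq> n_minus" "x \<in> n_minus" "y \<in> n_minus" "v \<in> free_alg_n"
    unfolding nideal_gens_def by blast
  have "gen b * g = word_vec (b # u) * (nrel x y * v)"
    by (simp add: g(1) gen_mult_mono flip: mult.assoc)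
  then show "gen b * g \<in> nideal"
    unfolding nideal_def nideal_gens_def using g assms(1) by (intro cvec.span_base) (auto, metis insert_subset list.simps(15))
qed

text \<open>For \<open>b\<close> outside of \<open>n\<close> and the empty word \<open>u\<close>, the Jacobi identity rewrites \<open>b (xy - yx - [x, y])\<close> as
  \<open>(xy - yx - [x, y]) b\<close> plus the relators of the pairs \<open>x, [b, y]\<close> and \<open>[b, x], y\<close>, which are in the ideal. The
  letters of \<open>u\<close> are then crossed one by one.\<close>

lemma opr_nideal_gen:
  assumes "set u \<subseteq> n_minus" "x \<in> n_minus" "y \<in> n_minus" "v \<in> free_alg_n"
  shows "opr mu b (word_vec u * (nrel x y * v)) \<in> nideal"
  using assms(1)
proof (induction u arbitrary: b)
  case Nil
  show ?case
  proof (cases "b \<in> n_minus")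
    case True
    then have "opr mu b (word_vec [] * (nrel x y * v)) = word_vec [b] * (nrel x y * v)"
      by (simp add: opr_n_minus gen_def flip: one_eq_mono)
    then show ?thesis
      unfolding nideal_def nideal_gens_def using assms True by (intro cvec.span_base) fastforce
  next
    case False
    have ex: "opr mu b (opr mu c u) = opr mu c (opr mu b u) + oprl mu (aff_bracket b c) u" if "c \<in> n_minus" for c u
      using oprel_mixed[OF False that, of mu u] by (simp add: oprel_def algebra_simps)
    have lin: "opr mu b (oprl mu (aff_bracket x y) v) = oprl mu (aff_bracket x y) (opr mu b v)
        + oprl mu (lin_ext (aff_bracket b) (aff_bracket x y)) v"
      using n_minus_bracket[OF assms(2,3)] by (intro opr_oprl oprel_mixed[OF False]) auto
    have eq: "opr mu b (oprel mu x y v) = oprel mu x y (opr mu b v)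
       + lin_ext (\<lambda>d. oprel mu x d v) (aff_bracket b y) + lin_ext (\<lambda>d. oprel mu d y v) (aff_bracket b x)"
    proof -
      define v' where "v' = opr mu b v"
      have cx: "opr mu b (opr mu x (opr mu y v)) = opr mu x (opr mu y v') + opr mu x (oprl mu (aff_bracket b y) v)
          + oprl mu (aff_bracket b x) (opr mu y v)"
        unfolding ex[OF assms(2)] ex[OF assms(3)] clin_add[OF clin_opr] v'_def ..
      have cy: "opr mu b (opr mu y (opr mu x v)) = opr mu y (opr mu x v') + opr mu y (oprl mu (aff_bracket b x) v)
          + oprl mu (aff_bracket b y) (opr mu x v)"
        unfolding ex[OF assms(2)] ex[OF assms(3)] clin_add[OF clin_opr] v'_def ..
      have r1: "lin_ext (\<lambda>d. oprel mu x d v) (aff_bracket b y) = opr mu x (oprl mu (aff_bracket b y) v)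
          - oprl mu (aff_bracket b y) (opr mu x v) - oprl mu (lin_ext (aff_bracket x) (aff_bracket b y)) v"
        unfolding oprel_def lin_ext_minus_fun clin_lin_ext_comp[OF clin_opr] clin_lin_ext_comp[OF clin_lin_ext] ..
      have r2: "lin_ext (\<lambda>d. oprel mu d y v) (aff_bracket b x) = oprl mu (aff_bracket b x) (opr mu y v)
          - opr mu y (oprl mu (aff_bracket b x) v) - oprl mu (lin_ext (\<lambda>d. aff_bracket d y) (aff_bracket b x)) v"
        unfolding oprel_def lin_ext_minus_fun clin_lin_ext_comp[OF clin_opr] clin_lin_ext_comp[OF clin_lin_ext] ..
      have abel: "(A + p + q) - (B + r + s) - (C + J) = (A - B - C) + (p - s - K) + (q - r - (J - K))"
        for A B C J K p q r s :: free_alg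
        by (simp add: algebra_simps)
      show ?thesis
        unfolding r1 r2 aff_jacobi[symmetric] oprl_diff
        unfolding oprel_def clin_diff[OF clin_opr] cx cy lin v'_def[symmetric]
        by (rule abel)
    qed
    have "opr mu b (oprel mu x y v) \<in> nideal"
      unfolding eq using assms(4)
      by (intro cvec.subspace_add[OF subspace_nideal] lin_ext_in[OF subspace_nideal] oprel_in_nideal opr_free_alg_n)
    then show ?thesis using assms by (simp add: nrel_mult[of _ _ _ mu] flip: one_eq_mono)
  qed
next
  case (Cons z u)
  define m where "m = word_vec u * (nrel x y * v)"
  have z: "z \<in> n_minus" and u: "set u \<subseteq> n_minus" using Cons.prems by auto
  have m: "word_vec (z # u) * (nrel x y * v) = gen z * m"
    by (simp add: m_def gen_mult_mono flip: mult.assoc)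
  have IH: "opr mu d m \<in> nideal" for d using Cons.IH[OF u] by (simp add: m_def)
  show ?case
  proof (cases "b \<in> n_minus")
    case True
    then show ?thesis unfolding m using IH[of z] z by (simp add: opr_n_minus gen_mult_nideal)
  next
    case False
    then show ?thesis unfolding m using IH z
      by (auto simp: opr_gen_mult intro!: cvec.subspace_add[OF subspace_nideal] gen_mult_nideal lin_ext_in[OF subspace_nideal])
  qed
qed

lemma opr_nideal:
  assumes "u \<in> nideal"
  shows "opr mu b u \<in> nideal"
  by (rule clin_span_into[OF clin_opr subspace_nideal _ assms[unfolded nideal_def]])
     (auto simp: nideal_gens_def intro: opr_nideal_gen)

text \<open>The action on the highest weight vector \<open>1\<close>. It represents an element of \<open>U(g)\<close> modulo the
  relations of the Verma module by an element of \<open>T(n)\<close>.\<close>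

definition normal_form :: "weight \<Rightarrow> free_alg \<Rightarrow> free_alg" where
  "normal_form mu = lin_ext (\<lambda>w. foldr (opr mu) (letters w) 1)"

lemma clin_normal_form [intro!]: "clin (normal_form mu)"
  by (simp add: normal_form_def clin_lin_ext)

lemma normal_form_mono: "normal_form mu (word_vec w) = foldr (opr mu) w 1"
  by (simp add: normal_form_def)

lemma normal_form_one [simp]: "normal_form mu 1 = 1"
  by (simp add: one_eq_mono normal_form_mono)

lemma normal_form_mono_mult: "normal_form mu (word_vec w * u) = foldr (opr mu) w (normal_form mu u)"
proof (rule clin_span_eq[of "\<lambda>u. normal_form mu (word_vec w * u)" "\<lambda>u. foldr (opr mu) w (normal_form mu u)",
    OF _ _ _ free_alg_span])
  show "clin (\<lambda>u. normal_form mu (word_vec w * u))"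
    by (intro clin_comp[OF clin_normal_form] clin_mult_right)
  have "clin (foldr (opr mu) w)"
    by (induction w) (simp_all add: clin_def clin_add[OF clin_opr] clin_scal[OF clin_opr])
  from clin_comp[OF this clin_normal_form]
  show "clin (\<lambda>u. foldr (opr mu) w (normal_form mu u))" .
qed (auto simp: mono_mult_mono normal_form_mono)

lemma normal_form_gen_mult: "normal_form mu (gen b * u) = opr mu b (normal_form mu u)"
  using normal_form_mono_mult[of mu "[b]" u] by (simp add: gen_def)

lemma normal_form_in: "normal_form mu u \<in> free_alg_n"
proof (rule clin_span_into[OF clin_normal_form subspace_free_alg_n _ free_alg_span])
  fix g assume "g \<in> range word_vec"
  then obtain w where "g = word_vec w" by blast
  moreover have "foldr (opr mu) w 1 \<in> free_alg_n"
    by (induction w) (auto intro: opr_free_alg_n one_in_free_alg_n)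
  ultimately show "normal_form mu g \<in> free_alg_n" by (simp add: normal_form_mono)
qed

lemma verma_gens_eq: "verma_gens mu = (\<lambda>b. gen b - scal (hw_val mu b) 1) ` (- n_minus)"
proof -
  obtain i k m where mu: "mu = (i, k, m)" by (cases mu)
  have "- n_minus = n_plus \<union> {Loop H 0, Central, Deg}" using borel_iff by auto
  moreover have "(\<lambda>b. gen b - scal (hw_val mu b) 1) ` n_plus = gen ` n_plus"
    by (intro image_cong refl) (simp add: hw_val_n_plus)
  ultimately show ?thesis
    by (simp only: image_Un) (simp add: verma_gens_def mu hw_val_def)
qed

lemma verma_lower: "lower (verma mu) = cvec.span (env_ideal \<union> {u * g |u g. g \<in> verma_gens mu})"
  by (simp add: verma_def)

lemma subspace_verma_lower: "cvec.subspace (lower (verma mu))"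
  by (simp add: verma_lower)

text \<open>With \<open>normal_form_cong_verma\<close>, this says that the Verma module is \<open>U(n)\<close>: the left ideal that
  defines it meets \<open>T(n)\<close> only in the relations of \<open>U(n)\<close>.\<close>

lemma normal_form_verma_lower:
  assumes "u \<in> lower (verma mu)"
  shows "normal_form mu u \<in> nideal"
proof (rule clin_span_into[OF clin_normal_form subspace_nideal _ assms[unfolded verma_lower]])
  fix g assume "g \<in> env_ideal \<union> {u * g |u g. g \<in> verma_gens mu}"
  then show "normal_form mu g \<in> nideal"
  proof
    assume "g \<in> env_ideal"
    then show ?thesis
      unfolding env_ideal_def
    proof (rule clin_span_into[OF clin_normal_form subspace_nideal, rotated])
      fix g assume "g \<in> {u * (gen b * gen c - gen c * gen b - lin_ext gen (aff_bracket b c)) * v |u v b c. True}"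
      then obtain u v b c where g: "g = u * ((gen b * gen c - gen c * gen b - lin_ext gen (aff_bracket b c)) * v)"
        by (auto simp: mult.assoc)
      define r where "r = (gen b * gen c - gen c * gen b - lin_ext gen (aff_bracket b c)) * v"
      have "normal_form mu (lin_ext gen (aff_bracket b c) * v) = oprl mu (aff_bracket b c) (normal_form mu v)"
        unfolding clin_lin_ext_comp[OF clin_mult_left] clin_lin_ext_comp[OF clin_normal_form]
        by (simp add: normal_form_gen_mult)
      then have "normal_form mu r = oprel mu b c (normal_form mu v)"
        by (simp add: r_def left_diff_distrib clin_diff[OF clin_normal_form] mult.assoc normal_form_gen_mult oprel_def)
      then have r: "normal_form mu r \<in> nideal" by (simp add: oprel_in_nideal normal_form_in)
      have "normal_form mu (u * r) \<in> nideal"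
      proof (rule clin_span_into[of "\<lambda>u. normal_form mu (u * r)", OF _ subspace_nideal _ free_alg_span])
        show "clin (\<lambda>u. normal_form mu (u * r))" by (intro clin_comp[OF clin_normal_form] clin_mult_left)
        fix h assume "h \<in> range word_vec"
        then obtain w where "h = word_vec w" by blast
        moreover have "foldr (opr mu) w (normal_form mu r) \<in> nideal"
          by (induction w) (auto intro: opr_nideal r)
        ultimately show "normal_form mu (h * r) \<in> nideal" by (simp add: normal_form_mono_mult)
      qed
      then show "normal_form mu g \<in> nideal" by (simp add: g r_def)
    qed
  next
    assume "g \<in> {u * g |u g. g \<in> verma_gens mu}"
    then obtain u h where g: "g = u * h" "h \<in> verma_gens mu" by blast
    have nf: "normal_form mu (gen b) = scal (hw_val mu b) 1" if "b \<notin> n_minus" for b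
      using normal_form_gen_mult[of mu b 1] that by (simp add: opr_one)
    from g(2) have h0: "normal_form mu h = 0"
      by (auto simp: verma_gens_eq nf clin_diff[OF clin_normal_form] clin_scal[OF clin_normal_form])
    have "normal_form mu (u * h) = 0"
    proof (rule clin_span_eq[of "\<lambda>u. normal_form mu (u * h)", OF _ clin_zero _ free_alg_span])
      show "clin (\<lambda>u. normal_form mu (u * h))" by (intro clin_comp[OF clin_normal_form] clin_mult_left)
      fix h' assume "h' \<in> range word_vec"
      then obtain w where "h' = word_vec w" by blast
      moreover have "foldr (opr mu) w 0 = 0" by (induction w) (auto simp: clin_0[OF clin_opr])
      ultimately show "normal_form mu (h' * h) = 0" by (simp add: normal_form_mono_mult h0)
    qed
    then show ?thesis using g(1) subspace_nideal cvec.subspace_0 by metis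
  qed
qed

lemma gen_mult_verma_lower:
  assumes "u \<in> lower (verma mu)"
  shows "gen b * u \<in> lower (verma mu)"
proof (rule clin_span_into[OF clin_mult_right subspace_verma_lower _ assms[unfolded verma_lower]])
  fix g assume "g \<in> env_ideal \<union> {u * g |u g. g \<in> verma_gens mu}"
  then show "gen b * g \<in> lower (verma mu)"
  proof
    assume "g \<in> env_ideal"
    then have "gen b * g \<in> env_ideal"
      unfolding env_ideal_def
    proof (rule clin_span_into[OF clin_mult_right cvec.subspace_span, rotated])
      fix h :: free_alg
      assume "h \<in> {u * (gen b * gen c - gen c * gen b - lin_ext gen (aff_bracket b c)) * v |u v b c. True}"
      then obtain u v x y where "h = u * (gen x * gen y - gen y * gen x - lin_ext gen (aff_bracket x y)) * v"
        by blast
      then have "gen b * h = gen b * u * (gen x * gen y - gen y * gen x - lin_ext gen (aff_bracket x y)) * v"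
        by (simp only: mult.assoc)
      then show "gen b * h \<in> cvec.span
          {u * (gen b * gen c - gen c * gen b - lin_ext gen (aff_bracket b c)) * v |u v b c. True}"
        by (intro cvec.span_base) blast
    qed
    then show ?thesis unfolding verma_lower by (intro cvec.span_base) simp
  next
    assume "g \<in> {u * g |u g. g \<in> verma_gens mu}"
    then obtain u h where "g = u * h" "h \<in> verma_gens mu" by blast
    then have "gen b * g \<in> {u * g |u g. g \<in> verma_gens mu}" by (metis (mono_tags, lifting) mem_Collect_eq mult.assoc)
    then show ?thesis unfolding verma_lower by (intro cvec.span_base) simp
  qed
qed

lemma verma_rel: "gen b * (gen c * v) - gen c * (gen b * v) - lin_ext (\<lambda>d. gen d * v) (aff_bracket b c) \<in> lower (verma mu)"
proof -
  have "1 * (gen b * gen c - gen c * gen b - lin_ext gen (aff_bracket b c)) * v \<in> env_ideal"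
    unfolding env_ideal_def by (intro cvec.span_base) blast
  then have "(gen b * gen c - gen c * gen b - lin_ext gen (aff_bracket b c)) * v \<in> lower (verma mu)"
    unfolding verma_lower by (intro cvec.span_base) simp
  then show ?thesis by (simp add: left_diff_distrib mult.assoc clin_lin_ext_comp[OF clin_mult_left])
qed

text \<open>The operators follow the commutation rules, and these hold in the Verma module.\<close>

lemma opr_cong_verma:
  assumes "u \<in> free_alg_n"
  shows "gen b * u - opr mu b u \<in> lower (verma mu)"
proof -
  have "gen b * word_vec w - opr mu b (word_vec w) \<in> lower (verma mu)" if "set w \<subseteq> n_minus" for w
    using that
  proof (induction w arbitrary: b)
    case Nil
    show ?case
    proof (cases "b \<in> n_minus")
      case False
      then have "gen b - scal (hw_val mu b) 1 \<in> verma_gens mu"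
        by (auto simp: verma_gens_eq)
      then have "1 * (gen b - scal (hw_val mu b) 1) \<in> lower (verma mu)"
        unfolding verma_lower by (intro cvec.span_base) blast
      then show ?thesis using False by (simp add: opr_one flip: one_eq_mono)
    qed (simp add: opr_n_minus cvec.subspace_0[OF subspace_verma_lower])
  next
    case (Cons x w)
    show ?case
    proof (cases "b \<in> n_minus")
      case False
      define m where "m = word_vec w"
      have IH: "gen d * m - opr mu d m \<in> lower (verma mu)" for d using Cons by (auto simp: m_def)
      have "gen b * (gen x * m) - opr mu b (gen x * m)
        = (gen b * (gen x * m) - gen x * (gen b * m) - lin_ext (\<lambda>d. gen d * m) (aff_bracket b x))
          + gen x * (gen b * m - opr mu b m) + lin_ext (\<lambda>d. gen d * m - opr mu d m) (aff_bracket b x)"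
        using False by (simp add: opr_gen_mult right_diff_distrib lin_ext_minus_fun)
      also have "\<dots> \<in> lower (verma mu)"
        by (intro cvec.subspace_add[OF subspace_verma_lower] verma_rel gen_mult_verma_lower
            lin_ext_in[OF subspace_verma_lower] IH)
      finally show ?thesis by (simp add: m_def gen_mult_mono)
    qed (simp add: opr_n_minus cvec.subspace_0[OF subspace_verma_lower])
  qed
  then show ?thesis
    by (intro clin_span_into[where f = "\<lambda>u. gen b * u - opr mu b u", OF _ subspace_verma_lower _ free_alg_n_span[OF assms]])
       (auto intro: clin_minus clin_mult_right)
qed

lemma normal_form_cong_verma: "u - normal_form mu u \<in> lower (verma mu)"
proof -
  have "word_vec w - normal_form mu (word_vec w) \<in> lower (verma mu)" for w
  proof (induction w)
    case Nil
    then show ?case by (simp add: normal_form_mono flip: one_eq_mono)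
        (simp add: cvec.subspace_0[OF subspace_verma_lower])
  next
    case (Cons b w)
    define y where "y = normal_form mu (word_vec w)"
    have "word_vec (b # w) - normal_form mu (word_vec (b # w)) = gen b * (word_vec w - y) + (gen b * y - opr mu b y)"
      by (simp add: y_def right_diff_distrib gen_mult_mono normal_form_mono)
    also have "\<dots> \<in> lower (verma mu)"
      using Cons.IH by (intro cvec.subspace_add[OF subspace_verma_lower] gen_mult_verma_lower opr_cong_verma)
         (auto simp: y_def normal_form_in)
    finally show ?case .
  qed
  then show ?thesis
    by (intro clin_span_into[where f = "\<lambda>u. u - normal_form mu u" and v = u,
          OF clin_minus[OF clin_id clin_normal_form] subspace_verma_lower _ free_alg_span]) auto
qed


section \<open>Coinvariants of a Verma module tensored with another module\<close>

lemma tensor_mod_act: 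
  assumes "clin (act M b)" "clin (act V b)"
  shows "act (tensor_mod M V) b (u \<otimes> v) = act M b u \<otimes> v + u \<otimes> act V b v"
proof -
  let ?f = "act (tensor_mod M V) b"
  have f: "clin ?f" by (simp add: tensor_mod_def clin_lin_ext)
  have "?f (basis_vec i \<otimes> v) = act M b (basis_vec i) \<otimes> v + basis_vec i \<otimes> act V b v" for i
  proof (rule clin_eq[where v = v and f = "\<lambda>v. ?f (basis_vec i \<otimes> v)"])
    show "clin (\<lambda>v. ?f (basis_vec i \<otimes> v))" by (rule clin_comp[OF f clin_tens_right])
    show "clin (\<lambda>v. act M b (basis_vec i) \<otimes> v + basis_vec i \<otimes> act V b v)"
      by (intro clin_plus clin_tens_right clin_comp[OF clin_tens_right assms(2)])
  qed (simp add: tensor_mod_def)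
  then show ?thesis
    by (intro clin_eq[where v = u and f = "\<lambda>u. ?f (u \<otimes> v)"])
       (intro clin_comp[OF f clin_tens_left] clin_plus clin_tens_left clin_comp[OF clin_tens_left assms(1)] | simp)+
qed

lemma direct_sum_act:
  assumes "clin (act (M w) b)"
  shows "act (direct_sum I M) b (basis_vec w \<otimes> v) = basis_vec w \<otimes> act (M w) b v"
proof (rule clin_eq[where v = v and f = "\<lambda>v. act (direct_sum I M) b (basis_vec w \<otimes> v)"])
  show "clin (\<lambda>v. act (direct_sum I M) b (basis_vec w \<otimes> v))"
    by (rule clin_comp[OF _ clin_tens_right]) (simp add: direct_sum_def clin_lin_ext)
  show "clin (\<lambda>v. basis_vec w \<otimes> act (M w) b v)"
    by (rule clin_comp[OF clin_tens_right assms])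
qed (simp add: direct_sum_def)

lemma act_verma: "act (verma mu) b = (\<lambda>v. gen b * v)"
  by (simp add: verma_def)

lemma clin_act_verma: "clin (act (verma mu) b)"
  unfolding act_verma by (rule clin_mult_right)

text \<open>The elements that act on the second factor: those of \<open>n\<close>, and \<open>h\<^sub>0\<close>, \<open>d\<close>, which define the grading.\<close>

definition lower_ops :: "aff set" where
  "lower_ops = n_minus \<union> {Loop H 0, Deg}"

text \<open>The quotient \<open>upper V / lower V\<close> is embedded in an ambient space \<open>A\<close> on which the commutation
  relations hold exactly and not only modulo \<open>lower V\<close>. This keeps congruences out of the
  construction of the maps below.\<close>

locale lower_module =
  fixes V :: "'j lmod" and A :: "'j cvec set"
  assumes clin_act: "clin (act V b)"
    and subspace_upper: "cvec.subspace (upper V)"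
    and subspace_lower: "cvec.subspace (lower V)"
    and lower_upper: "lower V \<subseteq> upper V"
    and upper_A: "upper V \<subseteq> A"
    and subspace_A: "cvec.subspace A"
    and act_A: "b \<in> lower_ops \<Longrightarrow> z \<in> A \<Longrightarrow> act V b z \<in> A"
    and act_upper: "b \<in> lower_ops \<Longrightarrow> z \<in> upper V \<Longrightarrow> act V b z \<in> upper V"
    and act_lower: "b \<in> lower_ops \<Longrightarrow> z \<in> lower V \<Longrightarrow> act V b z \<in> lower V"
    and act_bracket: "b \<in> lower_ops \<Longrightarrow> c \<in> lower_ops \<Longrightarrow> z \<in> A \<Longrightarrow>
      act V b (act V c z) - act V c (act V b z) = lin_ext (\<lambda>d. act V d z) (aff_bracket b c)"
begin

text \<open>The action of the image of \<open>u\<close> under the antipode \<open>x\<^sub>1 \<dots> x\<^sub>r \<mapsto> (-1)\<^sup>r x\<^sub>r \<dots> x\<^sub>1\<close>. In the coinvariants of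
  \<open>M \<otimes> V\<close> the vector \<open>u m \<otimes> z\<close> equals \<open>m \<otimes> S(u) z\<close>, because \<open>x (m \<otimes> z) = x m \<otimes> z + m \<otimes> x z\<close> vanishes there.\<close>

definition antipode_act :: "free_alg \<Rightarrow> 'j cvec \<Rightarrow> 'j cvec" where
  "antipode_act u z = lin_ext (\<lambda>w. fold (\<lambda>x z. - act V x z) (letters w) z) u"

lemma clin_antipode_act_left: "clin (\<lambda>u. antipode_act u z)"
  by (simp add: antipode_act_def clin_lin_ext)

lemma clin_antipode_act_right: "clin (antipode_act u)"
proof -
  have "clin (fold (\<lambda>x z. - act V x z) w)" for w
  proof (induction w)
    case (Cons x w)
    from clin_comp[OF Cons.IH clin_neg[OF clin_act]] show ?case by (simp add: comp_def)
  qed (simp add: clin_def)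
  then show ?thesis unfolding antipode_act_def by (intro clin_lin_ext_fun)
qed

lemma antipode_act_mono: "antipode_act (word_vec w) z = fold (\<lambda>x z. - act V x z) w z"
  by (simp add: antipode_act_def)

lemma antipode_act_one: "antipode_act 1 z = z"
  by (simp add: one_eq_mono antipode_act_mono)

lemma antipode_act_mono_mult: "antipode_act (word_vec w * u) z = antipode_act u (antipode_act (word_vec w) z)"
proof (rule clin_span_eq[where f = "\<lambda>u. antipode_act (word_vec w * u) z" and v = u, OF _ _ _ free_alg_span])
  show "clin (\<lambda>u. antipode_act (word_vec w * u) z)"
    by (rule clin_comp[OF clin_antipode_act_left clin_mult_right])
  show "clin (\<lambda>u. antipode_act u (antipode_act (word_vec w) z))"
    by (rule clin_antipode_act_left)
qed (auto simp: mono_mult_mono antipode_act_mono)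

lemma antipode_act_gen_mult: "antipode_act (gen x * u) z = - antipode_act u (act V x z)"
  using antipode_act_mono_mult[of "[x]" u z]
  by (simp add: gen_def antipode_act_mono clin_uminus[OF clin_antipode_act_right])

lemma antipode_act_in:
  assumes "cvec.subspace S" "\<And>x z. x \<in> n_minus \<Longrightarrow> z \<in> S \<Longrightarrow> act V x z \<in> S"
    and u: "u \<in> free_alg_n" and z: "z \<in> S"
  shows "antipode_act u z \<in> S"
proof (rule clin_span_into[where f = "\<lambda>u. antipode_act u z", OF clin_antipode_act_left assms(1) _ free_alg_n_span[OF u]])
  fix g assume "g \<in> word_vec ` {w. set w \<subseteq> n_minus}"
  then obtain w where w: "g = word_vec w" "set w \<subseteq> n_minus" by blast
  from w(2) z have "fold (\<lambda>x z. - act V x z) w z \<in> S"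
    by (induction w arbitrary: z) (auto intro!: cvec.subspace_neg[OF assms(1)] assms(2))
  then show "antipode_act g z \<in> S" by (simp add: w antipode_act_mono)
qed

lemma n_minus_lower_ops: "x \<in> n_minus \<Longrightarrow> x \<in> lower_ops"
  by (simp add: lower_ops_def)

lemma antipode_act_nideal:
  assumes "u \<in> nideal" "z \<in> A"
  shows "antipode_act u z = 0"
proof (rule clin_span_eq[where f = "\<lambda>u. antipode_act u z", OF clin_antipode_act_left clin_zero _ assms(1)[unfolded nideal_def]])
  fix g assume "g \<in> nideal_gens"
  then obtain u x y v where g: "g = word_vec u * (nrel x y * v)" "set u \<subseteq> n_minus" "x \<in> n_minus" "y \<in> n_minus" unfolding nideal_gens_def by blast
  define z' where "z' = antipode_act (word_vec u) z"
  have z': "z' \<in> A"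
    unfolding z'_def using g(2) assms(2)
    by (intro antipode_act_in[OF subspace_A] act_A n_minus_lower_ops) (simp_all add: mono_in_free_alg_n)
  have "antipode_act (lin_ext gen (aff_bracket x y) * v) z' = lin_ext (\<lambda>d. antipode_act (gen d * v) z') (aff_bracket x y)"
    unfolding clin_lin_ext_comp[OF clin_mult_left] clin_lin_ext_comp[OF clin_antipode_act_left] ..
  also have "\<dots> = - antipode_act v (lin_ext (\<lambda>d. act V d z') (aff_bracket x y))"
    unfolding clin_lin_ext_comp[OF clin_antipode_act_right] by (simp add: antipode_act_gen_mult lin_ext_uminus_fun)
  also have "\<dots> = - antipode_act v (act V x (act V y z') - act V y (act V x z'))"
    using act_bracket[of x y z'] g z' by (simp add: n_minus_lower_ops)
  finally have "antipode_act (nrel x y * v) z' = 0"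
    by (simp add: nrel_def left_diff_distrib mult.assoc antipode_act_gen_mult
        clin_diff[OF clin_antipode_act_left] clin_diff[OF clin_antipode_act_right] clin_uminus[OF clin_antipode_act_right])
  then show "antipode_act g z = 0"
    unfolding g(1) antipode_act_mono_mult z'_def by simp
qed

lemma cartan_bracket_n:
  assumes "b \<in> {Loop H 0, Deg}" "x \<in> n_minus"
  obtains a where "aff_bracket b x = scal a (basis_vec x)"
proof -
  obtain y i where x: "x = Loop y i" using assms(2) by (auto simp: n_minus_iff)
  have "\<exists>a. aff_bracket b x = scal a (basis_vec x)"
  proof (cases "b = Deg")
    case True
    then show ?thesis unfolding x by (intro exI[of _ "- of_int i"]) simp
  next
    case False
    then have "b = Loop H 0" using assms(1) by blast
    moreover have "\<exists>a. sl2_bracket H y = scal a (basis_vec y)"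
      by (cases y) (auto intro: exI[of _ 0] exI[of _ 2] exI[of _ "- 2"])
    ultimately show ?thesis unfolding x by (auto simp: lin_ext_scaled_basis)
  qed
  then show thesis using that by blast
qed

text \<open>A transported form of \<open>b (u v\<^sub>\<lambda> \<otimes> z) = b u v\<^sub>\<lambda> \<otimes> z + u v\<^sub>\<lambda> \<otimes> b z\<close>: under the passage to \<open>V\<close> the operator
  \<open>b\<close> becomes \<open>\<lambda>(b) + b\<close>. The proof moves \<open>b\<close> across the letters of \<open>u\<close>; a letter \<open>x\<close> is an eigenvector
  of \<open>b\<close>, and the two contributions of its eigenvalue \<open>a\<close> cancel.\<close>

lemma antipode_act_cartan:
  assumes b: "b \<in> {Loop H 0, Deg}" and u: "u \<in> free_alg_n" and z: "z \<in> A"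
  shows "antipode_act (opr mu b u) z + antipode_act u (act V b z)
    = scal (hw_val mu b) (antipode_act u z) + act V b (antipode_act u z)"
proof -
  have bn: "b \<notin> n_minus" using b by (auto simp: n_minus_iff)
  have bo: "b \<in> lower_ops" using b by (auto simp: lower_ops_def)
  define f where "f u z = antipode_act (opr mu b u) z + antipode_act u (act V b z)
    - (scal (hw_val mu b) (antipode_act u z) + act V b (antipode_act u z))" for u z
  have f: "clin (\<lambda>u. f u z)" for z unfolding f_def
    by (intro clin_minus clin_plus clin_antipode_act_left clin_scaled clin_comp[OF clin_act clin_antipode_act_left]
       clin_comp[OF clin_antipode_act_left clin_opr])
  have "f (word_vec w) z = 0" if "set w \<subseteq> n_minus" "z \<in> A" for w z
    using that
  proof (induction w arbitrary: z)
    case Nil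
    then show ?case using bn
      by (simp add: f_def opr_one antipode_act_one clin_scal[OF clin_antipode_act_left] flip: one_eq_mono)
  next
    case (Cons x w)
    then have x: "x \<in> n_minus" and w: "set w \<subseteq> n_minus" by auto
    obtain a where a: "aff_bracket b x = scal a (basis_vec x)" using cartan_bracket_n[OF b x] .
    define m where "m = word_vec w"
    define y where "y = act V x z"
    have "y \<in> A" unfolding y_def using Cons.prems by (intro act_A n_minus_lower_ops) auto
    then have "f m y = 0" using Cons.IH[OF w] by (simp add: m_def)
    then have IH: "antipode_act (opr mu b m) y + antipode_act m (act V b y)
       = scal (hw_val mu b) (antipode_act m y) + act V b (antipode_act m y)" by (simp add: f_def)
    have "act V b y - act V x (act V b z) = scal a y"
      unfolding y_def using act_bracket[OF bo n_minus_lower_ops[OF x], of z] Cons.prems by (simp add: a lin_ext_scaled_basis)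
    then have comm: "act V x (act V b z) = act V b y - scal a y" by (simp add: algebra_simps)
    have opr: "opr mu b (gen x * m) = gen x * opr mu b m + scal a (gen x * m)"
      using bn x by (simp add: opr_gen_mult a lin_ext_scaled_basis opr_n_minus)
    have "antipode_act (opr mu b (gen x * m)) z + antipode_act (gen x * m) (act V b z)
       = - (antipode_act (opr mu b m) y + antipode_act m (act V b y))"
      unfolding opr clin_add[OF clin_antipode_act_left] clin_scal[OF clin_antipode_act_left] antipode_act_gen_mult comm
        clin_diff[OF clin_antipode_act_right] clin_scal[OF clin_antipode_act_right]
      by (simp add: y_def)
    also have "\<dots> = scal (hw_val mu b) (antipode_act (gen x * m) z) + act V b (antipode_act (gen x * m) z)"
      unfolding IH antipode_act_gen_mult by (simp add: y_def clin_uminus[OF clin_act])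
    finally show ?case by (simp add: f_def m_def gen_mult_mono)
  qed
  then have "f u z = 0"
    using z by (intro clin_span_eq[where f = "\<lambda>u. f u z" and v = u, OF f clin_zero _ free_alg_n_span[OF u]]) auto
  then show ?thesis by (simp add: f_def)
qed

end

text \<open>The coinvariants of a direct sum of Verma modules tensored with \<open>V\<close>, for the computation of one
  term of the resolution.\<close>

locale coinvariants = lower_module V A for V :: "'j lmod" and A +
  fixes I :: "'w set" and mu :: "'w \<Rightarrow> weight"
begin

abbreviation "FM \<equiv> direct_sum I (\<lambda>w. verma (mu w))"
abbreviation "T \<equiv> tensor_mod FM V"
abbreviation "Q \<equiv> trivial_tensor_Un T"

definition gens :: "(('w \<times> aff free_word) \<times> 'j) cvec set" where
  "gens = {(basis_vec w \<otimes> a) \<otimes> z |w a z. w \<in> I \<and> z \<in> upper V}"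

lemma clin_act_T: "clin (act T b)" by (simp add: tensor_mod_def clin_lin_ext)

lemma clin_act_FM: "clin (act FM b)" by (simp add: direct_sum_def clin_lin_ext)

lemma act_T: "act T b ((basis_vec w \<otimes> a) \<otimes> z) = (basis_vec w \<otimes> (gen b * a)) \<otimes> z + (basis_vec w \<otimes> a) \<otimes> act V b z"
  using direct_sum_act[of "\<lambda>w. verma (mu w)" w b I a] 
  by (simp add: tensor_mod_act[OF clin_act_FM clin_act] clin_act_verma) (simp add: act_verma)

lemma act_Q: "act Q = act T" by (simp add: trivial_tensor_Un_def)

lemma upper_Q: "upper Q = upper T" by (simp add: trivial_tensor_Un_def)

lemma lower_Q: "lower Q = cvec.span (lower T \<union>
   {scal (augmentation u) v - free_alg_act T u v |u v. u \<in> free_alg_n \<and> v \<in> upper T})"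
  by (simp add: trivial_tensor_Un_def)

lemma subspace_upper_T: "cvec.subspace (upper T)" by (simp add: tensor_mod_def)
lemma subspace_lower_Q: "cvec.subspace (lower Q)" by (simp add: lower_Q)

lemma upper_FM: "upper FM = cvec.span {basis_vec w \<otimes> a |w a. w \<in> I}"
  by (simp add: direct_sum_def verma_def)

lemma lower_FM: "lower FM = cvec.span {basis_vec w \<otimes> a |w a. w \<in> I \<and> a \<in> lower (verma (mu w))}"
  by (simp add: direct_sum_def)

lemma upper_T: "upper T = cvec.span gens"
proof
  show "cvec.span gens \<subseteq> upper T"
  proof (intro cvec.span_minimal subspace_upper_T subsetI)
    fix g assume "g \<in> gens"
    then obtain w a z where g: "g = (basis_vec w \<otimes> a) \<otimes> z" "w \<in> I" "z \<in> upper V" by (auto simp: gens_def)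
    have "basis_vec w \<otimes> a \<in> upper FM" unfolding upper_FM using g by (intro cvec.span_base) blast
    then show "g \<in> upper T" unfolding tensor_mod_def using g by (auto intro: cvec.span_base)
  qed
  have "u \<otimes> v \<in> cvec.span gens" if u: "u \<in> upper FM" and v: "v \<in> upper V" for u v
    by (rule clin_span_into[where f = "\<lambda>u. u \<otimes> v", OF clin_tens_left _ _ u[unfolded upper_FM]])
       (use v in \<open>auto simp: gens_def intro!: cvec.span_base\<close>)
  then have "{u \<otimes> v |u v. u \<in> upper FM \<and> v \<in> upper V} \<subseteq> cvec.span gens" by blast
  then show "upper T \<subseteq> cvec.span gens" unfolding tensor_mod_def by (simp add: cvec.span_minimal)
qed

lemma lower_T_gen: 
  assumes "w \<in> I" "a \<in> lower (verma (mu w))" "z \<in> upper V"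
  shows "(basis_vec w \<otimes> a) \<otimes> z \<in> lower T"
proof -
  have "basis_vec w \<otimes> a \<in> lower FM" unfolding lower_FM using assms by (intro cvec.span_base) blast
  then have "(basis_vec w \<otimes> a) \<otimes> z \<in> {u \<otimes> v |u v. u \<in> lower FM \<and> v \<in> upper V}" using assms by blast
  then show ?thesis unfolding tensor_mod_def by (simp add: cvec.span_base)
qed

lemma lower_T_gen_V: 
  assumes "w \<in> I" "z \<in> lower V"
  shows "(basis_vec w \<otimes> a) \<otimes> z \<in> lower T"
proof -
  have "basis_vec w \<otimes> a \<in> upper FM" unfolding upper_FM using assms by (intro cvec.span_base) blast
  then have "(basis_vec w \<otimes> a) \<otimes> z \<in> {u \<otimes> v |u v. u \<in> upper FM \<and> v \<in> lower V}" using assms by blast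
  then show ?thesis unfolding tensor_mod_def by (simp add: cvec.span_base)
qed

lemma act_upper_T:
  assumes "b \<in> lower_ops" "v \<in> upper T"
  shows "act T b v \<in> upper T"
proof (rule clin_span_into[where f = "act T b", OF clin_act_T subspace_upper_T _ assms(2)[unfolded upper_T]])
  fix g assume "g \<in> gens"
  then obtain w a z where g: "g = (basis_vec w \<otimes> a) \<otimes> z" "w \<in> I" "z \<in> upper V" by (auto simp: gens_def)
  show "act T b g \<in> upper T"
    unfolding g(1) act_T upper_T
    using g act_upper[OF assms(1)] by (intro cvec.span_add cvec.span_base) (auto simp: gens_def)
qed

text \<open>The isomorphism from the coinvariants to the direct sum of copies of \<open>V\<close>. It sends
  \<open>u v\<^sub>\<lambda> \<otimes> z\<close>, \<open>u\<close> in \<open>U(n)\<close>, to \<open>S(u) z\<close>; its inverse is \<open>from_V\<close>.\<close>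

definition to_V :: "(('w \<times> aff free_word) \<times> 'j) cvec \<Rightarrow> ('w \<times> 'j) cvec" where
  "to_V = lin_ext (\<lambda>((w, u), j). basis_vec w \<otimes> antipode_act (normal_form (mu w) (basis_vec u)) (basis_vec j))"

definition from_V :: "('w \<times> 'j) cvec \<Rightarrow> (('w \<times> aff free_word) \<times> 'j) cvec" where
  "from_V = lin_ext (\<lambda>(w, j). (basis_vec w \<otimes> 1) \<otimes> basis_vec j)"

text \<open>The operator on the copies of \<open>V\<close> that corresponds to \<open>b\<close> on the coinvariants.\<close>

definition cartan_act :: "aff \<Rightarrow> ('w \<times> 'j) cvec \<Rightarrow> ('w \<times> 'j) cvec" where
  "cartan_act b = lin_ext (\<lambda>(w, j). basis_vec w \<otimes> (scal (hw_val (mu w) b) (basis_vec j) + act V b (basis_vec j)))"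

lemma clin_to_V: "clin to_V" and clin_from_V: "clin from_V" and clin_cartan_act: "clin (cartan_act b)"
  by (simp_all add: to_V_def from_V_def cartan_act_def clin_lin_ext)

lemma to_V_tens: "to_V ((basis_vec w \<otimes> a) \<otimes> z) = basis_vec w \<otimes> antipode_act (normal_form (mu w) a) z"
proof -
  have "to_V ((basis_vec w \<otimes> basis_vec u) \<otimes> z) = basis_vec w \<otimes> antipode_act (normal_form (mu w) (basis_vec u)) z" for u
  proof (rule clin_eq[where v = z and f = "\<lambda>z. to_V ((basis_vec w \<otimes> basis_vec u) \<otimes> z)"])
    show "clin (\<lambda>z. to_V ((basis_vec w \<otimes> basis_vec u) \<otimes> z))" by (rule clin_comp[OF clin_to_V clin_tens_right])
    show "clin (\<lambda>z. basis_vec w \<otimes> antipode_act (normal_form (mu w) (basis_vec u)) z)"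
      by (rule clin_comp[OF clin_tens_right clin_antipode_act_right])
  qed (simp add: to_V_def)
  then show ?thesis
    by (intro clin_eq[where v = a and f = "\<lambda>a. to_V ((basis_vec w \<otimes> a) \<otimes> z)"] 
        clin_comp[OF clin_to_V clin_comp[OF clin_tens_left clin_tens_right]]
        clin_comp[OF clin_tens_right clin_comp[OF clin_antipode_act_left clin_normal_form]])
qed

lemma from_V_tens: "from_V (basis_vec w \<otimes> z) = (basis_vec w \<otimes> 1) \<otimes> z"
  by (rule clin_eq[where v = z and f = "\<lambda>z. from_V (basis_vec w \<otimes> z)", OF clin_comp[OF clin_from_V clin_tens_right] clin_tens_right])
     (simp add: from_V_def)

lemma cartan_act_tens: "cartan_act b (basis_vec w \<otimes> z) = basis_vec w \<otimes> (scal (hw_val (mu w) b) z + act V b z)"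
  by (rule clin_eq[where v = z and f = "\<lambda>z. cartan_act b (basis_vec w \<otimes> z)", OF clin_comp[OF clin_cartan_act clin_tens_right] 
        clin_comp[OF clin_tens_right clin_plus[OF clin_scaled[OF clin_id] clin_act]]])
     (simp add: cartan_act_def)

lemma slice_cartan_act: "slice w (cartan_act b y) = scal (hw_val (mu w) b) (slice w y) + act V b (slice w y)"
  by (rule clin_eq[where v = y and f = "\<lambda>y. slice w (cartan_act b y)", OF clin_comp[OF clin_slice clin_cartan_act]
       clin_plus[OF clin_scaled[OF clin_slice] clin_comp[OF clin_act clin_slice]]])
    (auto simp: cartan_act_tens clin_0[OF clin_act] simp flip: basis_tens_basis)

lemma to_V_from_V: "to_V (from_V y) = y"
  by (rule clin_eq[where v = y and f = "\<lambda>y. to_V (from_V y)", OF clin_comp[OF clin_to_V clin_from_V] clin_id])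
     (auto simp: from_V_tens to_V_tens antipode_act_one simp flip: basis_tens_basis)

abbreviation "X \<equiv> dsum I (\<lambda>w. upper V)"
abbreviation "Y \<equiv> dsum I (\<lambda>w. lower V)"

lemma X_span: "X = cvec.span {basis_vec w \<otimes> z |w z. w \<in> I \<and> z \<in> upper V}"
  and Y_span: "Y = cvec.span {basis_vec w \<otimes> z |w z. w \<in> I \<and> z \<in> lower V}"
  by (simp_all add: span_dsum subspace_upper subspace_lower)

lemma subspace_X: "cvec.subspace X" and subspace_Y: "cvec.subspace Y" and Y_X: "Y \<subseteq> X"
  using lower_upper by (auto simp: X_span Y_span intro!: cvec.span_mono)

lemma antipode_act_upper: "u \<in> free_alg_n \<Longrightarrow> z \<in> upper V \<Longrightarrow> antipode_act u z \<in> upper V"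
  by (rule antipode_act_in[OF subspace_upper]) (auto intro: act_upper n_minus_lower_ops)

lemma antipode_act_lower: "u \<in> free_alg_n \<Longrightarrow> z \<in> lower V \<Longrightarrow> antipode_act u z \<in> lower V"
  by (rule antipode_act_in[OF subspace_lower]) (auto intro: act_lower n_minus_lower_ops)

lemma to_V_upper:
  assumes "v \<in> upper T"
  shows "to_V v \<in> X"
proof (rule clin_span_into[OF clin_to_V subspace_X _ assms[unfolded upper_T]])
  fix g assume "g \<in> gens"
  then obtain w a z where g: "g = (basis_vec w \<otimes> a) \<otimes> z" "w \<in> I" "z \<in> upper V" by (auto simp: gens_def)
  have "antipode_act (normal_form (mu w) a) z \<in> upper V" using g by (intro antipode_act_upper normal_form_in)
  then show "to_V g \<in> X" unfolding g(1) to_V_tens X_span using g(2) by (intro cvec.span_base) blast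
qed

lemma to_V_lower_T:
  assumes "v \<in> lower T"
  shows "to_V v \<in> Y"
proof (rule clin_span_into[OF clin_to_V subspace_Y])
  show "v \<in> cvec.span ({u \<otimes> v |u v. u \<in> lower FM \<and> v \<in> upper V} \<union> {u \<otimes> v |u v. u \<in> upper FM \<and> v \<in> lower V})"
    using assms by (simp add: tensor_mod_def)
next
  fix g assume "g \<in> {u \<otimes> v |u v. u \<in> lower FM \<and> v \<in> upper V} \<union> {u \<otimes> v |u v. u \<in> upper FM \<and> v \<in> lower V}"
  then consider u z where "g = u \<otimes> z" "u \<in> lower FM" "z \<in> upper V"
    | u z where "g = u \<otimes> z" "u \<in> upper FM" "z \<in> lower V" by blast
  then show "to_V g \<in> Y"
  proof cases
    case (1 u z)
    have "to_V (u \<otimes> z) = 0"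
    proof (rule clin_span_eq[where f = "\<lambda>u. to_V (u \<otimes> z)", OF clin_comp[OF clin_to_V clin_tens_left] clin_zero _ 1(2)[unfolded lower_FM]])
      fix h assume "h \<in> {basis_vec w \<otimes> a |w a. w \<in> I \<and> a \<in> lower (verma (mu w))}"
      then obtain w a where h: "h = basis_vec w \<otimes> a" "a \<in> lower (verma (mu w))" by blast
      have "z \<in> A" using 1 upper_A by blast
      then show "to_V (h \<otimes> z) = 0"
        by (simp add: h(1) to_V_tens antipode_act_nideal normal_form_verma_lower[OF h(2)])
    qed
    then show ?thesis using 1 subspace_Y cvec.subspace_0 by metis
  next
    case (2 u z)
    show ?thesis unfolding 2(1)
    proof (rule clin_span_into[where f = "\<lambda>u. to_V (u \<otimes> z)", OF clin_comp[OF clin_to_V clin_tens_left] subspace_Y _ 2(2)[unfolded upper_FM]])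
      fix h assume "h \<in> {basis_vec w \<otimes> (a :: free_alg) |w a. w \<in> I}"
      then obtain w a where h: "h = basis_vec w \<otimes> a" "w \<in> I" by blast
      have "antipode_act (normal_form (mu w) a) z \<in> lower V" using 2(3) by (intro antipode_act_lower normal_form_in)
      then show "to_V (h \<otimes> z) \<in> Y" unfolding h(1) to_V_tens Y_span using h(2) by (intro cvec.span_base) blast
    qed
  qed
qed

lemma to_V_act_n:
  assumes "x \<in> n_minus" "v \<in> upper T"
  shows "to_V (act T x v) = 0"
proof (rule clin_span_eq[where f = "\<lambda>v. to_V (act T x v)", OF clin_comp[OF clin_to_V clin_act_T] clin_zero _ assms(2)[unfolded upper_T]])
  fix g assume "g \<in> gens"
  then obtain w a z where g: "g = (basis_vec w \<otimes> a) \<otimes> z" by (auto simp: gens_def)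
  show "to_V (act T x g) = 0"
    using assms(1)
    by (simp add: g act_T clin_add[OF clin_to_V] to_V_tens normal_form_gen_mult opr_n_minus antipode_act_gen_mult
       tens_add_right[symmetric])
qed

text \<open>A nonempty word in \<open>n\<close> maps \<open>v\<close> into \<open>n (M \<otimes> V)\<close>, which \<open>to_V\<close> annihilates; only the constant term
  of \<open>u\<close> survives.\<close>

lemma to_V_coinvariant:
  assumes u: "u \<in> free_alg_n" and v: "v \<in> upper T"
  shows "to_V (scal (augmentation u) v - free_alg_act T u v) = 0"
proof -
  have "to_V (foldr (act T) (letters w) v) = (if w = 0 then to_V v else 0)" if "w \<in> Poly_Mapping.keys u" for w
  proof (cases "letters w")
    case Nil
    then have "w = 0" by (metis free_word.collapse zero_free_word_def)
    with Nil show ?thesis by simp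
  next
    case (Cons x ws)
    then have "w \<noteq> 0" by (auto simp: zero_free_word_def)
    have "set (letters w) \<subseteq> n_minus" using u that unfolding free_alg_n_def by blast
    then have sub: "set (x # ws) \<subseteq> n_minus" using Cons by simp
    then have "set ws \<subseteq> n_minus" by simp
    then have "foldr (act T) ws v \<in> upper T"
      by (induction ws) (auto intro!: act_upper_T n_minus_lower_ops v)
    then show ?thesis using to_V_act_n[of x] sub Cons \<open>w \<noteq> 0\<close> by simp
  qed
  then have "to_V (free_alg_act T u v) = (\<Sum>w\<in>Poly_Mapping.keys u. scal (Poly_Mapping.lookup u w) (if w = 0 then to_V v else 0))"
    unfolding free_alg_act_def clin_sum[OF clin_to_V] clin_scal[OF clin_to_V] by (intro sum.cong refl) simp
  also have "\<dots> = (\<Sum>w\<in>Poly_Mapping.keys u. if w = 0 then scal (augmentation u) (to_V v) else 0)"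
    by (intro sum.cong) (auto simp: augmentation_def)
  also have "\<dots> = scal (augmentation u) (to_V v)"
    by (simp add: augmentation_def in_keys_iff)
  finally show ?thesis by (simp add: clin_diff[OF clin_to_V] clin_scal[OF clin_to_V])
qed

lemma to_V_lower:
  assumes "v \<in> lower Q"
  shows "to_V v \<in> Y"
proof (rule clin_span_into[OF clin_to_V subspace_Y _ assms[unfolded lower_Q]])
  fix g assume "g \<in> lower T \<union> {scal (augmentation u) v - free_alg_act T u v |u v. u \<in> free_alg_n \<and> v \<in> upper T}"
  then show "to_V g \<in> Y"
    using to_V_lower_T to_V_coinvariant cvec.subspace_0[OF subspace_Y] by auto
qed

lemma act_n_lower_Q:
  assumes "x \<in> n_minus" "v \<in> upper T"
  shows "act T x v \<in> lower Q"
proof -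
  have "gen x \<in> free_alg_n" using assms(1) by (simp add: gen_def mono_in_free_alg_n)
  then have "scal (augmentation (gen x)) v - free_alg_act T (gen x) v \<in> lower Q"
    unfolding lower_Q using assms by (intro cvec.span_base) blast
  moreover have "augmentation (gen x) = 0"
    by (simp add: augmentation_def gen_def lookup_single zero_free_word_def when_def)
  moreover have "free_alg_act T (gen x) v = act T x v"
    by (simp add: free_alg_act_def gen_def)
  ultimately show ?thesis using cvec.subspace_neg[OF subspace_lower_Q] by fastforce
qed

lemma lower_T_Q: "lower T \<subseteq> lower Q"
  unfolding lower_Q using cvec.span_superset by blast

text \<open>The first letter \<open>x\<close> of a word is moved to the second factor by subtracting the coinvariant
  relation \<open>x (m \<otimes> z)\<close>.\<close>

lemma free_part_cong:
  assumes "w \<in> I" "u \<in> free_alg_n" "z \<in> upper V"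
  shows "(basis_vec w \<otimes> u) \<otimes> z - (basis_vec w \<otimes> 1) \<otimes> antipode_act u z \<in> lower Q"
proof -
  define f where "f u z = (basis_vec w \<otimes> u) \<otimes> z - (basis_vec w \<otimes> 1) \<otimes> antipode_act u z" for u z
  have f: "clin (\<lambda>u. f u z)" for z unfolding f_def
    by (intro clin_minus clin_comp[OF clin_tens_left clin_tens_right] clin_comp[OF clin_tens_right clin_antipode_act_left])
  have "f (word_vec v) z \<in> lower Q" if "set v \<subseteq> n_minus" "z \<in> upper V" for v z
    using that
  proof (induction v arbitrary: z)
    case Nil
    then show ?case by (simp add: f_def antipode_act_one cvec.subspace_0[OF subspace_lower_Q] flip: one_eq_mono)
  next
    case (Cons x v)
    define m where "m = word_vec v"
    have x: "x \<in> n_minus" using Cons.prems by simp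
    have xz: "act V x z \<in> upper V" using Cons.prems x by (intro act_upper n_minus_lower_ops)
    then have IH: "f m (act V x z) \<in> lower Q" using Cons by (simp add: m_def)
    have "(basis_vec w \<otimes> m) \<otimes> z \<in> upper T"
      unfolding upper_T gens_def using Cons.prems assms(1) by (intro cvec.span_base) blast
    then have "act T x ((basis_vec w \<otimes> m) \<otimes> z) \<in> lower Q" by (rule act_n_lower_Q[OF x])
    moreover have "f (gen x * m) z = act T x ((basis_vec w \<otimes> m) \<otimes> z) - f m (act V x z)"
      unfolding f_def act_T antipode_act_gen_mult by (simp add: clin_uminus[OF clin_tens_right])
    ultimately show ?case using IH cvec.subspace_diff[OF subspace_lower_Q]
      by (simp add: m_def gen_mult_mono)
  qed
  then have "f u z \<in> lower Q"
    using assms by (intro clin_span_into[where f = "\<lambda>u. f u z" and v = u, OF f subspace_lower_Q _ free_alg_n_span[OF assms(2)]]) auto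
  then show ?thesis by (simp add: f_def)
qed

text \<open>The first factor is brought into normal form by the relations of the Verma module, and then
  moved to the second factor.\<close>

lemma from_V_to_V:
  assumes "v \<in> upper T"
  shows "v - from_V (to_V v) \<in> lower Q"
proof (rule clin_span_into[where f = "\<lambda>v. v - from_V (to_V v)", OF clin_minus[OF clin_id clin_comp[OF clin_from_V clin_to_V]] 
     subspace_lower_Q _ assms[unfolded upper_T]])
  fix g assume "g \<in> gens"
  then obtain w a z where g: "g = (basis_vec w \<otimes> a) \<otimes> z" "w \<in> I" "z \<in> upper V" by (auto simp: gens_def)
  define n where "n = normal_form (mu w) a"
  have "(basis_vec w \<otimes> (a - n)) \<otimes> z \<in> lower Q"
    using lower_T_gen[OF g(2) normal_form_cong_verma g(3)] lower_T_Q by (auto simp: n_def)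
  moreover have "(basis_vec w \<otimes> n) \<otimes> z - (basis_vec w \<otimes> 1) \<otimes> antipode_act n z \<in> lower Q"
    using g by (intro free_part_cong) (auto simp: n_def normal_form_in)
  moreover have "g - from_V (to_V g) = (basis_vec w \<otimes> (a - n)) \<otimes> z
      + ((basis_vec w \<otimes> n) \<otimes> z - (basis_vec w \<otimes> 1) \<otimes> antipode_act n z)"
    by (simp add: g(1) to_V_tens from_V_tens n_def tens_diff_left tens_diff_right)
  ultimately show "g - from_V (to_V g) \<in> lower Q" using cvec.subspace_add[OF subspace_lower_Q] by simp
qed

lemma from_V_upper: "y \<in> X \<Longrightarrow> from_V y \<in> upper T"
  unfolding X_span
  by (erule clin_span_into[OF clin_from_V subspace_upper_T, rotated])
     (force simp: from_V_tens upper_T gens_def intro!: cvec.span_base)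

lemma from_V_lower: "y \<in> Y \<Longrightarrow> from_V y \<in> lower Q"
  unfolding Y_span
  by (erule clin_span_into[OF clin_from_V subspace_lower_Q, rotated])
     (use lower_T_Q lower_T_gen_V in \<open>auto simp: from_V_tens\<close>)

lemma lower_Q_upper: "lower Q \<subseteq> upper T"
proof -
  have "lower T \<subseteq> upper T"
  proof -
    have "lower FM \<subseteq> upper FM" unfolding lower_FM upper_FM by (intro cvec.span_mono) blast
    then show ?thesis unfolding tensor_mod_def using lower_upper
      by simp (intro cvec.span_mono; blast)
  qed
  moreover have "free_alg_act T u v \<in> upper T" if "u \<in> free_alg_n" "v \<in> upper T" for u v
    unfolding free_alg_act_def
  proof (intro cvec.subspace_sum cvec.subspace_scale subspace_upper_T)
    fix w assume "w \<in> Poly_Mapping.keys u"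
    then have "set (letters w) \<subseteq> n_minus" using that by (auto simp: free_alg_n_def)
    moreover have "set ws \<subseteq> n_minus \<Longrightarrow> foldr (act T) ws v \<in> upper T" for ws
      by (induction ws) (use that in \<open>auto intro: act_upper_T n_minus_lower_ops\<close>)
    ultimately show "foldr (act T) (letters w) v \<in> upper T" by blast
  qed
  ultimately show ?thesis unfolding lower_Q
    by (intro cvec.span_minimal subspace_upper_T)
       (auto intro!: cvec.subspace_diff cvec.subspace_scale subspace_upper_T)
qed

text \<open>Through this equivalence the stability of \<open>lower Q\<close> under \<open>h\<^sub>0\<close> and \<open>d\<close> follows from that of the
  copies of \<open>lower V\<close>.\<close>

lemma to_V_in_Y_iff: "v \<in> upper T \<Longrightarrow> to_V v \<in> Y \<longleftrightarrow> v \<in> lower Q"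
  using to_V_lower from_V_lower[of "to_V v"] from_V_to_V[of v] cvec.subspace_add[OF subspace_lower_Q]
  by (metis diff_add_cancel)

lemma to_V_cartan:
  assumes "b \<in> {Loop H 0, Deg}" "v \<in> upper T"
  shows "to_V (act T b v) = cartan_act b (to_V v)"
proof (rule clin_span_eq[OF clin_comp[OF clin_to_V clin_act_T] clin_comp[OF clin_cartan_act clin_to_V] _ assms(2)[unfolded upper_T]])
  fix g assume "g \<in> gens"
  then obtain w a z where g: "g = (basis_vec w \<otimes> a) \<otimes> z" "z \<in> upper V" by (auto simp: gens_def)
  then have "z \<in> A" using upper_A by blast
  from antipode_act_cartan[OF assms(1) normal_form_in this]
  show "to_V (act T b g) = cartan_act b (to_V g)"
    by (simp add: g(1) act_T clin_add[OF clin_to_V] to_V_tens normal_form_gen_mult cartan_act_tens flip: tens_add_right)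
qed

text \<open>The part of \<open>V\<close> that corresponds to weight \<open>0\<close> and degree \<open>s\<close> in the coinvariants of \<open>M(mu w) \<otimes> V\<close>.\<close>

definition graded_upper :: "int \<Rightarrow> 'w \<Rightarrow> 'j cvec set" where
  "graded_upper s w = {z \<in> upper V. scal (hw_val (mu w) (Loop H 0)) z + act V (Loop H 0) z \<in> lower V
       \<and> scal (hw_val (mu w) Deg - of_int s) z + act V Deg z \<in> lower V}"

lemma graded_upper: "cvec.subspace (graded_upper s w)" "lower V \<subseteq> graded_upper s w"
proof -
  have "graded_upper s w = upper V \<inter> ({z. scal (hw_val (mu w) (Loop H 0)) z + act V (Loop H 0) z \<in> lower V}
      \<inter> {z. scal (hw_val (mu w) Deg - of_int s) z + act V Deg z \<in> lower V})"
    by (auto simp: graded_upper_def)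
  moreover have "cvec.subspace {z. scal c z + act V b z \<in> lower V}" for c b
    by (intro clin_preimage clin_plus clin_scaled clin_id clin_act subspace_lower)
  ultimately show "cvec.subspace (graded_upper s w)"
    by (simp add: cvec.subspace_inter subspace_upper)
  show "lower V \<subseteq> graded_upper s w"
    unfolding graded_upper_def using lower_upper
    by (auto intro!: cvec.subspace_add cvec.subspace_scale subspace_lower act_lower simp: lower_ops_def)
qed

definition zero_weight :: "int \<Rightarrow> (('w \<times> aff free_word) \<times> 'j) cvec set" where
  "zero_weight s = {v \<in> upper Q. act Q (Loop H 0) v \<in> lower Q \<and> act Q Deg v - scal (of_int s) v \<in> lower Q}"

lemma coinvariant_quot_iso:
  "quot_iso to_V (zero_weight s) (lower Q)
     (dsum I (graded_upper s)) Y"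
proof -
  define S where "S = zero_weight s"
  have ops: "Loop H 0 \<in> lower_ops" "Deg \<in> lower_ops" by (auto simp: lower_ops_def)
  have X': "dsum I (graded_upper s) = {y \<in> X. cartan_act (Loop H 0) y \<in> Y \<and> cartan_act Deg y - scal (of_int s) y \<in> Y}"
    (is "_ = ?X'")
  proof -
    have sl: "slice w (cartan_act Deg y - scal (of_int s) y) = scal (hw_val (mu w) Deg - of_int s) (slice w y) + act V Deg (slice w y)" for w y
      by (simp add: clin_diff[OF clin_slice] clin_scal[OF clin_slice] slice_cartan_act cvec.scale_left_diff_distrib)
    show ?thesis
    proof (intro equalityI subsetI)
      fix y assume y: "y \<in> dsum I (graded_upper s)"
      have "slice w y \<in> graded_upper s w" if "w \<in> I" for w using dsum_in[OF y that] .
      then show "y \<in> ?X'"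
        using dsum_out[OF y]
        by (auto intro!: dsumI simp: graded_upper_def sl) (auto simp: graded_upper_def slice_cartan_act clin_0[OF clin_act])
    next
      fix y assume y: "y \<in> ?X'"
      show "y \<in> dsum I (graded_upper s)"
      proof (rule dsumI)
        fix w assume w: "w \<in> I"
        have "slice w y \<in> upper V" "slice w (cartan_act (Loop H 0) y) \<in> lower V"
           "slice w (cartan_act Deg y - scal (of_int s) y) \<in> lower V"
          using y dsum_in[OF _ w] by blast+
        then show "slice w y \<in> graded_upper s w" by (simp add: graded_upper_def sl slice_cartan_act)
      qed (use y in \<open>auto intro: dsum_out\<close>)
    qed
  qed
  have S_iff: "v \<in> S \<longleftrightarrow> to_V v \<in> dsum I (graded_upper s)" if v: "v \<in> upper T" for v
  proof -
    have d: "act T Deg v - scal (of_int s) v \<in> upper T" and h: "act T (Loop H 0) v \<in> upper T"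
      using v ops by (auto intro!: cvec.subspace_diff cvec.subspace_scale subspace_upper_T act_upper_T)
    show ?thesis
      unfolding X' S_def zero_weight_def using v to_V_upper[OF v] to_V_in_Y_iff[OF d] to_V_in_Y_iff[OF h]
      by (simp add: act_Q upper_Q to_V_cartan clin_diff[OF clin_to_V] clin_scal[OF clin_to_V])
  qed
  have "S = upper T \<inter> {v. to_V v \<in> dsum I (graded_upper s)}" using S_iff by (auto simp: S_def zero_weight_def upper_Q)
  moreover have "cvec.subspace (dsum I (graded_upper s))" by (intro subspace_dsum graded_upper)
  ultimately have sub: "cvec.subspace S"
    by (auto intro!: cvec.subspace_inter subspace_upper_T clin_preimage clin_to_V)
  have YX': "Y \<subseteq> dsum I (graded_upper s)" by (intro dsum_mono graded_upper)
  have "lower Q \<subseteq> S" using S_iff lower_Q_upper to_V_in_Y_iff YX' by blast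
  have SU: "v \<in> upper T" if "v \<in> S" for v using that by (simp add: S_def zero_weight_def upper_Q)
  have "quot_iso to_V S (lower Q) (dsum I (graded_upper s)) Y"
    unfolding quot_iso_def
  proof (intro conjI ballI)
    fix y assume y: "y \<in> dsum I (graded_upper s)"
    then have "y \<in> X" unfolding X' by blast
    then have "from_V y \<in> S" using S_iff[OF from_V_upper] y by (simp add: to_V_from_V)
    then show "\<exists>x\<in>S. y - to_V x \<in> Y"
      by (intro bexI[of _ "from_V y"]) (simp_all add: to_V_from_V cvec.subspace_0[OF subspace_Y])
  qed (use sub subspace_lower_Q \<open>lower Q \<subseteq> S\<close> YX' subspace_Y clin_to_V S_iff SU to_V_in_Y_iff
        \<open>cvec.subspace (dsum I (graded_upper s))\<close> in blast)+
  then show ?thesis by (simp add: S_def)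
qed

lemma qdim_coinvariants:
  assumes "finite I" "\<And>w. w \<in> I \<Longrightarrow> has_qdim (graded_upper s w) (lower V) (n w)"
  shows "qdim (zero_weight s) (lower Q) = (\<Sum>w\<in>I. n w)"
proof (rule qdim_eqI)
  have "has_qdim (dsum I (graded_upper s)) Y (\<Sum>w\<in>I. n w)"
    using assms by (intro has_qdim_dsum) (auto simp: graded_upper subspace_lower)
  then show "has_qdim (zero_weight s) (lower Q) (\<Sum>w\<in>I. n w)"
    using has_qdim_iso[OF coinvariant_quot_iso] by blast
qed (rule subspace_lower_Q)

end


section \<open>Finite-dimensional representations of sl2\<close>

text \<open>Boundedness of the weights takes the place of finite dimension: it makes \<open>e\<close> and \<open>f\<close> nilpotent on
  weight vectors.\<close>

locale sl2_rep =
  fixes e f h :: "'i cvec \<Rightarrow> 'i cvec" and A :: "'i cvec set" and N :: int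
  assumes clin_e: "clin e" and clin_f: "clin f" and clin_h: "clin h"
    and subspace_A: "cvec.subspace A"
    and e_A: "v \<in> A \<Longrightarrow> e v \<in> A" and f_A: "v \<in> A \<Longrightarrow> f v \<in> A"
    and h_e: "v \<in> A \<Longrightarrow> h (e v) = e (h v) + scal 2 (e v)"
    and h_f: "v \<in> A \<Longrightarrow> h (f v) = f (h v) - scal 2 (f v)"
    and e_f: "v \<in> A \<Longrightarrow> e (f v) = f (e v) + h v"
    and weight_bound: "v \<in> A \<Longrightarrow> h v = scal (of_int j) v \<Longrightarrow> \<bar>j\<bar> > N \<Longrightarrow> v = 0"
begin

text \<open>The Chevalley involution. It gives for free each statement with \<open>e\<close> and \<open>f\<close> exchanged.\<close>

lemma mirror: "sl2_rep f e (\<lambda>v. - h v) A N"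
proof
  fix v j assume v: "v \<in> A" and j: "- h v = scal (of_int j) v" "\<bar>j\<bar> > N"
  from j(1) have "h v = scal (of_int (- j)) v" by (metis cvec.scale_minus_left minus_minus of_int_minus)
  then show "v = 0" using weight_bound[OF v, of "- j"] j by simp
qed (auto simp: clin_e clin_f clin_h subspace_A e_A f_A h_e h_f e_f clin_uminus clin_neg algebra_simps)

definition wspace :: "int \<Rightarrow> 'i cvec set" where
  "wspace j = {v \<in> A. h v = scal (of_int j) v}"

lemma wspace_A: "v \<in> wspace j \<Longrightarrow> v \<in> A" and wspace_h: "v \<in> wspace j \<Longrightarrow> h v = scal (of_int j) v"
  by (simp_all add: wspace_def)

lemma subspace_wspace: "cvec.subspace (wspace j)"
proof -
  have "wspace j = A \<inter> {v. h v - scal (of_int j) v \<in> {0}}" by (auto simp: wspace_def)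
  then show ?thesis
    by (simp only: cvec.subspace_inter subspace_A clin_preimage[OF clin_minus[OF clin_h clin_scaled[OF clin_id]] cvec.subspace_single_0])
qed

lemma wspace_mirror: "sl2_rep.wspace (\<lambda>v. - h v) A j = wspace (- j)"
proof -
  have "(- h v = scal (of_int j) v) = (h v = scal (of_int (- j)) v)" for v
    by (metis cvec.scale_minus_left minus_minus of_int_minus)
  then show ?thesis by (simp add: sl2_rep.wspace_def[OF mirror] wspace_def)
qed

lemma e_wspace: "v \<in> wspace j \<Longrightarrow> e v \<in> wspace (j + 2)"
  by (simp add: wspace_def e_A h_e clin_scal[OF clin_e] cvec.scale_left_distrib)

lemma f_wspace: "v \<in> wspace j \<Longrightarrow> f v \<in> wspace (j - 2)"
  by (simp add: wspace_def f_A h_f clin_scal[OF clin_f] cvec.scale_left_diff_distrib)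

lemma e_pow_wspace: "v \<in> wspace j \<Longrightarrow> (e ^^ r) v \<in> wspace (j + 2 * int r)"
  by (induction r) (auto dest: e_wspace simp: algebra_simps)

lemma f_pow_wspace: "v \<in> wspace j \<Longrightarrow> (f ^^ r) v \<in> wspace (j - 2 * int r)"
  by (induction r) (auto dest: f_wspace simp: algebra_simps)

lemma clin_e_pow: "clin (e ^^ r)" and clin_f_pow: "clin (f ^^ r)"
  by (induction r) (auto simp: clin_def clin_add[OF clin_e] clin_add[OF clin_f] clin_scal[OF clin_e] clin_scal[OF clin_f])

lemma f_nilpotent: "v \<in> wspace j \<Longrightarrow> \<exists>r. (f ^^ r) v = 0"
proof -
  assume v: "v \<in> wspace j"
  define r where "r = nat (\<bar>j\<bar> + \<bar>N\<bar> + 1)"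
  have "(f ^^ r) v \<in> wspace (j - 2 * int r)" by (rule f_pow_wspace[OF v])
  moreover have "\<bar>j - 2 * int r\<bar> > N" by (simp add: r_def)
  ultimately have "(f ^^ r) v = 0" using weight_bound wspace_def by blast
  then show ?thesis ..
qed

lemma f_pow_e:
  assumes w: "w \<in> wspace j"
  shows "(f ^^ Suc r) (e w) = e ((f ^^ Suc r) w) - scal (of_int ((int r + 1) * (j - int r))) ((f ^^ r) w)"
proof (induction r)
  case 0
  show ?case using w e_f[of w] by (simp add: wspace_def algebra_simps)
next
  case (Suc r)
  define u where "u = (f ^^ Suc r) w"
  have u: "u \<in> wspace (j - 2 * int (Suc r))" unfolding u_def by (rule f_pow_wspace[OF w])
  have "(f ^^ Suc (Suc r)) (e w) = f (e u) - scal (of_int ((int r + 1) * (j - int r))) u"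
    using Suc unfolding u_def by (simp add: clin_diff[OF clin_f] clin_scal[OF clin_f])
  also have "f (e u) = e (f u) - scal (of_int (j - 2 * int (Suc r))) u"
    using u e_f[of u] by (simp add: wspace_def algebra_simps)
  also have "e (f u) - scal (of_int (j - 2 * int (Suc r))) u - scal (of_int ((int r + 1) * (j - int r))) u
    = e (f u) - scal (of_int ((int (Suc r) + 1) * (j - int (Suc r)))) u"
  proof -
    have eq: "(int (Suc r) + 1) * (j - int (Suc r)) = j - 2 * int (Suc r) + (int r + 1) * (j - int r)"
      by (simp add: algebra_simps)
    show ?thesis unfolding eq of_int_add cvec.scale_left_distrib by simp
  qed
  finally show ?case by (simp add: u_def)
qed

lemma e_pow_f:
  assumes w: "w \<in> wspace j"
  shows "(e ^^ Suc r) (f w) = f ((e ^^ Suc r) w) + scal (of_int ((int r + 1) * (j + int r))) ((e ^^ r) w)"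
proof -
  interpret m: sl2_rep f e "\<lambda>v. - h v" A N by (rule mirror)
  have "w \<in> m.wspace (- j)" using w by (simp add: wspace_mirror)
  from m.f_pow_e[OF this, of r] 
  have "(e ^^ Suc r) (f w) = f ((e ^^ Suc r) w) - scal (of_int (- ((int r + 1) * (j + int r)))) ((e ^^ r) w)"
    by (simp add: algebra_simps)
  then show ?thesis unfolding of_int_minus cvec.scale_minus_left by simp
qed

text \<open>Induction on the nilpotency index \<open>r\<close> of \<open>f\<close> on \<open>w\<close>. The vector \<open>f w\<close> has weight \<open>-(n + 2)\<close>, is killed by
  \<open>e\<^bsup>n+2\<^esup>\<close>, and has a smaller index, so \<open>f w = 0\<close>. For a lowest weight vector \<open>w\<close> one has
  \<open>f e\<^bsup>k+1\<^esup> w = (k + 1)(n - k) e\<^sup>k w\<close>, and one descends from \<open>e\<^sup>n w = 0\<close> to \<open>w = 0\<close>.\<close>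

lemma e_pow_inj:
  assumes "w \<in> wspace (- int n)" "(e ^^ n) w = 0"
  shows "w = 0"
proof -
  have "w = 0" if "w \<in> wspace (- int n)" "(e ^^ n) w = 0" "(f ^^ r) w = 0" for r
    using that
  proof (induction r arbitrary: n w)
    case (Suc r)
    have "(e ^^ Suc (Suc n)) (f w) = 0"
      unfolding e_pow_f[OF Suc.prems(1)] using Suc.prems(2)
      by (simp add: clin_0[OF clin_e] clin_0[OF clin_f])
    moreover have "f w \<in> wspace (- int (Suc (Suc n)))" using f_wspace[OF Suc.prems(1)] by (simp add: algebra_simps)
    moreover have "(f ^^ r) (f w) = 0" using Suc.prems(3) by (simp add: funpow_swap1)
    ultimately have fw: "f w = 0" using Suc.IH by blast
    have "w = 0" if "(e ^^ k) w = 0" "k \<le> n" for k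
      using that
    proof (induction k)
      case (Suc k)
      have "scal (of_int ((int k + 1) * (- int n + int k))) ((e ^^ k) w) = 0"
        using e_pow_f[OF \<open>w \<in> wspace (- int n)\<close>, of k] Suc.prems
        by (simp add: fw clin_0[OF clin_e] clin_0[OF clin_f] clin_0[OF clin_e_pow])
      moreover have "(int k + 1) * (- int n + int k) \<noteq> 0" using Suc.prems by simp
      ultimately have "(e ^^ k) w = 0" using cvec.scale_eq_0_iff of_int_eq_0_iff by blast
      then show ?case using Suc by simp
    qed simp
    then show ?case using Suc.prems by blast
  qed simp
  then show ?thesis using assms f_nilpotent by blast
qed

lemma f_pow_inj:
  assumes "w \<in> wspace (int n)" "(f ^^ n) w = 0"
  shows "w = 0"
  using sl2_rep.e_pow_inj[OF mirror, of w n] assms by (simp add: wspace_mirror)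

lemma lowest_weight_f:
  assumes "v \<in> wspace (- int l)" "f v = 0"
  shows "f ((e ^^ Suc r) v) = scal (of_int ((int r + 1) * (int l - int r))) ((e ^^ r) v)"
proof -
  have "f ((e ^^ Suc r) v) = - scal (of_int ((int r + 1) * (- int l + int r))) ((e ^^ r) v)"
    using e_pow_f[OF assms(1), of r] assms(2) by (simp add: clin_0[OF clin_e] clin_0[OF clin_e_pow] eq_neg_iff_add_eq_0)
  then show ?thesis by (simp add: algebra_simps flip: cvec.scale_minus_left)
qed

text \<open>The vector \<open>e\<^bsup>l+1\<^esup> v\<close> is killed by \<open>f\<close> and has the positive weight \<open>l + 2\<close>, on which a power of
  \<open>f\<close> is injective.\<close>

lemma lowest_weight_e:
  assumes "v \<in> wspace (- int l)" "f v = 0"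
  shows "(e ^^ Suc l) v = 0"
proof -
  define u where "u = (e ^^ Suc l) v"
  have "u \<in> wspace (- int l + 2 * int (Suc l))" unfolding u_def by (rule e_pow_wspace[OF assms(1)])
  then have u: "u \<in> wspace (int (Suc (Suc l)))" by (simp add: algebra_simps)
  have "f u = 0" unfolding u_def lowest_weight_f[OF assms] by simp
  then have "(f ^^ Suc (Suc l)) u = 0" by (simp only: funpow_Suc_right comp_def) (simp add: clin_0[OF clin_f] clin_0[OF clin_f_pow])
  from f_pow_inj[OF u this] show ?thesis by (simp add: u_def)
qed

definition stable :: "'i cvec set \<Rightarrow> bool" where
  "stable S \<longleftrightarrow> cvec.subspace S \<and> S \<subseteq> A \<and> (\<forall>v\<in>S. e v \<in> S \<and> f v \<in> S \<and> h v \<in> S)"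

lemma stable_e_pow: "stable S \<Longrightarrow> v \<in> S \<Longrightarrow> (e ^^ r) v \<in> S"
  by (induction r) (auto simp: stable_def)

lemma stable_f_pow: "stable S \<Longrightarrow> v \<in> S \<Longrightarrow> (f ^^ r) v \<in> S"
  by (induction r) (auto simp: stable_def)

lemma subspace_weight: "stable S \<Longrightarrow> cvec.subspace (S \<inter> wspace j)"
  by (simp add: stable_def cvec.subspace_inter subspace_wspace)

text \<open>Induction on the nilpotency index \<open>r\<close> of \<open>f\<close> on \<open>w\<close>. If \<open>f\<^bsup>r+1\<^esup> w = 0\<close>, then \<open>f\<^bsup>r+1\<^esup> e w = c f\<^sup>r w\<close> with
  \<open>c = (r + 1)(r - j) \<noteq> 0\<close>, so subtracting \<open>f (c\<^bsup>-1\<^esup> e w)\<close> from \<open>w\<close> lowers the index.\<close>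

lemma f_surj:
  assumes S: "stable S" and w: "w \<in> S \<inter> wspace j" and j: "j < 0"
  shows "\<exists>u \<in> S \<inter> wspace (j + 2). f u = w"
proof -
  have "\<exists>u \<in> S \<inter> wspace (j + 2). f u = w" if "w \<in> S \<inter> wspace j" "(f ^^ r) w = 0" for r
    using that
  proof (induction r arbitrary: w)
    case 0
    then show ?case using cvec.subspace_0[OF subspace_weight[OF S]] by (intro bexI[of _ 0]) (auto simp: clin_0[OF clin_f])
  next
    case (Suc r)
    define c :: complex where "c = - of_int ((int r + 1) * (j - int r))"
    have c: "c \<noteq> 0" using j unfolding c_def neg_equal_0_iff_equal of_int_eq_0_iff by simp
    define u where "u = scal (inverse c) (e w)"
    have u: "u \<in> S \<inter> wspace (j + 2)"
      using Suc.prems S e_wspace unfolding u_def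
      by (intro cvec.subspace_scale subspace_weight) (auto simp: stable_def)
    have "(f ^^ Suc r) (e w) = scal c ((f ^^ r) w)"
      using f_pow_e[of w j r] Suc.prems by (simp add: c_def clin_0[OF clin_e] del: funpow.simps)
    then have "(f ^^ r) (w - f u) = 0"
      using c by (simp add: u_def clin_diff[OF clin_f_pow] clin_scal[OF clin_f_pow] clin_scal[OF clin_f] funpow_swap1)
    moreover have "f u \<in> S \<inter> wspace j" using u f_wspace[of u "j + 2"] S by (auto simp: stable_def)
    then have "w - f u \<in> S \<inter> wspace j"
      using Suc.prems by (intro cvec.subspace_diff subspace_weight S) auto
    ultimately obtain u' where "u' \<in> S \<inter> wspace (j + 2)" "f u' = w - f u" using Suc.IH by blast
    then show ?case using u cvec.subspace_add[OF subspace_weight[OF S]]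
      by (intro bexI[of _ "u' + u"]) (auto simp: clin_add[OF clin_f])
  qed
  then show ?thesis using w f_nilpotent by blast
qed

definition lowest :: "'i cvec set \<Rightarrow> nat \<Rightarrow> 'i cvec set" where
  "lowest S l = {v \<in> S \<inter> wspace (- int l). f v = 0}"

lemma subspace_lowest: "stable S \<Longrightarrow> cvec.subspace (lowest S l)"
proof -
  assume "stable S"
  moreover have "lowest S l = (S \<inter> wspace (- int l)) \<inter> {v. f v \<in> {0}}" by (auto simp: lowest_def)
  ultimately show ?thesis by (simp only: cvec.subspace_inter subspace_weight clin_preimage[OF clin_f cvec.subspace_single_0])
qed

end

lemma qdim_inj_le:
  assumes "clin L" "cvec.subspace S" "cvec.subspace X" "\<And>v. v \<in> S \<Longrightarrow> L v \<in> X" "\<And>v. v \<in> S \<Longrightarrow> L v = 0 \<Longrightarrow> v = 0"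
    and fin: "finite G" "S \<subseteq> cvec.span G" "X \<subseteq> cvec.span G"
  shows "qdim S {0} \<le> qdim X {0}"
proof -
  have im: "cvec.subspace (L ` S)" "L ` S \<subseteq> X" using assms clin_image by auto
  have "quot_iso L S {0} (L ` S) {0}"
    unfolding quot_iso_def using assms(1,2,5) im
    by (auto simp: cvec.subspace_0 clin_0)
  moreover have "has_qdim S {0} (qdim S {0})"
    by (rule has_qdim_finite[OF _ assms(2) _ fin(2,1)]) (auto simp: cvec.subspace_0 assms(2))
  ultimately have "has_qdim (L ` S) {0} (qdim S {0})" using has_qdim_iso by blast
  moreover have "has_qdim X (L ` S) (qdim X (L ` S))"
    by (rule has_qdim_finite[OF im(1) assms(3) im(2) fin(3,1)])
  ultimately have "has_qdim X {0} (qdim X (L ` S) + qdim S {0})"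
    using has_qdim_trans[OF _ _ im(1)] by auto
  then have "qdim X {0} = qdim X (L ` S) + qdim S {0}" by (rule qdim_eqI) simp
  then show ?thesis by simp
qed

lemma qdim_tower:
  assumes "cvec.subspace S" "cvec.subspace N" "N \<subseteq> S" "finite G" "S \<subseteq> cvec.span G"
  shows "qdim S {0} = qdim S N + qdim N {0}"
proof -
  have "has_qdim S N (qdim S N)" using assms by (intro has_qdim_finite)
  moreover have "has_qdim N {0} (qdim N {0})"
    using assms by (intro has_qdim_finite[of _ _ G]) (auto simp: cvec.subspace_0)
  ultimately have "has_qdim S {0} (qdim S N + qdim N {0})" using assms(2) by (rule has_qdim_trans) simp
  then show ?thesis by (rule qdim_eqI) simp
qed

text \<open>The projections \<open>p k\<close> to the weight spaces are part of the data, since the subspaces of interest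
  must be stable under them.\<close>

locale sl2_rep_fin = sl2_rep +
  fixes G :: "'a cvec set" and p :: "int \<Rightarrow> 'a cvec \<Rightarrow> 'a cvec"
  assumes fin_G: "finite G" and A_G: "A \<subseteq> cvec.span G"
    and clin_p: "clin (p k)"
    and p_A: "v \<in> A \<Longrightarrow> p k v \<in> A"
    and p_h: "v \<in> A \<Longrightarrow> p k (h v) = scal (of_int k) (p k v)"
    and h_p: "v \<in> A \<Longrightarrow> h (p k v) = scal (of_int k) (p k v)"
    and p_sum: "v \<in> A \<Longrightarrow> v = (\<Sum>k\<in>{- N..N}. p k v)"
begin

lemma p_zero: "v \<in> A \<Longrightarrow> k \<notin> {- N..N} \<Longrightarrow> p k v = 0"
  using weight_bound[OF p_A h_p, of v k] by (auto simp: abs_if split: if_splits)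

definition graded :: "'a cvec set \<Rightarrow> bool" where
  "graded S \<longleftrightarrow> stable S \<and> (\<forall>v\<in>S. \<forall>k. p k v \<in> S)"

lemma gradedD: "graded S \<Longrightarrow> stable S" "graded S \<Longrightarrow> cvec.subspace S" "graded S \<Longrightarrow> v \<in> S \<Longrightarrow> v \<in> A"
  by (auto simp: graded_def stable_def)

lemma span_G: "stable S \<Longrightarrow> S \<subseteq> cvec.span G"
  using A_G by (auto simp: stable_def)

text \<open>The maps \<open>e\<^sup>n\<close> and \<open>f\<^sup>n\<close> between the weight spaces of weights \<open>-n\<close> and \<open>n\<close> are both injective.\<close>

lemma weight_symmetric:
  assumes S: "stable S"
  shows "qdim (S \<inter> wspace (- j)) {0} = qdim (S \<inter> wspace j) {0}"
proof -
  have *: "qdim (S \<inter> wspace (- int n)) {0} = qdim (S \<inter> wspace (int n)) {0}" for n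
  proof (rule antisym)
    have e: "(e ^^ n) v \<in> wspace (int n)" if "v \<in> wspace (- int n)" for v
      using e_pow_wspace[OF that, of n] by simp
    have f: "(f ^^ n) v \<in> wspace (- int n)" if "v \<in> wspace (int n)" for v
      using f_pow_wspace[OF that, of n] by simp
    show "qdim (S \<inter> wspace (- int n)) {0} \<le> qdim (S \<inter> wspace (int n)) {0}"
      using S span_G[OF S] e by (intro qdim_inj_le[OF clin_e_pow[of n] _ _ _ _ fin_G]) (auto intro: subspace_weight stable_e_pow e_pow_inj)
    show "qdim (S \<inter> wspace (int n)) {0} \<le> qdim (S \<inter> wspace (- int n)) {0}"
      using S span_G[OF S] f by (intro qdim_inj_le[OF clin_f_pow[of n] _ _ _ _ fin_G]) (auto intro: subspace_weight stable_f_pow f_pow_inj)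
  qed
  show ?thesis
  proof (cases "j \<ge> 0")
    case True then show ?thesis using *[of "nat j"] by simp
  next
    case False then show ?thesis using *[of "nat (- j)"] by simp
  qed
qed

text \<open>The map \<open>f\<close> from weight \<open>-l\<close> to weight \<open>-l - 2\<close> is onto, and its kernel consists of the lowest weight
  vectors.\<close>

lemma qdim_lowest:
  assumes S: "stable S"
  shows "qdim (S \<inter> wspace (- int l)) {0} = qdim (lowest S l) {0} + qdim (S \<inter> wspace (- int l - 2)) {0}"
proof -
  let ?S = "S \<inter> wspace (- int l)" and ?X = "S \<inter> wspace (- int l - 2)"
  have "quot_iso f ?S (lowest S l) ?X {0}"
    unfolding quot_iso_def
  proof (intro conjI ballI)
    fix y assume "y \<in> ?X"
    then obtain u where "u \<in> ?S" "f u = y" using f_surj[OF S, of y "- int l - 2"] by auto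
    then show "\<exists>x\<in>?S. y - f x \<in> {0}" by auto
  next
    fix x assume x: "x \<in> ?S"
    then show "f x \<in> ?X" using f_wspace[of x "- int l"] S by (auto simp: stable_def)
    show "(f x \<in> {0}) = (x \<in> lowest S l)" using x by (auto simp: lowest_def)
  next
    show "lowest S l \<subseteq> ?S" by (auto simp: lowest_def)
    show "{0} \<subseteq> ?X" using cvec.subspace_0[OF subspace_weight[OF S]] by blast
  qed (use S in \<open>simp_all add: clin_f subspace_weight subspace_lowest\<close>)
  moreover have "has_qdim ?X {0} (qdim ?X {0})"
    using S span_G[OF S] by (intro has_qdim_finite[OF _ _ _ _ fin_G])
      (use cvec.subspace_0[OF subspace_weight[OF S], of "- int l - 2"] in \<open>auto simp: subspace_weight\<close>)
  ultimately have "has_qdim ?S (lowest S l) (qdim ?X {0})" using has_qdim_iso by blast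
  then have "qdim ?S (lowest S l) = qdim ?X {0}" by (rule qdim_eqI) (rule subspace_lowest[OF S])
  moreover have "qdim ?S {0} = qdim ?S (lowest S l) + qdim (lowest S l) {0}"
    using span_G[OF S] by (intro qdim_tower[OF subspace_weight[OF S] subspace_lowest[OF S] _ fin_G])
      (auto simp: lowest_def)
  ultimately show ?thesis by simp
qed

text \<open>A weight vector of a graded quotient is represented by a weight vector: the component of
  weight \<open>k \<noteq> j\<close> of \<open>h v - j v\<close> is \<open>(k - j) p k v\<close>.\<close>

lemma weight_lift:
  assumes U: "graded U" and U': "graded U'" "U' \<subseteq> U" and v: "v \<in> U" and hv: "h v - scal (of_int j) v \<in> U'"
  shows "p j v \<in> U \<inter> wspace j" "v - p j v \<in> U'"
proof -
  have vA: "v \<in> A" using gradedD(3)[OF U v] .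
  have hA: "h v \<in> A" using U v unfolding graded_def stable_def by blast
  show "p j v \<in> U \<inter> wspace j" using U v vA by (auto simp: graded_def wspace_def p_A h_p)
  have comp: "p k v \<in> U'" if "k \<noteq> j" for k
  proof -
    have "p k (h v - scal (of_int j) v) \<in> U'" using U' hv by (simp add: graded_def)
    moreover have "p k (h v - scal (of_int j) v) = scal (of_int k - of_int j) (p k v)"
      by (simp add: clin_diff[OF clin_p] clin_scal[OF clin_p] p_h[OF vA] cvec.scale_left_diff_distrib)
    ultimately have "scal (inverse (of_int k - of_int j)) (scal (of_int k - of_int j) (p k v)) \<in> U'"
      using cvec.subspace_scale[OF gradedD(2)[OF U'(1)]] by metis
    moreover have "inverse (of_int k - of_int j) * (of_int k - of_int j) = (1 :: complex)" using that by simp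
    ultimately show ?thesis unfolding cvec.scale_scale by simp
  qed
  have "v - p j v = (\<Sum>k\<in>{- N..N} - {j}. p k v)"
  proof (cases "j \<in> {- N..N}")
    case True
    have "v = (\<Sum>k\<in>{- N..N}. p k v)" by (rule p_sum[OF vA])
    also have "\<dots> = p j v + (\<Sum>k\<in>{- N..N} - {j}. p k v)" using True by (intro sum.remove) auto
    finally show ?thesis by (metis add_diff_cancel_left')
  next
    case False
    then show ?thesis using p_sum[OF vA] p_zero[OF vA] by simp
  qed
  also have "\<dots> \<in> U'" using comp by (intro cvec.subspace_sum gradedD(2)[OF U'(1)]) auto
  finally show "v - p j v \<in> U'" .
qed

text \<open>The multiplicity of the weight \<open>j\<close> in \<open>U / U'\<close>.\<close>

definition wdim :: "'a cvec set \<Rightarrow> 'a cvec set \<Rightarrow> int \<Rightarrow> nat" where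
  "wdim U U' j = qdim (U \<inter> wspace j) (U' \<inter> wspace j)"

lemma wdim_tower:
  assumes "graded U" "graded U'" "U' \<subseteq> U"
  shows "qdim (U \<inter> wspace j) {0} = wdim U U' j + qdim (U' \<inter> wspace j) {0}"
  unfolding wdim_def
  using assms span_G[OF gradedD(1)[OF assms(1)]]
  by (intro qdim_tower[OF _ _ _ fin_G]) (auto simp: subspace_weight gradedD)

lemma wdim_symmetric:
  assumes "graded U" "graded U'" "U' \<subseteq> U"
  shows "wdim U U' (- j) = wdim U U' j"
  using wdim_tower[OF assms, of j] wdim_tower[OF assms, of "- j"] assms
  by (simp add: weight_symmetric gradedD)

lemma wdim_zero:
  assumes "graded U" "graded U'" "\<bar>j\<bar> > N"
  shows "wdim U U' j = 0"
proof -
  have "S \<inter> wspace j = {0}" if "graded S" for S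
    using weight_bound assms(3) cvec.subspace_0[OF subspace_weight[OF gradedD(1)[OF that]], of j]
    by (auto simp: wspace_def)
  then show ?thesis unfolding wdim_def using assms by (simp add: qdim_eqI[OF has_qdim_0])
qed

lemma has_qdim_weight:
  assumes "graded U" "graded U'" "U' \<subseteq> U"
  shows "has_qdim {v \<in> U. h v - scal (of_int j) v \<in> U'} U' (wdim U U' j)"
proof -
  let ?X = "{v \<in> U. h v - scal (of_int j) v \<in> U'}"
  have X: "cvec.subspace ?X"
  proof -
    have "?X = U \<inter> {v. h v - scal (of_int j) v \<in> U'}" by blast
    then show ?thesis using assms
      by (simp only: cvec.subspace_inter gradedD clin_preimage[OF clin_minus[OF clin_h clin_scaled[OF clin_id]]])
  qed
  have U'X: "U' \<subseteq> ?X"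
    using assms(2,3) by (auto simp: graded_def stable_def intro!: cvec.subspace_diff cvec.subspace_scale)
  have "quot_iso (\<lambda>v. v) (U \<inter> wspace j) (U' \<inter> wspace j) ?X U'"
    unfolding quot_iso_def
  proof (intro conjI ballI)
    fix x assume x: "x \<in> U \<inter> wspace j"
    then show "x \<in> ?X" using cvec.subspace_0[OF gradedD(2)[OF assms(2)]] by (auto simp: wspace_def)
    show "(x \<in> U') = (x \<in> U' \<inter> wspace j)" using x by blast
  next
    fix y assume "y \<in> ?X"
    then show "\<exists>x\<in>U \<inter> wspace j. y - x \<in> U'" using weight_lift[OF assms, of y j] by auto
  qed (use X U'X assms in \<open>auto simp: subspace_weight gradedD clin_id\<close>)
  moreover have "has_qdim (U \<inter> wspace j) (U' \<inter> wspace j) (wdim U U' j)"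
    unfolding wdim_def using assms span_G[OF gradedD(1)[OF assms(1)]]
    by (intro has_qdim_finite[OF _ _ _ _ fin_G]) (auto simp: subspace_weight gradedD)
  ultimately show ?thesis using has_qdim_iso by blast
qed

text \<open>The homomorphism from \<open>\<pi>\<^sub>l\<close> that sends the lowest weight vector to \<open>v\<close>, in the encoding of \<open>dim_hom\<close>.\<close>

definition hom_vec :: "nat \<Rightarrow> 'a cvec \<Rightarrow> (nat \<times> 'a) cvec" where
  "hom_vec l v = (\<Sum>j\<le>l. basis_vec j \<otimes> (e ^^ j) v)"

lemma slice_hom_vec: "slice j (hom_vec l v) = (if j \<le> l then (e ^^ j) v else 0)"
  by (simp add: hom_vec_def clin_sum[OF clin_slice])

lemma map_apply_slice: "map_apply phi = lin_ext (\<lambda>j. slice j phi)"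
  by (simp add: map_apply_def slice_def)

lemma map_apply_basis: "map_apply phi (basis_vec j) = slice j phi"
  by (simp add: map_apply_slice)

lemma clin_map_apply: "clin (map_apply phi)"
  by (simp add: map_apply_slice clin_lin_ext)

text \<open>A homomorphism from \<open>\<pi>\<^sub>l\<close> to \<open>U / U'\<close> is the class of \<open>hom_vec l x\<close> for a vector \<open>x\<close> of \<open>U\<close> that is exactly
  a lowest weight vector. For this the image of \<open>v\<^sub>0\<close> is first replaced by its component \<open>u\<close> of
  weight \<open>-l\<close>; then \<open>f u\<close> is in \<open>U'\<close>, hence \<open>f u = f u'\<close> with \<open>u'\<close> in \<open>U'\<close> by the surjectivity of \<open>f\<close>, and
  \<open>x = u - u'\<close>. The dimension is the difference of the numbers of lowest weight vectors in \<open>U\<close> and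
  \<open>U'\<close>.\<close>

lemma dim_hom_eq:
  assumes U: "graded U" and U': "graded U'" "U' \<subseteq> U"
    and action: "action E = e" "action F = f" "action H = h"
  shows "int (dim_hom l action U U') = int (wdim U U' (int l)) - int (wdim U U' (int l + 2))"
proof -
  define Hom where "Hom = {phi \<in> dsum {..l} (\<lambda>_. U). \<forall>x. \<forall>j\<le>l.
     map_apply phi (irr_act l x j) - action x (map_apply phi (basis_vec j)) \<in> U'}"
  define Z where "Z = dsum {..l} (\<lambda>_::nat. U')"
  have sF: "cvec.subspace U" "cvec.subspace U'" and st: "stable U" "stable U'" using U U' by (auto simp: gradedD)
  have clin_action: "clin (action x)" for x using action clin_e clin_f clin_h by (cases x) auto
  have action_F': "v \<in> U' \<Longrightarrow> action x v \<in> U'" for x v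
    using st action by (cases x) (auto simp: stable_def)
  have dsF: "cvec.subspace (dsum {..l} (\<lambda>_::nat. U))" and dsF': "cvec.subspace Z"
    unfolding Z_def using sF by (auto intro: subspace_dsum)
  have clin_map: "clin (\<lambda>phi. map_apply phi u)" for u :: "nat cvec"
    unfolding map_apply_slice by (intro clin_lin_ext_fun clin_slice)
  have Hom_sub: "cvec.subspace Hom"
  proof -
    have "cvec.subspace {phi. map_apply phi (irr_act l x j) - action x (map_apply phi (basis_vec j)) \<in> U'}" for x j
      by (intro clin_preimage clin_minus clin_comp[OF clin_action] clin_map sF)
    then have "cvec.subspace (dsum {..l} (\<lambda>_. U) \<inter> \<Inter>{{phi. map_apply phi (irr_act l x j) -
        action x (map_apply phi (basis_vec j)) \<in> U'} |x j. j \<le> l})"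
      by (intro cvec.subspace_inter dsF cvec.subspace_Inter) blast
    moreover have "Hom = dsum {..l} (\<lambda>_. U) \<inter> \<Inter>{{phi. map_apply phi (irr_act l x j) -
        action x (map_apply phi (basis_vec j)) \<in> U'} |x j. j \<le> l}"
      unfolding Hom_def by blast
    ultimately show ?thesis by simp
  qed
  have Z_Hom: "Z \<subseteq> Hom"
  proof
    fix phi assume phi: "phi \<in> Z"
    then have sl: "slice j phi \<in> U'" for j
      unfolding Z_def using dsum_in[of phi "{..l}" "\<lambda>_. U'" j] dsum_out[of phi "{..l}" "\<lambda>_. U'" j] cvec.subspace_0[OF sF(2)]
      by (cases "j \<le> l") auto
    have "map_apply phi u \<in> U'" for u unfolding map_apply_slice by (intro lin_ext_in sF sl)
    then have "\<forall>x. \<forall>j\<le>l. map_apply phi (irr_act l x j) - action x (map_apply phi (basis_vec j)) \<in> U'"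
      using action_F' cvec.subspace_diff[OF sF(2)] by blast
    moreover have "phi \<in> dsum {..l} (\<lambda>_. U)" using phi U'(2) dsum_mono[of "{..l}" "\<lambda>_. U'" "\<lambda>_. U"] by (auto simp: Z_def)
    ultimately show "phi \<in> Hom" by (simp add: Hom_def)
  qed
  have clin_hom: "clin (hom_vec l)"
    unfolding hom_vec_def by (intro clin_setsum clin_comp[OF clin_tens_right clin_e_pow])
  have "quot_iso (hom_vec l) (lowest U l) (lowest U' l) Hom Z"
    unfolding quot_iso_def
  proof (intro conjI ballI)
    fix v assume v: "v \<in> lowest U l"
    then have vF: "v \<in> U" and vW: "v \<in> wspace (- int l)" and fv: "f v = 0" by (auto simp: lowest_def)
    have "map_apply (hom_vec l v) (irr_act l x j) - action x (map_apply (hom_vec l v) (basis_vec j)) = 0" if "j \<le> l" for x j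
    proof (cases x)
      case E
      show ?thesis
      proof (cases "j < l")
        case False
        then have "j = l" using that by simp
        then show ?thesis using E lowest_weight_e[OF vW fv] by (simp add: map_apply_slice slice_hom_vec action)
      qed (use E in \<open>simp add: map_apply_slice slice_hom_vec action\<close>)
    next
      case H
      then show ?thesis using that wspace_h[OF e_pow_wspace[OF vW, of j]]
        by (simp add: map_apply_slice lin_ext_scal lin_ext_diff slice_hom_vec action cvec.scale_left_diff_distrib
            cvec.scale_left_distrib algebra_simps)
    next
      case F
      show ?thesis
      proof (cases j)
        case 0
        show ?thesis unfolding map_apply_basis slice_hom_vec F 0
          by (simp add: fv action clin_0[OF clin_map_apply])
      next
        case (Suc r)
        then show ?thesis using F that lowest_weight_f[OF vW fv, of r]
          by (simp add: map_apply_slice lin_ext_scal lin_ext_add lin_ext_diff slice_hom_vec action algebra_simps)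
      qed
    qed
    moreover have "hom_vec l v \<in> dsum {..l} (\<lambda>_. U)"
      by (intro dsumI) (auto simp: slice_hom_vec stable_e_pow[OF st(1) vF])
    ultimately show "hom_vec l v \<in> Hom" using cvec.subspace_0[OF sF(2)] by (simp add: Hom_def)
    show "(hom_vec l v \<in> Z) = (v \<in> lowest U' l)"
    proof
      assume "hom_vec l v \<in> Z"
      from dsum_in[OF this[unfolded Z_def], of 0] have "v \<in> U'" by (simp add: slice_hom_vec)
      then show "v \<in> lowest U' l" using v by (simp add: lowest_def)
    next
      assume "v \<in> lowest U' l"
      then have "v \<in> U'" by (simp add: lowest_def)
      then show "hom_vec l v \<in> Z" unfolding Z_def
        by (intro dsumI) (auto simp: slice_hom_vec stable_e_pow[OF st(2)])
    qed
  next
    fix phi assume phi: "phi \<in> Hom"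
    define v where "v = slice 0 phi"
    have eq: "map_apply phi (irr_act l x j) - action x (slice j phi) \<in> U'" if "j \<le> l" for x j
    proof -
      have "map_apply phi (irr_act l x j) - action x (map_apply phi (basis_vec j)) \<in> U'"
        using phi that by (simp add: Hom_def)
      then show ?thesis by (simp add: map_apply_slice)
    qed
    have "phi \<in> dsum {..l} (\<lambda>_. U)" using phi by (simp add: Hom_def)
    then have vF: "v \<in> U" unfolding v_def using dsum_in[of phi "{..l}" "\<lambda>_. U" 0] by simp
    have "map_apply phi (irr_act l H 0) = scal (- of_nat l) v"
      unfolding irr_act.simps clin_scal[OF clin_map_apply] map_apply_basis v_def by simp
    then have "- (scal (- of_nat l) v - h v) \<in> U'"
      using eq[of 0 H] by (intro cvec.subspace_neg sF) (simp only: action v_def le0 simp_thms)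
    then have hv: "h v - scal (of_int (- int l)) v \<in> U'" by simp
    have "map_apply phi (irr_act l F 0) = 0" by (simp add: clin_0[OF clin_map_apply])
    then have "- f v \<in> U'" using eq[of 0 F] by (simp add: action v_def)
    then have fv: "f v \<in> U'" using cvec.subspace_neg[OF sF(2)] by fastforce
    define u where "u = p (- int l) v"
    have u: "u \<in> U \<inter> wspace (- int l)" and vu: "v - u \<in> U'"
      using weight_lift[OF U U' vF hv] by (auto simp: u_def)
    have "f v - f (v - u) \<in> U'" using fv vu st by (intro cvec.subspace_diff sF) (auto simp: stable_def)
    then have "f u \<in> U'" by (simp add: clin_diff[OF clin_f])
    then have "f u \<in> U' \<inter> wspace (- int l - 2)" using f_wspace u by blast
    from f_surj[OF st(2) this] obtain u' where u': "u' \<in> U' \<inter> wspace (- int l)" "f u' = f u" by auto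
    define x where "x = u - u'"
    have x: "x \<in> lowest U l"
      using u u' U'(2) cvec.subspace_diff[OF subspace_weight[OF st(1)], of u "- int l" u']
      by (auto simp: lowest_def x_def clin_diff[OF clin_f])
    have "(v - u) + u' \<in> U'" using vu u' by (intro cvec.subspace_add sF) auto
    then have vx: "v - x \<in> U'" by (simp add: x_def algebra_simps)
    have "slice j phi - (e ^^ j) x \<in> U'" if "j \<le> l" for j
      using that
    proof (induction j)
      case 0
      then show ?case using vx by (simp add: v_def)
    next
      case (Suc j)
      have "slice (Suc j) phi - e (slice j phi) \<in> U'"
        using eq[of j E] Suc.prems by (simp add: action map_apply_slice)
      moreover have "e (slice j phi - (e ^^ j) x) \<in> U'" using Suc st by (auto simp: stable_def)
      ultimately have "(slice (Suc j) phi - e (slice j phi)) + e (slice j phi - (e ^^ j) x) \<in> U'"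
        by (intro cvec.subspace_add sF)
      then show ?case by (simp add: clin_diff[OF clin_e])
    qed
    then have "phi - hom_vec l x \<in> Z" unfolding Z_def
      using \<open>phi \<in> dsum {..l} (\<lambda>_. U)\<close>
      by (intro dsumI) (auto simp: clin_diff[OF clin_slice] slice_hom_vec dsum_out)
    then show "\<exists>x\<in>lowest U l. phi - hom_vec l x \<in> Z" using x by blast
  next
    show "lowest U' l \<subseteq> lowest U l" using U'(2) by (auto simp: lowest_def)
  qed (use st clin_hom Hom_sub Z_Hom dsF' in \<open>simp_all add: subspace_lowest\<close>)
  note iso = this
  have low: "lowest U' l \<subseteq> lowest U l" "lowest U l \<subseteq> cvec.span G"
    using U'(2) span_G[OF st(1)] by (auto simp: lowest_def)
  have "has_qdim (lowest U l) (lowest U' l) (qdim (lowest U l) (lowest U' l))"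
    using low st by (intro has_qdim_finite[OF _ _ _ _ fin_G] subspace_lowest)
  then have "has_qdim Hom Z (qdim (lowest U l) (lowest U' l))" using has_qdim_iso[OF iso] by blast
  from qdim_eqI[OF this dsF'] have 1: "qdim Hom Z = qdim (lowest U l) (lowest U' l)" .
  have "dim_hom l action U U' = qdim Hom Z"
    using span_dsum[of "{..l}" "\<lambda>_. U"] span_dsum[of "{..l}" "\<lambda>_. U'"] sF
    by (simp add: dim_hom_def Hom_def Z_def)
  moreover have "qdim (lowest U l) {0} = qdim (lowest U l) (lowest U' l) + qdim (lowest U' l) {0}"
    using low st by (intro qdim_tower[OF _ _ _ fin_G] subspace_lowest)
  ultimately have "int (dim_hom l action U U') = int (wdim U U' (- int l)) - int (wdim U U' (- int l - 2))"
    using 1 qdim_lowest[OF st(1), of l] qdim_lowest[OF st(2), of l] wdim_tower[OF U U', of "- int l"] wdim_tower[OF U U', of "- int l - 2"]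
    by simp
  moreover have "wdim U U' (- int l - 2) = wdim U U' (int l + 2)"
    using wdim_symmetric[OF U U', of "int l + 2"] by simp
  ultimately show ?thesis using wdim_symmetric[OF U U', of "int l"] by simp
qed

end


section \<open>Tensor products of evaluation modules\<close>

text \<open>Each basis element of \<open>sl\<^sub>2\<close> maps a basis vector of \<open>\<pi>\<^sub>a\<close> to a multiple of a basis vector. The
  separation of coefficient and index makes operators on different tensor factors commute
  visibly.\<close>

fun irr_coef :: "nat \<Rightarrow> sl2 \<Rightarrow> nat \<Rightarrow> complex" where
  "irr_coef a E j = (if j < a then 1 else 0)"
| "irr_coef a H j = 2 * of_nat j - of_nat a"
| "irr_coef a F j = of_nat j * (of_nat a - of_nat j + 1)"

fun irr_shift :: "sl2 \<Rightarrow> nat \<Rightarrow> nat" where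
  "irr_shift E j = j + 1"
| "irr_shift H j = j"
| "irr_shift F j = j - 1"

lemma irr_act_eq: "irr_act a x j = scal (irr_coef a x j) (basis_vec (irr_shift x j))"
  by (cases x) auto

definition slot_act :: "nat list \<Rightarrow> nat \<Rightarrow> sl2 \<Rightarrow> nat list cvec \<Rightarrow> nat list cvec" where
  "slot_act as i x = lin_ext (\<lambda>js. scal (irr_coef (as ! i) x (js ! i)) (basis_vec (js[i := irr_shift x (js ! i)])))"

lemma clin_slot_act [intro!]: "clin (slot_act as i x)"
  by (simp add: slot_act_def clin_lin_ext)

lemma slot_act_basis: "slot_act as i x (basis_vec js)
    = scal (irr_coef (as ! i) x (js ! i)) (basis_vec (js[i := irr_shift x (js ! i)]))"
  by (simp add: slot_act_def)

lemma eval_act_slot: "eval_act as zs x r v = (\<Sum>i<length as. scal ((zs ! i) ^ r) (slot_act as i x v))"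
  by (rule clin_eq[where v = v and f = "eval_act as zs x r"])
     (auto intro: clin_setsum clin_scaled clin_slot_act
        simp: eval_act_def slot_act_basis irr_act_eq lin_ext_scaled_basis clin_lin_ext)

lemma clin_eval_act: "clin (eval_act as zs x r)"
  by (simp add: eval_act_def clin_lin_ext)

lemma slot_act_commute:
  assumes "i \<noteq> k"
  shows "slot_act as i x (slot_act as k y v) = slot_act as k y (slot_act as i x v)"
  by (rule clin_eq[where v = v and f = "\<lambda>v. slot_act as i x (slot_act as k y v)"])
     (use assms in \<open>auto intro: clin_comp[OF clin_slot_act clin_slot_act]
        simp: slot_act_basis clin_scal[OF clin_slot_act] list_update_swap[of i k] mult.commute\<close>)

definition indices :: "nat list \<Rightarrow> nat list set" where
  "indices as = {js. length js = length as \<and> (\<forall>i<length as. js ! i \<le> as ! i)}"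

text \<open>The tensor product proper: the ambient space also has basis vectors with indices that do not
  occur in it, and the relations of \<open>sl\<^sub>2\<close> fail on those.\<close>

definition tensor_space :: "nat list \<Rightarrow> nat list cvec set" where
  "tensor_space as = {v. Poly_Mapping.keys v \<subseteq> indices as}"

lemma subspace_tensor_space: "cvec.subspace (tensor_space as)"
  by (simp add: tensor_space_def subspace_keys)

lemma basis_in_tensor_space: "basis_vec js \<in> tensor_space as \<longleftrightarrow> js \<in> indices as"
  by (simp add: tensor_space_def)

lemma finite_indices: "finite (indices as)"
proof (rule finite_subset)
  show "indices as \<subseteq> {js. set js \<subseteq> {..sum_list as} \<and> length js = length as}"
  proof (safe, goal_cases)
    case (1 js x)
    then obtain i where "i < length as" "x = js ! i" by (auto simp: indices_def in_set_conv_nth)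
    then have "x \<le> as ! i" "as ! i \<le> sum_list as" using 1 by (auto simp: indices_def elem_le_sum_list)
    then show ?case by simp
  qed (simp add: indices_def)
  show "finite {js. set js \<subseteq> {..sum_list as} \<and> length js = length as}"
    by (rule finite_lists_length_eq) simp
qed

lemma slot_act_tensor_space:
  assumes "v \<in> tensor_space as" "i < length as"
  shows "slot_act as i x v \<in> tensor_space as"
proof (rule clin_into_keys[OF clin_slot_act subspace_tensor_space])
  fix js assume "js \<in> Poly_Mapping.keys v"
  then have js: "js \<in> indices as" using assms by (auto simp: tensor_space_def)
  show "slot_act as i x (basis_vec js) \<in> tensor_space as"
  proof (cases "irr_coef (as ! i) x (js ! i) = 0")
    case False
    then have "irr_shift x (js ! i) \<le> as ! i" using js assms(2) by (cases x) (auto simp: indices_def split: if_splits)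
    then have "js[i := irr_shift x (js ! i)] \<in> indices as" using js assms(2) by (auto simp: indices_def nth_list_update)
    then show ?thesis
      by (simp add: slot_act_basis cvec.subspace_scale[OF subspace_tensor_space] basis_in_tensor_space)
  qed (simp add: slot_act_basis cvec.subspace_0[OF subspace_tensor_space])
qed

lemma eval_act_tensor_space: "v \<in> tensor_space as \<Longrightarrow> eval_act as zs x r v \<in> tensor_space as"
  unfolding eval_act_slot
  by (intro cvec.subspace_sum[OF subspace_tensor_space] cvec.subspace_scale[OF subspace_tensor_space] slot_act_tensor_space) auto

lemma slot_act_bracket:
  assumes "v \<in> tensor_space as" "i < length as"
  shows "slot_act as i x (slot_act as i y v) - slot_act as i y (slot_act as i x v)
    = lin_ext (\<lambda>z. slot_act as i z v) (sl2_bracket x y)"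
proof (rule clin_eq_keys[where v = v and f = "\<lambda>v. slot_act as i x (slot_act as i y v) - slot_act as i y (slot_act as i x v)"])
  fix js assume "js \<in> Poly_Mapping.keys v"
  then have "js \<in> indices as" using assms by (auto simp: tensor_space_def)
  then have js: "js ! i \<le> as ! i" "i < length js" using assms(2) by (auto simp: indices_def)
  define a j where "a = as ! i" and "j = js ! i"
  have b: "slot_act as i x (basis_vec (js[i := n])) = scal (irr_coef a x n) (basis_vec (js[i := irr_shift x n]))" for x n
    using js by (simp add: slot_act_basis a_def)
  have jsi: "js = js[i := j]" by (simp add: j_def)
  have ja: "j \<le> a" using js by (simp add: a_def j_def)
  have "slot_act as i x (slot_act as i y (basis_vec (js[i := j]))) - slot_act as i y (slot_act as i x (basis_vec (js[i := j])))
    = lin_ext (\<lambda>z. slot_act as i z (basis_vec (js[i := j]))) (sl2_bracket x y)"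
  proof (cases j)
    case 0
    show ?thesis
      using ja 0 by (cases "a = 0"; cases x; cases y)
        (simp_all add: b clin_scal[OF clin_slot_act] lin_ext_scaled_basis lin_ext_uminus clin_0[OF clin_slot_act]
          flip: cvec.scale_left_distrib cvec.scale_left_diff_distrib cvec.scale_minus_left)
  next
    case (Suc r)
    show ?thesis
      using ja Suc by (cases "a = Suc r"; cases x; cases y)
        (simp_all add: b clin_scal[OF clin_slot_act] lin_ext_scaled_basis lin_ext_uminus clin_0[OF clin_slot_act]
          flip: cvec.scale_left_distrib cvec.scale_left_diff_distrib cvec.scale_minus_left,
         simp_all add: algebra_simps)
  qed
  then show "slot_act as i x (slot_act as i y (basis_vec js)) - slot_act as i y (slot_act as i x (basis_vec js))
    = lin_ext (\<lambda>z. slot_act as i z (basis_vec js)) (sl2_bracket x y)"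
    unfolding jsi[symmetric] .
qed (intro clin_minus clin_comp[OF clin_slot_act] clin_slot_act clin_lin_ext_fun)+

text \<open>In the double sum over the tensor factors only the diagonal terms contribute.\<close>

lemma eval_act_bracket:
  assumes "v \<in> tensor_space as"
  shows "eval_act as zs x r (eval_act as zs y s v) - eval_act as zs y s (eval_act as zs x r v)
    = lin_ext (\<lambda>z. eval_act as zs z (r + s) v) (sl2_bracket x y)"
proof -
  let ?n = "length as"
  have 1: "eval_act as zs x r (eval_act as zs y s v)
    = (\<Sum>i<?n. \<Sum>k<?n. scal ((zs ! i) ^ r * (zs ! k) ^ s) (slot_act as i x (slot_act as k y v)))" for x y r s
    unfolding eval_act_slot[of _ _ _ _ v] clin_sum[OF clin_eval_act] clin_scal[OF clin_eval_act]
    unfolding eval_act_slot by (subst sum.swap) (simp add: cvec.scale_sum_right mult.commute)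
  have 2: "eval_act as zs y s (eval_act as zs x r v)
    = (\<Sum>i<?n. \<Sum>k<?n. scal ((zs ! i) ^ r * (zs ! k) ^ s) (slot_act as k y (slot_act as i x v)))"
    unfolding 1 by (subst sum.swap) (simp add: mult.commute)
  have inner: "(\<Sum>k<?n. scal ((zs ! i) ^ r * (zs ! k) ^ s) (slot_act as i x (slot_act as k y v) - slot_act as k y (slot_act as i x v)))
     = scal ((zs ! i) ^ (r + s)) (lin_ext (\<lambda>z. slot_act as i z v) (sl2_bracket x y))" if "i < ?n" for i
  proof -
    have "(\<Sum>k<?n. scal ((zs ! i) ^ r * (zs ! k) ^ s) (slot_act as i x (slot_act as k y v) - slot_act as k y (slot_act as i x v)))
      = (\<Sum>k<?n. if k = i then scal ((zs ! i) ^ (r + s)) (lin_ext (\<lambda>z. slot_act as i z v) (sl2_bracket x y)) else 0)"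
      by (rule sum.cong) (use assms that in \<open>auto simp: slot_act_bracket slot_act_commute power_add\<close>)
    then show ?thesis using that by simp
  qed
  have "eval_act as zs x r (eval_act as zs y s v) - eval_act as zs y s (eval_act as zs x r v)
    = (\<Sum>i<?n. scal ((zs ! i) ^ (r + s)) (lin_ext (\<lambda>z. slot_act as i z v) (sl2_bracket x y)))"
    unfolding 1[of x r y s] 2 sum_subtractf[symmetric] cvec.scale_right_diff_distrib[symmetric]
    by (rule sum.cong) (simp_all add: inner)
  also have "\<dots> = lin_ext (\<lambda>z. eval_act as zs z (r + s) v) (sl2_bracket x y)"
    unfolding eval_act_slot by (simp add: lin_ext_def cvec.scale_sum_right mult.commute) (subst sum.swap, rule refl)
  finally show ?thesis .
qed

definition tensor_weight :: "nat list \<Rightarrow> nat list \<Rightarrow> int" where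
  "tensor_weight as js = (\<Sum>i<length as. 2 * int (js ! i) - int (as ! i))"

lemma tensor_weight_bound:
  assumes "js \<in> indices as"
  shows "\<bar>tensor_weight as js\<bar> \<le> int (sum_list as)"
proof -
  have "\<bar>tensor_weight as js\<bar> \<le> (\<Sum>i<length as. \<bar>2 * int (js ! i) - int (as ! i)\<bar>)"
    unfolding tensor_weight_def by (rule sum_abs)
  also have "\<dots> \<le> (\<Sum>i<length as. int (as ! i))"
    using assms by (intro sum_mono) (auto simp: indices_def)
  also have "\<dots> = int (sum_list as)"
    by (simp add: sum_list_sum_nth atLeast0LessThan)
  finally show ?thesis .
qed

lemma eval_act_H:
  shows "eval_act as zs H 0 (basis_vec js) = scal (of_int (tensor_weight as js)) (basis_vec js)"
  by (simp add: eval_act_slot slot_act_basis tensor_weight_def flip: cvec.scale_sum_left)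

definition weight_part :: "nat list \<Rightarrow> int \<Rightarrow> nat list cvec \<Rightarrow> nat list cvec" where
  "weight_part as k = lin_ext (\<lambda>js. if tensor_weight as js = k then basis_vec js else 0)"

lemma clin_weight_part: "clin (weight_part as k)"
  by (simp add: weight_part_def clin_lin_ext)

lemma lookup_weight_part: "Poly_Mapping.lookup (weight_part as k v) js = (if tensor_weight as js = k then Poly_Mapping.lookup v js else 0)"
proof -
  have "Poly_Mapping.lookup (weight_part as k v) js = (\<Sum>i\<in>Poly_Mapping.keys v. if i = js then (if tensor_weight as js = k then Poly_Mapping.lookup v js else 0) else 0)"
    unfolding weight_part_def lin_ext_def lookup_sum
    by (rule sum.cong) (auto simp: lookup_single when_def)
  then show ?thesis by (simp add: in_keys_iff)
qed

lemma lookup_eval_act_H: "Poly_Mapping.lookup (eval_act as zs H 0 v) js = of_int (tensor_weight as js) * Poly_Mapping.lookup v js"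
proof -
  have "eval_act as zs H 0 v = lin_ext (\<lambda>js. scal (of_int (tensor_weight as js)) (basis_vec js)) v"
    by (rule clin_eq[OF clin_eval_act clin_lin_ext]) (simp add: eval_act_H)
  also have "Poly_Mapping.lookup \<dots> js = (\<Sum>i\<in>Poly_Mapping.keys v. if i = js then of_int (tensor_weight as js) * Poly_Mapping.lookup v js else 0)"
    unfolding lin_ext_def lookup_sum by (rule sum.cong) (auto simp: lookup_single when_def)
  finally show ?thesis by (simp add: in_keys_iff)
qed

interpretation ev: sl2_rep_fin "eval_act as zs E 0" "eval_act as zs F 0" "eval_act as zs H 0" "tensor_space as"
    "int (sum_list as)" "basis_vec ` indices as" "weight_part as" for as zs
proof
  fix v :: "nat list cvec" assume v: "v \<in> tensor_space as"
  note br = eval_act_bracket[OF v, of zs _ 0 _ 0]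
  show "eval_act as zs H 0 (eval_act as zs E 0 v) = eval_act as zs E 0 (eval_act as zs H 0 v) + scal 2 (eval_act as zs E 0 v)"
    using br[of H E] by (simp add: lin_ext_scaled_basis algebra_simps)
  show "eval_act as zs H 0 (eval_act as zs F 0 v) = eval_act as zs F 0 (eval_act as zs H 0 v) - scal 2 (eval_act as zs F 0 v)"
    using br[of H F] by (simp add: lin_ext_scaled_basis lin_ext_uminus algebra_simps)
  show "eval_act as zs E 0 (eval_act as zs F 0 v) = eval_act as zs F 0 (eval_act as zs E 0 v) + eval_act as zs H 0 v"
    using br[of E F] by (simp add: algebra_simps)
  show "weight_part as k v \<in> tensor_space as" for k
    using v by (auto simp: tensor_space_def in_keys_iff lookup_weight_part subset_iff split: if_splits)
  show "weight_part as k (eval_act as zs H 0 v) = scal (of_int k) (weight_part as k v)" for k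
    by (rule poly_mapping_eqI) (simp add: lookup_weight_part lookup_eval_act_H)
  show "eval_act as zs H 0 (weight_part as k v) = scal (of_int k) (weight_part as k v)" for k
    by (rule poly_mapping_eqI) (simp add: lookup_weight_part lookup_eval_act_H)
  show "v = (\<Sum>k\<in>{- int (sum_list as)..int (sum_list as)}. weight_part as k v)"
  proof (rule poly_mapping_eqI)
    fix js
    have "tensor_weight as js \<in> {- int (sum_list as)..int (sum_list as)}" if "Poly_Mapping.lookup v js \<noteq> 0"
      using that v tensor_weight_bound[of js as] by (auto simp: tensor_space_def in_keys_iff subset_iff)
    then show "Poly_Mapping.lookup v js = Poly_Mapping.lookup (\<Sum>k\<in>{- int (sum_list as)..int (sum_list as)}. weight_part as k v) js"
      by (auto simp: lookup_sum lookup_weight_part)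
  qed
next
  fix v :: "nat list cvec" and j
  assume v: "v \<in> tensor_space as" and j: "eval_act as zs H 0 v = scal (of_int j) v" "\<bar>j\<bar> > int (sum_list as)"
  show "v = 0"
  proof (rule poly_mapping_eqI)
    fix js
    have "of_int (tensor_weight as js) * Poly_Mapping.lookup v js = of_int j * Poly_Mapping.lookup v js"
      using arg_cong[OF j(1), of "\<lambda>u. Poly_Mapping.lookup u js"] by (simp add: lookup_eval_act_H)
    moreover have "tensor_weight as js \<noteq> j" if "Poly_Mapping.lookup v js \<noteq> 0"
      using that v tensor_weight_bound[of js as] j(2) by (auto simp: tensor_space_def in_keys_iff subset_iff)
    ultimately show "Poly_Mapping.lookup v js = Poly_Mapping.lookup 0 js" by auto
  qed
next
  show "tensor_space as \<subseteq> cvec.span (basis_vec ` indices as)"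
    by (auto simp: tensor_space_def intro: in_span_basis)
qed (auto simp: clin_eval_act subspace_tensor_space eval_act_tensor_space finite_indices clin_weight_part)


section \<open>Fusion products\<close>

definition words_upto :: "nat list \<Rightarrow> complex list \<Rightarrow> nat \<Rightarrow> nat list cvec set" where
  "words_upto as zs s = {foldr (\<lambda>(x, i). eval_act as zs x i) xs (lowest_vec as) |xs. sum_list (map snd xs) \<le> s}"

lemma fusion_filt_span: "fusion_filt as zs s = cvec.span (words_upto as zs s)"
  by (simp add: fusion_filt_def words_upto_def)

lemma subspace_fusion_filt: "cvec.subspace (fusion_filt as zs s)"
  by (simp add: fusion_filt_def)

lemma subspace_fusion_filt_prev: "cvec.subspace (fusion_filt_prev as zs s)"
  by (simp add: fusion_filt_prev_def subspace_fusion_filt split: nat.split)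

lemma eval_act_fusion_filt:
  assumes "v \<in> fusion_filt as zs s"
  shows "eval_act as zs x r v \<in> fusion_filt as zs (s + r)"
proof (rule clin_span_into[OF clin_eval_act subspace_fusion_filt _ assms[unfolded fusion_filt_span]])
  fix g assume "g \<in> words_upto as zs s"
  then obtain xs where "g = foldr (\<lambda>(x, i). eval_act as zs x i) xs (lowest_vec as)" "sum_list (map snd xs) \<le> s"
    by (auto simp: words_upto_def)
  then have "eval_act as zs x r g = foldr (\<lambda>(x, i). eval_act as zs x i) ((x, r) # xs) (lowest_vec as)
     \<and> sum_list (map snd ((x, r) # xs)) \<le> s + r" by simp
  then show "eval_act as zs x r g \<in> fusion_filt as zs (s + r)"
    unfolding fusion_filt_span words_upto_def by (intro cvec.span_base) blast
qed

lemma eval_act_fusion_filt_prev: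
  assumes "v \<in> fusion_filt_prev as zs s"
  shows "eval_act as zs x r v \<in> fusion_filt_prev as zs (s + r)"
proof (cases s)
  case 0
  then show ?thesis using assms subspace_fusion_filt_prev cvec.subspace_0
    by (auto simp: fusion_filt_prev_def[of _ _ 0] clin_0[OF clin_eval_act])
next
  case (Suc t)
  then show ?thesis using assms eval_act_fusion_filt[of v as zs t x r] by (simp add: fusion_filt_prev_def)
qed

lemma fusion_filt_prev_sub: "fusion_filt_prev as zs s \<subseteq> fusion_filt as zs s"
proof (cases s)
  case 0
  then show ?thesis using cvec.subspace_0[OF subspace_fusion_filt] by (auto simp: fusion_filt_prev_def)
next
  case (Suc t)
  then show ?thesis unfolding fusion_filt_prev_def fusion_filt_span words_upto_def
    by (simp, intro cvec.span_mono) fastforce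
qed

text \<open>The lowest weight vector is a weight vector, and \<open>e\<^sub>r\<close>, \<open>h\<^sub>r\<close>, \<open>f\<^sub>r\<close> change weights by \<open>2\<close>, \<open>0\<close>, \<open>-2\<close>. Thus each
  step of the filtration is graded by weight.\<close>

lemma words_weight:
  "g \<in> words_upto as zs s \<Longrightarrow> \<exists>j. g \<in> ev.wspace as zs j"
proof -
  have step: "eval_act as zs x r v \<in> ev.wspace as zs (j + (case x of E \<Rightarrow> 2 | H \<Rightarrow> 0 | F \<Rightarrow> - 2))"
    if "v \<in> ev.wspace as zs j" for x r v j
  proof -
    have v: "v \<in> tensor_space as" "eval_act as zs H 0 v = scal (of_int j) v"
      using that by (auto simp: ev.wspace_def)
    have "eval_act as zs H 0 (eval_act as zs x r v) = scal (of_int j) (eval_act as zs x r v)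
       + lin_ext (\<lambda>z. eval_act as zs z r v) (sl2_bracket H x)"
      using eval_act_bracket[OF v(1), of zs H 0 x r] v(2)
      by (simp add: clin_scal[OF clin_eval_act] algebra_simps)
    then show ?thesis
      using v(1) by (cases x) (simp_all add: ev.wspace_def eval_act_tensor_space lin_ext_scaled_basis lin_ext_uminus
         cvec.scale_left_distrib cvec.scale_left_diff_distrib)
  qed
  have low: "replicate (length as) 0 \<in> indices as" by (simp add: indices_def)
  have "\<exists>j. foldr (\<lambda>(x, i). eval_act as zs x i) xs (lowest_vec as) \<in> ev.wspace as zs j" for xs
  proof (induction xs)
    case Nil
    have "lowest_vec as \<in> ev.wspace as zs (tensor_weight as (replicate (length as) 0))"
      using low by (simp add: ev.wspace_def lowest_vec_def eval_act_H basis_in_tensor_space)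
    then show ?case by auto
  next
    case (Cons a xs)
    then show ?case using step by (cases a) fastforce
  qed
  then show "g \<in> words_upto as zs s \<Longrightarrow> \<exists>j. g \<in> ev.wspace as zs j" by (auto simp: words_upto_def)
qed

lemma graded_fusion_filt: "ev.graded as zs (fusion_filt as zs s)"
proof -
  have sub: "fusion_filt as zs s \<subseteq> tensor_space as"
    unfolding fusion_filt_span using words_weight ev.wspace_A
    by (intro cvec.span_minimal subspace_tensor_space) blast
  have "weight_part as k v \<in> fusion_filt as zs s" if v: "v \<in> fusion_filt as zs s" for v k
  proof (rule clin_span_into[OF clin_weight_part subspace_fusion_filt _ v[unfolded fusion_filt_span]])
    fix g assume g: "g \<in> words_upto as zs s"
    then obtain j where "g \<in> ev.wspace as zs j" using words_weight by blast
    then have gH: "eval_act as zs H 0 g = scal (of_int j) g" by (simp add: ev.wspace_def)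
    have "weight_part as k g = (if k = j then g else 0)"
    proof (rule poly_mapping_eqI)
      fix js
      have "of_int (tensor_weight as js) * Poly_Mapping.lookup g js = of_int j * Poly_Mapping.lookup g js"
        using arg_cong[OF gH, of "\<lambda>u. Poly_Mapping.lookup u js"] by (simp add: lookup_eval_act_H)
      then have "tensor_weight as js = j \<or> Poly_Mapping.lookup g js = 0" by auto
      then show "Poly_Mapping.lookup (weight_part as k g) js = Poly_Mapping.lookup (if k = j then g else 0) js"
        by (auto simp: lookup_weight_part)
    qed
    then show "weight_part as k g \<in> fusion_filt as zs s"
      using g cvec.subspace_0[OF subspace_fusion_filt] by (auto simp: fusion_filt_span cvec.span_base)
  qed
  then show ?thesis
    unfolding ev.graded_def ev.stable_def
    using sub subspace_fusion_filt eval_act_fusion_filt[of _ as zs s _ 0] by simp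
qed

lemma graded_fusion_filt_prev: "ev.graded as zs (fusion_filt_prev as zs s)"
proof (cases s)
  case 0
  then show ?thesis
    by (auto simp: fusion_filt_prev_def ev.graded_def ev.stable_def clin_0[OF clin_eval_act]
        clin_0[OF clin_weight_part] cvec.subspace_0[OF subspace_tensor_space])
qed (simp add: fusion_filt_prev_def graded_fusion_filt)

text \<open>The dimension of the weight space of weight \<open>j\<close> in degree \<open>s\<close> of the fusion product.\<close>

definition mult_dim :: "nat list \<Rightarrow> complex list \<Rightarrow> nat \<Rightarrow> int \<Rightarrow> nat" where
  "mult_dim as zs s = ev.wdim as zs (fusion_filt as zs s) (fusion_filt_prev as zs s)"

lemma kostka_nth:
  "fps_nth (Abs_fps (\<lambda>s. int (dim_hom l (\<lambda>x. eval_act as zs x 0) (fusion_filt as zs s) (fusion_filt_prev as zs s)))) s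
   = int (mult_dim as zs s (int l)) - int (mult_dim as zs s (int l + 2))"
  unfolding mult_dim_def fps_nth_Abs_fps
  by (rule ev.dim_hom_eq[OF graded_fusion_filt graded_fusion_filt_prev fusion_filt_prev_sub]) simp_all

lemma mult_dim_symmetric: "mult_dim as zs s (- j) = mult_dim as zs s j"
  unfolding mult_dim_def by (rule ev.wdim_symmetric[OF graded_fusion_filt graded_fusion_filt_prev fusion_filt_prev_sub])

lemma mult_dim_zero: "\<bar>j\<bar> > int (sum_list as) \<Longrightarrow> mult_dim as zs s j = 0"
  unfolding mult_dim_def by (rule ev.wdim_zero[OF graded_fusion_filt graded_fusion_filt_prev])

lemma fusion_upper: "upper (fusion as zs) = dsum UNIV (fusion_filt as zs)"
  and fusion_lower: "lower (fusion as zs) = dsum UNIV (fusion_filt_prev as zs)"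
  using span_dsum[of UNIV "fusion_filt as zs"] span_dsum[of UNIV "fusion_filt_prev as zs"]
  by (simp_all add: fusion_def subspace_fusion_filt subspace_fusion_filt_prev)

lemma clin_act_fusion: "clin (act (fusion as zs) b)"
  by (simp add: fusion_def clin_lin_ext)

lemma act_fusion_Loop: "i \<le> 0 \<Longrightarrow> act (fusion as zs) (Loop x i) (basis_vec s \<otimes> v)
    = basis_vec (s + nat (- i)) \<otimes> eval_act as zs x (nat (- i)) v"
  by (rule clin_eq[where v = v and f = "\<lambda>v. act (fusion as zs) (Loop x i) (basis_vec s \<otimes> v)",
        OF clin_comp[OF clin_act_fusion clin_tens_right] clin_comp[OF clin_tens_right clin_eval_act]])
     (simp add: fusion_def)

lemma act_fusion_Deg: "act (fusion as zs) Deg (basis_vec s \<otimes> v) = scal (of_nat s) (basis_vec s \<otimes> v)"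
  by (rule clin_eq[where v = v and f = "\<lambda>v. act (fusion as zs) Deg (basis_vec s \<otimes> v)",
        OF clin_comp[OF clin_act_fusion clin_tens_right] clin_scaled[OF clin_tens_right]])
     (simp add: fusion_def)

lemma act_fusion_Central: "act (fusion as zs) Central v = 0"
  by (rule clin_eq[OF clin_act_fusion clin_zero]) (simp add: fusion_def)

lemma lower_ops_cases:
  assumes "b \<in> lower_ops"
  obtains x i where "b = Loop x i" "i \<le> 0" | "b = Deg"
  using assms by (auto simp: lower_ops_def n_minus_def)

text \<open>The upper space, the lower space and the ambient space of the fusion product are all of this form.\<close>

lemma act_fusion_dsum:
  assumes b: "b \<in> lower_ops" and sub: "\<And>s. cvec.subspace (S s)"
    and st: "\<And>x r s v. v \<in> S s \<Longrightarrow> eval_act as zs x r v \<in> S (s + r)"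
    and z: "z \<in> dsum UNIV S"
  shows "act (fusion as zs) b z \<in> dsum UNIV S"
proof -
  have eq: "dsum UNIV S = cvec.span {basis_vec s \<otimes> v |s v. s \<in> UNIV \<and> v \<in> S s}"
    by (rule span_dsum[symmetric]) (rule sub)
  show ?thesis
  proof (rule clin_span_into[OF clin_act_fusion _ _ z[unfolded eq]])
    show "cvec.subspace (dsum UNIV S)" by (rule subspace_dsum) (rule sub)
    fix g assume "g \<in> {basis_vec s \<otimes> v |s v. s \<in> UNIV \<and> v \<in> S s}"
    then obtain s v where g: "g = basis_vec s \<otimes> v" "v \<in> S s" by blast
    from b show "act (fusion as zs) b g \<in> dsum UNIV S"
    proof (cases rule: lower_ops_cases)
      case (1 x i)
      have "act (fusion as zs) b g = basis_vec (s + nat (- i)) \<otimes> eval_act as zs x (nat (- i)) v"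
        using 1 by (simp add: g act_fusion_Loop)
      then show ?thesis unfolding eq using st[OF g(2), of x "nat (- i)"] by (intro cvec.span_base) blast
    next
      case 2
      have "basis_vec s \<otimes> v \<in> dsum UNIV S" unfolding eq using g by (intro cvec.span_base) blast
      then show ?thesis unfolding 2 g(1) act_fusion_Deg
        by (intro cvec.subspace_scale subspace_dsum sub)
    qed
  qed
qed

lemma act_fusion_loop_vec:
  assumes "n \<le> 0"
  shows "lin_ext (\<lambda>d. act (fusion as zs) d (basis_vec s \<otimes> v)) (loop_vec u n)
    = basis_vec (s + nat (- n)) \<otimes> lin_ext (\<lambda>z. eval_act as zs z (nat (- n)) v) u"
  unfolding loop_vec_def clin_lin_ext_comp[OF clin_lin_ext] clin_lin_ext_comp[OF clin_tens_right]
  using assms by (simp add: act_fusion_Loop)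

lemma fusion_bracket:
  assumes b: "b \<in> lower_ops" and c: "c \<in> lower_ops" and z: "z \<in> dsum UNIV (\<lambda>_. tensor_space as)"
  shows "act (fusion as zs) b (act (fusion as zs) c z) - act (fusion as zs) c (act (fusion as zs) b z)
    = lin_ext (\<lambda>d. act (fusion as zs) d z) (aff_bracket b c)"
proof -
  let ?a = "act (fusion as zs)"
  have eq: "dsum UNIV (\<lambda>_::nat. tensor_space as) = cvec.span {basis_vec s \<otimes> v |s v. s \<in> UNIV \<and> v \<in> tensor_space as}"
    by (rule span_dsum[symmetric]) (rule subspace_tensor_space)
  show ?thesis
  proof (rule clin_span_eq[where f = "\<lambda>z. ?a b (?a c z) - ?a c (?a b z)" and h = "\<lambda>z. lin_ext (\<lambda>d. ?a d z) (aff_bracket b c)"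
         and v = z, OF _ _ _ z[unfolded eq]])
    show "clin (\<lambda>z. ?a b (?a c z) - ?a c (?a b z))" by (intro clin_minus clin_comp[OF clin_act_fusion clin_act_fusion])
    show "clin (\<lambda>z. lin_ext (\<lambda>d. ?a d z) (aff_bracket b c))" by (intro clin_lin_ext_fun clin_act_fusion)
    fix g :: "(nat \<times> nat list) cvec" assume "g \<in> {basis_vec s \<otimes> v |s v. s \<in> UNIV \<and> v \<in> tensor_space as}"
    then obtain s v where g: "g = basis_vec s \<otimes> v" "v \<in> tensor_space as" by blast
    show "?a b (?a c g) - ?a c (?a b g) = lin_ext (\<lambda>d. ?a d g) (aff_bracket b c)"
      using b
    proof (cases rule: lower_ops_cases)
      case b: (1 x i)
      from c show ?thesis
      proof (cases rule: lower_ops_cases)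
        case c: (1 y j)
        define r q where "r = nat (- i)" and "q = nat (- j)"
        have ij: "i = - int r" "j = - int q" using b c by (auto simp: r_def q_def)
        have "?a b (?a c g) - ?a c (?a b g) = basis_vec (s + (r + q)) \<otimes>
           (eval_act as zs x r (eval_act as zs y q v) - eval_act as zs y q (eval_act as zs x r v))"
          by (simp add: b(1) c(1) ij g act_fusion_Loop add_ac tens_diff_right)
        also have "\<dots> = lin_ext (\<lambda>d. ?a d g) (loop_vec (sl2_bracket x y) (i + j))"
          by (simp add: eval_act_bracket[OF g(2)] g(1) act_fusion_loop_vec ij nat_add_distrib add.commute[of q r])
        also have "\<dots> = lin_ext (\<lambda>d. ?a d g) (aff_bracket b c)"
          unfolding b c aff_bracket_loop by (simp add: lin_ext_if_Central act_fusion_Central)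
        finally show ?thesis .
      next
        case 2
        then show ?thesis using b
          by (simp add: g act_fusion_Loop act_fusion_Deg lin_ext_scaled_basis clin_scal[OF clin_act_fusion] of_nat_nat algebra_simps)
      qed
    next
      case b: 2
      from c show ?thesis
      proof (cases rule: lower_ops_cases)
        case (1 y j)
        then show ?thesis using b
          by (simp add: g act_fusion_Loop act_fusion_Deg lin_ext_scaled_basis lin_ext_uminus clin_scal[OF clin_act_fusion] of_nat_nat algebra_simps)
      next
        case 2
        then show ?thesis using b by simp
      qed
    qed
  qed
qed

lemma lower_module_fusion: "lower_module (fusion as zs) (dsum UNIV (\<lambda>_. tensor_space as))"
proof
  have "fusion_filt as zs s \<subseteq> tensor_space as" for s
    using graded_fusion_filt[of as zs s] by (auto simp: ev.graded_def ev.stable_def)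
  then show "upper (fusion as zs) \<subseteq> dsum UNIV (\<lambda>_. tensor_space as)"
    unfolding fusion_upper by (intro dsum_mono)
  show "lower (fusion as zs) \<subseteq> upper (fusion as zs)"
    unfolding fusion_upper fusion_lower by (intro dsum_mono fusion_filt_prev_sub)
qed (auto simp: clin_act_fusion fusion_upper fusion_lower fusion_bracket
     intro!: subspace_dsum subspace_fusion_filt subspace_fusion_filt_prev subspace_tensor_space act_fusion_dsum
       eval_act_fusion_filt eval_act_fusion_filt_prev eval_act_tensor_space)

lemma slice_fusion_H: "slice s (act (fusion as zs) (Loop H 0) y) = eval_act as zs H 0 (slice s y)"
  by (rule clin_eq[where v = y and f = "\<lambda>y. slice s (act (fusion as zs) (Loop H 0) y)",
        OF clin_comp[OF clin_slice clin_act_fusion] clin_comp[OF clin_eval_act clin_slice]])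
     (auto simp: act_fusion_Loop clin_0[OF clin_eval_act] simp flip: basis_tens_basis)

lemma slice_fusion_Deg: "slice s (act (fusion as zs) Deg y) = scal (of_nat s) (slice s y)"
  by (rule clin_eq[where v = y and f = "\<lambda>y. slice s (act (fusion as zs) Deg y)",
        OF clin_comp[OF clin_slice clin_act_fusion] clin_scaled[OF clin_slice]])
     (auto simp: act_fusion_Deg clin_scal[OF clin_slice] simp flip: basis_tens_basis)

text \<open>The shift of degrees by \<open>\<lambda>(d)\<close> leads to negative degrees, where the fusion product vanishes.\<close>

definition mult_dim_int :: "nat list \<Rightarrow> complex list \<Rightarrow> int \<Rightarrow> int \<Rightarrow> nat" where
  "mult_dim_int as zs t j = (if t \<ge> 0 then mult_dim as zs (nat t) j else 0)"

text \<open>The operator \<open>d\<close> acts on the component of degree \<open>t\<close> by \<open>t\<close>. So all components except the one of degree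
  \<open>s - m\<close> vanish in the quotient, and the latter is the weight space of weight \<open>-i\<close>. Its dimension is that
  of weight \<open>i\<close> by symmetry.\<close>

lemma has_qdim_fusion:
  "has_qdim {z \<in> upper (fusion as zs). scal (of_int i) z + act (fusion as zs) (Loop H 0) z \<in> lower (fusion as zs)
       \<and> scal (of_int m - of_int s) z + act (fusion as zs) Deg z \<in> lower (fusion as zs)}
     (lower (fusion as zs)) (mult_dim_int as zs (s - m) i)"
proof -
  define U where "U = fusion_filt as zs"
  define U' where "U' = fusion_filt_prev as zs"
  have sU: "cvec.subspace (U t)" and sU': "cvec.subspace (U' t)" and U'U: "U' t \<subseteq> U t" for t
    by (simp_all add: U_def U'_def subspace_fusion_filt subspace_fusion_filt_prev fusion_filt_prev_sub)
  define Z where "Z = {z \<in> upper (fusion as zs). scal (of_int i) z + act (fusion as zs) (Loop H 0) z \<in> lower (fusion as zs)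
       \<and> scal (of_int m - of_int s) z + act (fusion as zs) Deg z \<in> lower (fusion as zs)}"
  have dU: "y \<in> dsum UNIV T \<longleftrightarrow> (\<forall>t. slice t y \<in> T t)" for y and T :: "nat \<Rightarrow> nat list cvec set"
    by (auto simp: dsum_def)
  have Zc: "z \<in> Z \<longleftrightarrow> (\<forall>t. slice t z \<in> U t \<and> scal (of_int i) (slice t z) + eval_act as zs H 0 (slice t z) \<in> U' t
       \<and> scal (of_int (m - s + int t)) (slice t z) \<in> U' t)" for z
    unfolding Z_def fusion_upper fusion_lower dU mem_Collect_eq
    by (simp add: clin_add[OF clin_slice] clin_diff[OF clin_slice] clin_scal[OF clin_slice] slice_fusion_H slice_fusion_Deg U_def U'_def
       cvec.scale_left_distrib cvec.scale_left_diff_distrib) blast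
  have low: "z \<in> lower (fusion as zs) \<longleftrightarrow> (\<forall>t. slice t z \<in> U' t)" for z
    unfolding fusion_lower dU U'_def ..
  have H: "v \<in> U' t \<Longrightarrow> eval_act as zs H 0 v \<in> U' t" for v t
    using eval_act_fusion_filt_prev[of v as zs t H 0] by (simp add: U'_def)
  have sub: "lower (fusion as zs) \<subseteq> Z"
    using H by (auto simp: Zc low intro!: cvec.subspace_add[OF sU'] cvec.subspace_scale[OF sU'] subsetD[OF U'U])
  have slow: "cvec.subspace (lower (fusion as zs))" by (simp add: fusion_def)
  have off: "slice t z \<in> U' t" if "z \<in> Z" "int t \<noteq> s - m" for z t
  proof -
    have "scal (of_int (m - s + int t)) (slice t z) \<in> U' t" using that Zc by blast
    then have "scal (inverse (of_int (m - s + int t))) (scal (of_int (m - s + int t)) (slice t z)) \<in> U' t"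
      by (rule cvec.subspace_scale[OF sU'])
    moreover have "inverse (of_int (m - s + int t)) * of_int (m - s + int t) = (1 :: complex)"
    proof (rule left_inverse)
      have "m - s + int t \<noteq> 0" using that(2) by arith
      then show "of_int (m - s + int t) \<noteq> (0 :: complex)" using of_int_eq_0_iff by blast
    qed
    ultimately show ?thesis unfolding cvec.scale_scale by simp
  qed
  show ?thesis
  proof (cases "s - m \<ge> 0")
    case False
    then have "int t \<noteq> s - m" for t by linarith
    then have "Z \<subseteq> lower (fusion as zs)" using off by (auto simp: low)
    then have "Z = lower (fusion as zs)" using sub by blast
    then show ?thesis using has_qdim_0[OF slow] False by (simp add: mult_dim_int_def flip: Z_def)
  next
    case True
    define t where "t = nat (s - m)"
    have t: "int t = s - m" using True by (simp add: t_def)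
    define X where "X = {v \<in> U t. eval_act as zs H 0 v - scal (of_int (- i)) v \<in> U' t}"
    have Xc: "v \<in> X \<longleftrightarrow> v \<in> U t \<and> scal (of_int i) v + eval_act as zs H 0 v \<in> U' t" for v
      by (simp add: X_def add.commute)
    have hX: "has_qdim X (U' t) (mult_dim as zs t i)"
      using ev.has_qdim_weight[OF graded_fusion_filt graded_fusion_filt_prev fusion_filt_prev_sub, of as zs t "- i"]
        mult_dim_symmetric[of as zs t i]
      by (simp add: mult_dim_def X_def U_def U'_def)
    have sZ: "cvec.subspace Z"
    proof -
      have "Z = upper (fusion as zs) \<inter> ({z. scal (of_int i) z + act (fusion as zs) (Loop H 0) z \<in> lower (fusion as zs)}
       \<inter> {z. scal (of_int m - of_int s) z + act (fusion as zs) Deg z \<in> lower (fusion as zs)})"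
        by (auto simp: Z_def)
      moreover have "cvec.subspace {z. scal c z + act (fusion as zs) b z \<in> lower (fusion as zs)}" for c b
        by (intro clin_preimage clin_plus clin_scaled clin_id clin_act_fusion slow)
      moreover have "cvec.subspace (upper (fusion as zs))" by (simp add: fusion_def)
      ultimately show ?thesis by (simp only: cvec.subspace_inter)
    qed
    have sX: "cvec.subspace X"
    proof -
      have "X = U t \<inter> {v. eval_act as zs H 0 v - scal (of_int (- i)) v \<in> U' t}" by (auto simp: X_def)
      then show ?thesis
        by (simp only: cvec.subspace_inter sU clin_preimage[OF clin_minus[OF clin_eval_act clin_scaled[OF clin_id]] sU'])
    qed
    have "quot_iso (slice t) Z (lower (fusion as zs)) X (U' t)"
      unfolding quot_iso_def
    proof (intro conjI ballI)
      fix z assume z: "z \<in> Z"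
      then show "slice t z \<in> X" by (simp add: Zc Xc)
      show "(slice t z \<in> U' t) = (z \<in> lower (fusion as zs))"
        using off[OF z] t by (auto simp: low) (metis of_nat_eq_iff)
    next
      fix v assume v: "v \<in> X"
      have "(of_nat t :: complex) = of_int (s - m)" using t by (metis of_int_of_nat_eq)
      then have "basis_vec t \<otimes> v \<in> Z"
        using v cvec.subspace_0[OF sU'] cvec.subspace_0[OF sU] by (auto simp: Zc Xc clin_0[OF clin_eval_act])
      then show "\<exists>x\<in>Z. v - slice t x \<in> U' t"
        by (intro bexI[of _ "basis_vec t \<otimes> v"]) (simp_all add: cvec.subspace_0[OF sU'])
    next
      show "U' t \<subseteq> X" using H
        by (auto simp: Xc intro!: cvec.subspace_add[OF sU'] cvec.subspace_scale[OF sU'] subsetD[OF U'U])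
    qed (use sub slow sZ sX sU' in auto)
    from has_qdim_iso[OF this] hX show ?thesis using True by (simp add: mult_dim_int_def t_def flip: Z_def)
  qed
qed


section \<open>The Weyl group\<close>

text \<open>The element \<open>t\<^sup>n\<close> of the Weyl group, with \<open>t = s\<^sub>0 s\<^sub>1\<close>.\<close>

definition translation :: "int \<Rightarrow> weight \<Rightarrow> weight" where
  "translation n = (\<lambda>(i, k, m). (i + 2 * of_int n * k, k, m + of_int n * i + of_int n ^ 2 * k))"

text \<open>The element \<open>t\<^sup>n s\<^sub>1\<close>.\<close>

definition reflection :: "int \<Rightarrow> weight \<Rightarrow> weight" where
  "reflection n = (\<lambda>(i, k, m). (- i + 2 * of_int n * k, k, m - of_int n * i + of_int n ^ 2 * k))"

lemma simple_reflection_comp: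
  "s0 \<circ> translation n = reflection (1 - n)" "s0 \<circ> reflection n = translation (1 - n)"
  "s1 \<circ> translation n = reflection (- n)" "s1 \<circ> reflection n = translation (- n)"
  by (auto simp: fun_eq_iff s0_def s1_def translation_def reflection_def power2_eq_square algebra_simps)

lemma translation_0: "translation 0 = id"
  by (auto simp: fun_eq_iff translation_def)

lemma weyl_word_cases:
  "set ss \<subseteq> {s0, s1} \<Longrightarrow> \<exists>n. weyl_word ss = translation n \<and> 2 * \<bar>n\<bar> \<le> int (length ss)
      \<or> weyl_word ss = reflection n \<and> \<bar>2 * n - 1\<bar> \<le> int (length ss)"
proof (induction ss)
  case Nil
  show ?case by (intro exI[of _ 0]) (simp add: weyl_word_def translation_0)
next
  case (Cons s ss)
  then obtain n where n: "weyl_word ss = translation n \<and> 2 * \<bar>n\<bar> \<le> int (length ss)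
      \<or> weyl_word ss = reflection n \<and> \<bar>2 * n - 1\<bar> \<le> int (length ss)" by auto
  have w: "weyl_word (s # ss) = s \<circ> weyl_word ss" by (simp add: weyl_word_def)
  from n show ?case
  proof (elim disjE conjE)
    assume n: "weyl_word ss = translation n" "2 * \<bar>n\<bar> \<le> int (length ss)"
    have "weyl_word (s # ss) = reflection (1 - n) \<or> weyl_word (s # ss) = reflection (- n)"
      using Cons.prems unfolding w n(1) simple_reflection_comp[symmetric] by auto
    moreover have "\<bar>2 * (1 - n) - 1\<bar> \<le> int (length (s # ss))" "\<bar>2 * (- n) - 1\<bar> \<le> int (length (s # ss))"
      using n(2) by (auto simp: abs_if split: if_splits)
    ultimately show ?thesis by blast
  next
    assume n: "weyl_word ss = reflection n" "\<bar>2 * n - 1\<bar> \<le> int (length ss)"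
    have "weyl_word (s # ss) = translation (1 - n) \<or> weyl_word (s # ss) = translation (- n)"
      using Cons.prems unfolding w n(1) simple_reflection_comp[symmetric] by auto
    moreover have "2 * \<bar>1 - n\<bar> \<le> int (length (s # ss))" "2 * \<bar>- n\<bar> \<le> int (length (s # ss))"
      using n(2) by (auto simp: abs_if split: if_splits)
    ultimately show ?thesis by blast
  qed
qed

text \<open>Induction on the length \<open>p\<close>: multiplication by \<open>s\<^sub>0\<close> shortens the elements with \<open>n > 0\<close>, and
  multiplication by \<open>s\<^sub>1\<close> the others of positive length.\<close>

lemma weyl_word_exists:
  "(2 * \<bar>n\<bar> = int p \<longrightarrow> (\<exists>ss. set ss \<subseteq> {s0, s1} \<and> length ss = p \<and> weyl_word ss = translation n)) \<and>
   (\<bar>2 * n - 1\<bar> = int p \<longrightarrow> (\<exists>ss. set ss \<subseteq> {s0, s1} \<and> length ss = p \<and> weyl_word ss = reflection n))"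
proof (induction p arbitrary: n)
  case 0
  show ?case
  proof (intro conjI impI)
    assume "2 * \<bar>n\<bar> = int 0"
    then have "n = 0" by simp
    then show "\<exists>ss. set ss \<subseteq> {s0, s1} \<and> length ss = 0 \<and> weyl_word ss = translation n"
      by (intro exI[of _ "[]"]) (simp add: weyl_word_def translation_0)
  next
    assume "\<bar>2 * n - 1\<bar> = int 0"
    then have "2 * n = 1" by simp
    then have False by presburger
    then show "\<exists>ss. set ss \<subseteq> {s0, s1} \<and> length ss = 0 \<and> weyl_word ss = reflection n" ..
  qed
next
  case (Suc p)
  have ext: "\<exists>ss. set ss \<subseteq> {s0, s1} \<and> length ss = Suc p \<and> weyl_word ss = s \<circ> w"
    if "\<exists>ss. set ss \<subseteq> {s0, s1} \<and> length ss = p \<and> weyl_word ss = w" "s \<in> {s0, s1}" for s w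
  proof -
    from that(1) obtain ss where ss: "set ss \<subseteq> {s0, s1}" "length ss = p" "weyl_word ss = w" by (elim exE conjE)
    have "weyl_word (s # ss) = s \<circ> w" unfolding ss(3)[symmetric] by (simp add: weyl_word_def)
    moreover have "set (s # ss) \<subseteq> {s0, s1}" "length (s # ss) = Suc p" using ss(1,2) that(2) by auto
    ultimately show ?thesis by blast
  qed
  show ?case
  proof (intro conjI impI)
    assume n: "2 * \<bar>n\<bar> = int (Suc p)"
    show "\<exists>ss. set ss \<subseteq> {s0, s1} \<and> length ss = Suc p \<and> weyl_word ss = translation n"
    proof (cases "n > 0")
      case True
      then have "\<bar>2 * (1 - n) - 1\<bar> = int p" using n by simp
      from ext[OF Suc.IH[of "1 - n", THEN conjunct2, rule_format, OF this], of s0]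
      show ?thesis by (simp add: simple_reflection_comp)
    next
      case False
      then have "\<bar>2 * (- n) - 1\<bar> = int p" using n by simp
      from ext[OF Suc.IH[of "- n", THEN conjunct2, rule_format, OF this], of s1]
      show ?thesis by (simp add: simple_reflection_comp)
    qed
  next
    assume n: "\<bar>2 * n - 1\<bar> = int (Suc p)"
    show "\<exists>ss. set ss \<subseteq> {s0, s1} \<and> length ss = Suc p \<and> weyl_word ss = reflection n"
    proof (cases "n > 0")
      case True
      then have "2 * \<bar>1 - n\<bar> = int p" using n by simp
      from ext[OF Suc.IH[of "1 - n", THEN conjunct1, rule_format, OF this], of s0]
      show ?thesis by (simp add: simple_reflection_comp)
    next
      case False
      then have "2 * \<bar>- n\<bar> = int p" using n by simp
      from ext[OF Suc.IH[of "- n", THEN conjunct1, rule_format, OF this], of s1]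
      show ?thesis by (simp add: simple_reflection_comp)
    qed
  qed
qed

lemma translation_word:
    "\<exists>ss. set ss \<subseteq> {s0, s1} \<and> length ss = nat (2 * \<bar>n\<bar>) \<and> weyl_word ss = translation n"
  and reflection_word:
    "\<exists>ss. set ss \<subseteq> {s0, s1} \<and> length ss = nat \<bar>2 * n - 1\<bar> \<and> weyl_word ss = reflection n"
  using weyl_word_exists[of n "nat (2 * \<bar>n\<bar>)"] weyl_word_exists[of n "nat \<bar>2 * n - 1\<bar>"] by simp_all

text \<open>The orbit of \<open>rho\<close> separates the elements of the Weyl group.\<close>

lemma fst_rho:
  "fst (translation n rho) = of_int (1 + 4 * n)" "fst (reflection n rho) = of_int (- 1 + 4 * n)"
  by (simp_all add: translation_def reflection_def rho_def)

lemma translation_inj: "translation n = translation n' \<longleftrightarrow> n = n'"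
  and reflection_inj: "reflection n = reflection n' \<longleftrightarrow> n = n'"
  and translation_neq_reflection: "translation n \<noteq> reflection n'"
proof -
  show "translation n = translation n' \<longleftrightarrow> n = n'"
    using fst_rho(1)[of n] fst_rho(1)[of n'] by (metis add_left_cancel mult_cancel_left of_int_eq_iff zero_neq_numeral)
  show "reflection n = reflection n' \<longleftrightarrow> n = n'"
    using fst_rho(2)[of n] fst_rho(2)[of n'] by (metis add_left_cancel mult_cancel_left of_int_eq_iff zero_neq_numeral)
  have "1 + 4 * n \<noteq> - 1 + 4 * n'" by presburger
  then show "translation n \<noteq> reflection n'"
    using fst_rho(1)[of n] fst_rho(2)[of n'] by (metis of_int_eq_iff)
qed

lemma weyl_length_eqI:
  assumes "\<exists>ss. set ss \<subseteq> {s0, s1} \<and> length ss = p \<and> weyl_word ss = w"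
    and "\<And>ss. set ss \<subseteq> {s0, s1} \<Longrightarrow> weyl_word ss = w \<Longrightarrow> p \<le> length ss"
  shows "weyl_length w = p"
  unfolding weyl_length_def using assms by (intro Least_equality) auto

lemma weyl_length_translation: "weyl_length (translation n) = nat (2 * \<bar>n\<bar>)"
proof (rule weyl_length_eqI)
  show "\<exists>ss. set ss \<subseteq> {s0, s1} \<and> length ss = nat (2 * \<bar>n\<bar>) \<and> weyl_word ss = translation n"
    by (rule translation_word)
  fix ss assume "set ss \<subseteq> {s0, s1}" "weyl_word ss = translation n"
  with weyl_word_cases[of ss] have "2 * \<bar>n\<bar> \<le> int (length ss)"
    by (auto simp: translation_inj translation_neq_reflection)
  then show "nat (2 * \<bar>n\<bar>) \<le> length ss" by simp
qed

lemma weyl_length_reflection: "weyl_length (reflection n) = nat \<bar>2 * n - 1\<bar>"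
proof (rule weyl_length_eqI)
  show "\<exists>ss. set ss \<subseteq> {s0, s1} \<and> length ss = nat \<bar>2 * n - 1\<bar> \<and> weyl_word ss = reflection n"
    by (rule reflection_word)
  fix ss assume "set ss \<subseteq> {s0, s1}" "weyl_word ss = reflection n"
  with weyl_word_cases[of ss] have "\<bar>2 * n - 1\<bar> \<le> int (length ss)"
    by (auto simp: reflection_inj translation_neq_reflection translation_neq_reflection[symmetric])
  then show "nat \<bar>2 * n - 1\<bar> \<le> length ss" by simp
qed

lemma weyl_group_eq: "weyl_group = range translation \<union> range reflection"
proof
  show "weyl_group \<subseteq> range translation \<union> range reflection"
    unfolding weyl_group_def using weyl_word_cases by blast
  have "translation n \<in> weyl_group" "reflection n \<in> weyl_group" for n
  proof -
    obtain ss where "set ss \<subseteq> {s0, s1}" "weyl_word ss = translation n" using translation_word[of n] by (elim exE conjE)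
    then show "translation n \<in> weyl_group" unfolding weyl_group_def by (intro CollectI exI[of _ ss]) simp
    obtain ss where "set ss \<subseteq> {s0, s1}" "weyl_word ss = reflection n" using reflection_word[of n] by (elim exE conjE)
    then show "reflection n \<in> weyl_group" unfolding weyl_group_def by (intro CollectI exI[of _ ss]) simp
  qed
  then show "range translation \<union> range reflection \<subseteq> weyl_group" by blast
qed

text \<open>The elements that index the term of degree \<open>p\<close> of the resolution.\<close>

definition weyl_layer :: "nat \<Rightarrow> (weight \<Rightarrow> weight) set" where
  "weyl_layer p = {w \<in> weyl_group. weyl_length w = p}"

lemma weyl_layer_0: "weyl_layer 0 = {translation 0}"
proof -
  have "nat \<bar>2 * n - 1\<bar> \<noteq> 0" for n :: int by (simp, presburger)
  then show ?thesis
    by (auto simp: weyl_layer_def weyl_group_eq weyl_length_translation weyl_length_reflection)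
qed

lemma weyl_layer_even: "n > 0 \<Longrightarrow> weyl_layer (2 * n) = {translation (int n), translation (- int n)}"
proof -
  assume n: "n > 0"
  have "nat \<bar>2 * n' - 1\<bar> \<noteq> 2 * n" for n'
  proof
    assume "nat \<bar>2 * n' - 1\<bar> = 2 * n"
    then have "2 * n' - 1 = 2 * int n \<or> 2 * n' - 1 = - 2 * int n" by linarith
    then show False by presburger
  qed
  moreover have "nat (2 * \<bar>n'\<bar>) = 2 * n \<longleftrightarrow> n' = int n \<or> n' = - int n" for n' by auto
  ultimately show ?thesis
    by (auto simp: weyl_layer_def weyl_group_eq weyl_length_translation weyl_length_reflection)
qed

lemma weyl_layer_odd: "weyl_layer (2 * n + 1) = {reflection (int n + 1), reflection (- int n)}"
proof -
  have "nat (2 * \<bar>n'\<bar>) \<noteq> 2 * n + 1" for n'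
  proof
    assume "nat (2 * \<bar>n'\<bar>) = 2 * n + 1"
    then have "2 * \<bar>n'\<bar> = 2 * int n + 1" by linarith
    then show False by presburger
  qed
  moreover have "nat \<bar>2 * n' - 1\<bar> = 2 * n + 1 \<longleftrightarrow> n' = int n + 1 \<or> n' = - int n" for n' by auto
  ultimately show ?thesis
    by (auto simp: weyl_layer_def weyl_group_eq weyl_length_translation weyl_length_reflection)
qed

lemma shifted_translation: "shifted (translation n) (of_nat l, of_nat k, 0)
   = (of_int (int l + 2 * n * (int k + 2)), of_nat k, of_int (n * (int l + 1) + n ^ 2 * (int k + 2)))"
  by (simp add: shifted_def translation_def rho_def algebra_simps)

lemma shifted_reflection: "shifted (reflection n) (of_nat l, of_nat k, 0)
   = (of_int (- int l - 2 + 2 * n * (int k + 2)), of_nat k, of_int (- n * (int l + 1) + n ^ 2 * (int k + 2)))"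
  by (simp add: shifted_def reflection_def rho_def algebra_simps)


section \<open>Characters\<close>

text \<open>The series \<open>C\<^sub>j\<close> of the introduction.\<close>

definition mult_series :: "nat list \<Rightarrow> complex list \<Rightarrow> int \<Rightarrow> int fls" where
  "mult_series as zs j = fps_to_fls (Abs_fps (\<lambda>s. int (mult_dim as zs s j)))"

lemma mult_series_nth: "fls_nth (mult_series as zs j) t = int (mult_dim_int as zs t j)"
  by (simp add: mult_series_def mult_dim_int_def)

lemma mult_series_symmetric: "mult_series as zs (- j) = mult_series as zs j"
  by (simp add: mult_series_def mult_dim_symmetric)

lemma mult_series_zero: "\<bar>j\<bar> > int (sum_list as) \<Longrightarrow> mult_series as zs j = 0"
  by (rule fls_eqI) (simp add: mult_series_nth mult_dim_int_def mult_dim_zero)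

lemma kostka_mult_series: "kostka l as zs = mult_series as zs (int l) - mult_series as zs (int l + 2)"
proof (rule fls_eqI)
  fix t
  show "fls_nth (kostka l as zs) t = fls_nth (mult_series as zs (int l) - mult_series as zs (int l + 2)) t"
    using kostka_nth[of l as zs "nat t"] by (simp add: kostka_def mult_series_nth mult_dim_int_def)
qed

lemma ch_q0_coinvariants:
  assumes "finite I" and mu: "\<And>w. w \<in> I \<Longrightarrow> mu w = (of_int (i w), c, of_int (m w))"
  shows "ch_q0 (trivial_tensor_Un (tensor_mod (direct_sum I (\<lambda>w. verma (mu w))) (fusion as zs)))
    = (\<Sum>w\<in>I. fls_shift (- m w) (mult_series as zs (i w)))"
proof -
  interpret coinvariants "fusion as zs" "dsum UNIV (\<lambda>_. tensor_space as)" I mu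
    unfolding coinvariants_def by (rule lower_module_fusion)
  have "qdim (zero_weight s) (lower Q)
      = (\<Sum>w\<in>I. mult_dim_int as zs (s - m w) (i w))" for s
  proof (rule qdim_coinvariants[OF assms(1)])
    fix w assume w: "w \<in> I"
    show "has_qdim (graded_upper s w) (lower (fusion as zs)) (mult_dim_int as zs (s - m w) (i w))"
      unfolding graded_upper_def using has_qdim_fusion[where i = "i w" and m = "m w" and s = s and as = as and zs = zs]
      by (simp add: mu[OF w] hw_val_def)
  qed
  then have "ch_q0 Q = Abs_fls (\<lambda>s. \<Sum>w\<in>I. int (mult_dim_int as zs (s - m w) (i w)))"
    by (simp add: ch_q0_def zero_weight_def)
  also have "(\<lambda>s. \<Sum>w\<in>I. int (mult_dim_int as zs (s - m w) (i w))) = fls_nth (\<Sum>w\<in>I. fls_shift (- m w) (mult_series as zs (i w)))"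
    by (simp add: fun_eq_iff fls_nth_sum mult_series_nth)
  finally show ?thesis by (simp add: fls_nth_inverse)
qed

theorem proposition3p1:
  fixes k l :: nat and m :: "nat \<Rightarrow> nat" and zs :: "complex list"
  assumes "k \<ge> 1" and "l \<le> k"
    and "length zs = length (mult_list k m)" and "distinct zs"
  shows "summable (\<lambda>p. (-1) ^ p * ch_q0 (trivial_tensor_Un (tensor_mod (bgg_term l k p) (fusion (mult_list k m) zs))))
    \<and> summable (\<lambda>p. fls_X ^ ((k + 2) * p\<^sup>2 + (l + 1) * p) * kostka (2 * (k + 2) * p + l) (mult_list k m) zs)
    \<and> summable (\<lambda>p. if p > 0 then fls_X ^ ((k + 2) * p\<^sup>2 - (l + 1) * p)
                                   * kostka (2 * (k + 2) * p - l - 2) (mult_list k m) zs else 0)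
    \<and> suminf (\<lambda>p. (-1) ^ p * ch_q0 (trivial_tensor_Un (tensor_mod (bgg_term l k p) (fusion (mult_list k m) zs))))
      = suminf (\<lambda>p. fls_X ^ ((k + 2) * p\<^sup>2 + (l + 1) * p) * kostka (2 * (k + 2) * p + l) (mult_list k m) zs)
        - suminf (\<lambda>p. if p > 0 then fls_X ^ ((k + 2) * p\<^sup>2 - (l + 1) * p)
                              * kostka (2 * (k + 2) * p - l - 2) (mult_list k m) zs else 0)"
proof -
  define as where "as = mult_list k m"
  define C where "C = mult_series as zs"
  define A where "A n = fls_shift (- (n * (int l + 1) + n ^ 2 * (int k + 2))) (C (int l + 2 * n * (int k + 2)))" for n
  define B where "B n = fls_shift (- (- n * (int l + 1) + n ^ 2 * (int k + 2))) (C (- int l - 2 + 2 * n * (int k + 2)))" for n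
  define T where "T p = ch_q0 (trivial_tensor_Un (tensor_mod (bgg_term l k p) (fusion as zs)))" for p
  define R where "R p = fls_X ^ ((k + 2) * p\<^sup>2 + (l + 1) * p) * kostka (2 * (k + 2) * p + l) as zs" for p
  define R' where "R' p = (if p > 0 then fls_X ^ ((k + 2) * p\<^sup>2 - (l + 1) * p)
                                   * kostka (2 * (k + 2) * p - l - 2) as zs else 0)" for p
  have Csym: "C (- j) = C j" for j by (simp add: C_def mult_series_symmetric)
  have layer: "T p = (\<Sum>w\<in>weyl_layer p. fls_shift (- d w) (C (i w)))"
    if "finite (weyl_layer p)" "\<And>w. w \<in> weyl_layer p \<Longrightarrow> shifted w (of_nat l, of_nat k, 0) = (of_int (i w), of_nat k, of_int (d w))"
    for p i d
    unfolding T_def bgg_term_def C_def weyl_layer_def[symmetric] using that by (rule ch_q0_coinvariants)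
  \<comment> \<open>the values on \<open>h\<^sub>0\<close> and \<open>d\<close> of the shifted weight, as integers\<close>
  define ht where "ht w = (SOME id. shifted w (of_nat l, of_nat k, 0) = (of_int (fst id), of_nat k, of_int (snd id)))" for w
  have ht_eq: "ht w = (i, d)" if "shifted w (of_nat l, of_nat k, 0) = (of_int i, of_nat k, of_int d)" for w i d
    unfolding ht_def that by (rule some_equality) auto
  have ht_tr: "ht (translation n) = (int l + 2 * n * (int k + 2), n * (int l + 1) + n ^ 2 * (int k + 2))" for n
    by (rule ht_eq[OF shifted_translation])
  have ht_re: "ht (reflection n) = (- int l - 2 + 2 * n * (int k + 2), - n * (int l + 1) + n ^ 2 * (int k + 2))" for n
    by (rule ht_eq[OF shifted_reflection])
  have ht: "shifted w (of_nat l, of_nat k, 0) = (of_int (fst (ht w)), of_nat k, of_int (snd (ht w)))" if "w \<in> weyl_layer p" for w p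
    using that by (auto simp: weyl_layer_def weyl_group_eq ht_tr ht_re shifted_translation shifted_reflection)
  have T_sum: "T p = (\<Sum>w\<in>weyl_layer p. fls_shift (- snd (ht w)) (C (fst (ht w))))" if "finite (weyl_layer p)" for p
    using layer[OF that ht] by simp
  have T0: "T 0 = A 0"
    using T_sum[of 0] by (simp add: weyl_layer_0 ht_tr A_def)
  have Teven: "T (2 * n) = A (int n) + A (- int n)" if "n > 0" for n
    using T_sum[of "2 * n"] that by (simp add: weyl_layer_even ht_tr A_def translation_inj)
  have Todd: "T (2 * n + 1) = B (int n + 1) + B (- int n)" for n
    using T_sum[of "2 * n + 1"] by (simp add: weyl_layer_odd[simplified] ht_re B_def reflection_inj)
  have R: "R p = A (int p) - B (- int p)" for p
  proof -
    have e: "int ((k + 2) * p\<^sup>2 + (l + 1) * p) = int p * (int l + 1) + int p ^ 2 * (int k + 2)"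
      by (simp add: algebra_simps)
    have a: "int (2 * (k + 2) * p + l) = int l + 2 * int p * (int k + 2)"
      by (simp add: algebra_simps)
    have b: "C (int l + 2 * int p * (int k + 2) + 2) = C (- int l - 2 + 2 * (- int p) * (int k + 2))"
      using Csym[of "int l + 2 * int p * (int k + 2) + 2"] by (simp add: algebra_simps)
    show ?thesis
      unfolding R_def kostka_mult_series fls_X_power_times_conv_shift e a C_def[symmetric] b fls_shift_minus
      by (simp add: A_def B_def)
  qed
  have R': "R' p = (if p > 0 then B (int p) - A (- int p) else 0)" for p
  proof (cases "p > 0")
    case True
    have "(l + 1) * p \<le> (k + 2) * p" using assms(2) by (intro mult_right_mono) auto
    also have "\<dots> \<le> (k + 2) * p\<^sup>2" using True by (intro mult_left_mono) (auto simp: power2_eq_square)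
    finally have e: "int ((k + 2) * p\<^sup>2 - (l + 1) * p) = - int p * (int l + 1) + int p ^ 2 * (int k + 2)"
      by (simp add: of_nat_diff algebra_simps)
    have "l + 2 \<le> 2 * (k + 2) * 1" using assms(2) by simp
    also have "\<dots> \<le> 2 * (k + 2) * p" using True by (intro mult_left_mono) auto
    finally have a: "int (2 * (k + 2) * p - l - 2) = - int l - 2 + 2 * int p * (int k + 2)"
      by (simp add: of_nat_diff algebra_simps)
    have b: "C (- int l - 2 + 2 * int p * (int k + 2) + 2) = C (int l + 2 * (- int p) * (int k + 2))"
      using Csym[of "- int l - 2 + 2 * int p * (int k + 2) + 2"] by (simp add: algebra_simps)
    have "R' p = fls_X ^ ((k + 2) * p\<^sup>2 - (l + 1) * p) * kostka (2 * (k + 2) * p - l - 2) as zs"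
      using True by (simp add: R'_def)
    also have "\<dots> = B (int p) - A (- int p)"
      unfolding kostka_mult_series fls_X_power_times_conv_shift e a C_def[symmetric] b fls_shift_minus
      by (simp add: A_def B_def)
    finally show ?thesis using True by simp
  qed (simp add: R'_def)
  \<comment> \<open>for \<open>\<bar>n\<bar> \<ge> M\<close> the weights that occur in \<open>A n\<close> and \<open>B n\<close> exceed those of the fusion product\<close>
  define M where "M = Suc (sum_list as)"
  have large: "2 * (int k + 2) * \<bar>n\<bar> \<ge> int k + 2 + int M" if "\<bar>n\<bar> \<ge> int M" for n
  proof -
    define x where "x = (int k + 2) * \<bar>n\<bar>"
    have "(int k + 2) * 1 \<le> x" unfolding x_def using that by (intro mult_left_mono) (auto simp: M_def)
    then have 1: "int k + 2 \<le> x" by simp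
    have "1 * \<bar>n\<bar> \<le> x" unfolding x_def by (intro mult_right_mono) auto
    then have 2: "int M \<le> x" using that by simp
    have "2 * (int k + 2) * \<bar>n\<bar> = 2 * x" by (simp add: x_def)
    then show ?thesis using 1 2 by simp
  qed
  have abs: "\<bar>2 * n * (int k + 2)\<bar> = 2 * (int k + 2) * \<bar>n\<bar>" for n
    by (simp add: abs_mult)
  have A0: "A n = 0" if "\<bar>n\<bar> \<ge> int M" for n
  proof -
    have "\<bar>int l + 2 * n * (int k + 2)\<bar> > int (sum_list as)"
      using large[OF that] abs[of n] assms(2) unfolding M_def by linarith
    then show ?thesis by (simp add: A_def C_def mult_series_zero)
  qed
  have B0: "B n = 0" if "\<bar>n\<bar> \<ge> int M" for n
  proof -
    have "\<bar>- int l - 2 + 2 * n * (int k + 2)\<bar> > int (sum_list as)"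
      using large[OF that] abs[of n] assms(2) unfolding M_def by linarith
    then show ?thesis by (simp add: B_def C_def mult_series_zero)
  qed
  have T_zero: "(- 1) ^ p * T p = 0" if "p \<notin> {..<2 * M}" for p
  proof (cases "even p")
    case True
    then obtain n where "p = 2 * n" by blast
    with that have "T p = 0" using Teven[of n] by (simp add: M_def A0)
    then show ?thesis by simp
  next
    case False
    then obtain n where "p = 2 * n + 1" using oddE by blast
    with that have "T p = 0" using Todd[of n] by (simp add: M_def B0)
    then show ?thesis by simp
  qed
  have R_zero: "R p = 0" if "p \<notin> {..<M}" for p
    using that by (simp add: R A0 B0)
  have R'_zero: "R' p = 0" if "p \<notin> {..<M}" for p
    using that by (simp add: R' A0 B0)
  \<comment> \<open>the layers up to \<open>2n + 1\<close> contain \<open>B (n + 1)\<close>, whose partner belongs to the next summand on the right\<close>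
  have fin: "(\<Sum>p<2 * Suc n. (- 1) ^ p * T p) + B (int (Suc n)) = (\<Sum>p<Suc n. R p) - (\<Sum>p<Suc n. R' p)" for n
  proof (induction n)
    case 0
    show ?case using Todd[of 0] by (simp add: T0 R R' numeral_2_eq_2)
  next
    case (Suc n)
    have s: "(\<Sum>p<2 * Suc (Suc n). (- 1) ^ p * T p) = (\<Sum>p<2 * Suc n. (- 1) ^ p * T p) + T (2 * Suc n) - T (2 * Suc n + 1)"
      by simp
    have e: "T (2 * Suc n) = A (int (Suc n)) + A (- int (Suc n))" by (rule Teven) simp
    have o: "T (2 * Suc n + 1) = B (int (Suc (Suc n))) + B (- int (Suc n))"
      using Todd[of "Suc n"] by (simp add: add.commute)
    have r: "(\<Sum>p<Suc (Suc n). R p) = (\<Sum>p<Suc n. R p) + (A (int (Suc n)) - B (- int (Suc n)))"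
      by (simp add: R)
    have r': "(\<Sum>p<Suc (Suc n). R' p) = (\<Sum>p<Suc n. R' p) + (B (int (Suc n)) - A (- int (Suc n)))"
      by (simp add: R')
    define S Z Z' where "S = (\<Sum>p<2 * Suc n. (- 1) ^ p * T p)" and "Z = (\<Sum>p<Suc n. R p)" and "Z' = (\<Sum>p<Suc n. R' p)"
    have IH: "Z = S + B (int (Suc n)) + Z'" using Suc.IH unfolding S_def Z_def Z'_def by (simp only: eq_diff_eq)
    show ?case
      unfolding s e o r r' S_def[symmetric] Z_def[symmetric] Z'_def[symmetric] IH by (simp add: algebra_simps)
  qed
  have "(\<Sum>p<2 * M. (- 1) ^ p * T p) = (\<Sum>p<M. R p) - (\<Sum>p<M. R' p)"
    using fin[of "sum_list as"] B0[of "int M"] by (simp add: M_def)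
  moreover have "suminf (\<lambda>p. (- 1) ^ p * T p) = (\<Sum>p<2 * M. (- 1) ^ p * T p)"
    by (rule suminf_finite[OF finite_lessThan T_zero])
  moreover have "suminf R = (\<Sum>p<M. R p)"
    by (rule suminf_finite[OF finite_lessThan R_zero])
  moreover have "suminf R' = (\<Sum>p<M. R' p)"
    by (rule suminf_finite[OF finite_lessThan R'_zero])
  moreover have "summable (\<lambda>p. (- 1) ^ p * T p)"
    by (rule summable_finite[OF finite_lessThan T_zero])
  moreover have "summable R"
    by (rule summable_finite[OF finite_lessThan R_zero])
  moreover have "summable R'"
    by (rule summable_finite[OF finite_lessThan R'_zero])
  ultimately show ?thesis
    unfolding T_def R_def R'_def as_def by simp
qed

end
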